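(* For every $N$ and every $z\in\mathbb{C}^+$ there exists a unique solution $t_N(z)$ of the equation $$t_N(z)=\frac1M\mathrm{Tr}\left[R_N\left(-zI_M-\frac{z c_N t_N(z)}{1-z c_N^2t_N(z)^2}R_N\right)^{-1}\right]$$ satisfying $t_N(z)\in\mathbb{C}^+$ and $z t_N(z)\in\mathbb{C}^+$. The function $z\mapsto t_N(z)$ belongs to $\mathcal{S}(\mathbb{R}^+)$, and the associated positive measure $\mu_N$ verifies $$\mu_N(\mathbb{R}^+)=\frac1M\mathrm{Tr}R_N,\qquad \int_{\mathbb{R}^+}\lambda\,d\mu_N(\lambda)=c_N\,\frac1M\mathrm{Tr}R_N\;\frac1M\mathrm{Tr}R_N^2 .$$ Moreover, there exist nice constants $\beta$ and $\kappa$ such that $$\frac{1}{\left|1-z\left(c_Nt_N(z)\right)^2\right|}\le\frac{\kappa(\beta^2+|z|^2)^2}{(\mathrm{Im}\,z)^3}$$ for each $z\in\mathbb{C}^+$ and each $N$. Finally, the $M\times M$ matrix valued function $$T_N(z)=-\left(zI_M+\frac{z c_Nt_N(z)}{1-z c_N^2t_N(z)^2}R_N\right)^{-1}$$ belongs to $\mathcal{S}_M(\mathbb{R}^+)$, and the associated $M\times M$ positive matrix-valued measure $\nu_N^T$ verifies $\nu_N^T(\mathbb{R}^+)=I_M$ and $\mu_N=\frac1M\mathrm{Tr}\,R_N\nu_N^T$.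
   Context: $L\ge 1$ is a fixed integer, $M=M(N)$ are integers such that $c_N=ML/N\to c_*>0$ as $N\to\infty$. $(R_N)_{N\ge1}$ are $M\times M$ Hermitian positive definite matrices with $aI_M\le R_N<bI_M$ for all $N$, where $a,b>0$ do not depend on $N$. $\mathbb{C}^+=\{z:\mathrm{Im}\,z>0\}$, $\mathbb{R}^+=[0,+\infty)$. For a Borel set $A\subset\mathbb{R}$, $\mathcal{S}_M(A)$ is the set of Stieltjes transforms $z\mapsto\int\frac{d\mu(\lambda)}{\lambda-z}$ of $M\times M$ matrix-valued positive finite measures $\mu$ carried by $A$, and $\mathcal{S}(A)=\mathcal{S}_1(A)$. A nice constant is a positive deterministic constant that does not depend on $M$, $N$ or $z$. *)

theory Defs
  imports
    "HOL-Analysis.Set_Integral"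
    "Jordan_Normal_Form.Gauss_Jordan_Elimination"
    "Jordan_Normal_Form.Schur_Decomposition"
begin

definition mat_trace :: "'a::comm_monoid_add mat \<Rightarrow> 'a" where
  "mat_trace A = (\<Sum>i<dim_row A. A $$ (i, i))"

(* mat_inverse is option-valued; mat_inv A is only meaningful for invertible A. *)
definition mat_inv :: "'a::field mat \<Rightarrow> 'a mat" where
  "mat_inv A = the (mat_inverse A)"

(* (A *\<^sub>v x) \<bullet>c x is the quadratic form x^* A x. *)
definition psd_mat :: "nat \<Rightarrow> complex mat \<Rightarrow> bool" where
  "psd_mat M A \<longleftrightarrow> A \<in> carrier_mat M M \<and> mat_adjoint A = A \<and>
     (\<forall>x\<in>carrier_vec M. 0 \<le> Re ((A *\<^sub>v x) \<bullet>c x))"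

definition pd_mat :: "nat \<Rightarrow> complex mat \<Rightarrow> bool" where
  "pd_mat M A \<longleftrightarrow> A \<in> carrier_mat M M \<and> mat_adjoint A = A \<and>
     (\<forall>x\<in>carrier_vec M. x \<noteq> 0\<^sub>v M \<longrightarrow> 0 < Re ((A *\<^sub>v x) \<bullet>c x))"

(* Finite positive M x M matrix-valued measures on the Borel sets of the real line.
   Only the values on Borel sets matter; \<nu> {} = 0 follows from countable additivity,
   and finiteness is built in since the values are matrices. *)
definition pos_mat_measure :: "nat \<Rightarrow> (real set \<Rightarrow> complex mat) \<Rightarrow> bool" where
  "pos_mat_measure M \<nu> \<longleftrightarrow>
     (\<forall>B\<in>sets borel. psd_mat M (\<nu> B)) \<and>
     (\<forall>F :: nat \<Rightarrow> real set. range F \<subseteq> sets borel \<longrightarrow> disjoint_family F \<longrightarrow>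
        (\<forall>i<M. \<forall>j<M. (\<lambda>n. \<nu> (F n) $$ (i, j)) sums (\<nu> (\<Union>n. F n) $$ (i, j))))"

(* The finite positive measure B \<mapsto> x^* \<nu>(B) x. *)
definition quad_measure :: "(real set \<Rightarrow> complex mat) \<Rightarrow> complex vec \<Rightarrow> real measure" where
  "quad_measure \<nu> x =
     measure_of UNIV (sets borel) (\<lambda>B. ennreal (Re ((\<nu> B *\<^sub>v x) \<bullet>c x)))"

(* S = \<integral> f d\<nu>, understood through x^* S x = \<integral> f d(x^* \<nu> x) for all x. By polarization this
   determines S, entry by entry, as the integral of f against the complex measures \<nu>_ij. *)
definition has_mat_integral ::
  "nat \<Rightarrow> (real set \<Rightarrow> complex mat) \<Rightarrow> (real \<Rightarrow> complex) \<Rightarrow> complex mat \<Rightarrow> bool" where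
  "has_mat_integral M \<nu> f S \<longleftrightarrow> S \<in> carrier_mat M M \<and>
     (\<forall>x\<in>carrier_vec M. has_bochner_integral (quad_measure \<nu> x) f ((S *\<^sub>v x) \<bullet>c x))"

(* f belongs to S(A) iff it has an associated measure in the following sense; Stieltjes
   transforms are regarded as functions on the open upper half-plane. *)
definition stieltjes_measure_of :: "real set \<Rightarrow> (complex \<Rightarrow> complex) \<Rightarrow> real measure \<Rightarrow> bool" where
  "stieltjes_measure_of A f \<mu> \<longleftrightarrow>
     sets \<mu> = sets borel \<and> finite_measure \<mu> \<and> emeasure \<mu> (- A) = 0 \<and>
     (\<forall>z. 0 < Im z \<longrightarrow> has_bochner_integral \<mu> (\<lambda>l. 1 / (complex_of_real l - z)) (f z))"

definition stieltjes_mat_measure_of ::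
  "nat \<Rightarrow> real set \<Rightarrow> (complex \<Rightarrow> complex mat) \<Rightarrow> (real set \<Rightarrow> complex mat) \<Rightarrow> bool" where
  "stieltjes_mat_measure_of M A F \<nu> \<longleftrightarrow>
     pos_mat_measure M \<nu> \<and> \<nu> (- A) = 0\<^sub>m M M \<and>
     (\<forall>z. 0 < Im z \<longrightarrow> has_mat_integral M \<nu> (\<lambda>l. 1 / (complex_of_real l - z)) (F z))"

(* The equation is required to be meaningful (nonzero denominator, invertible matrix), so
   that neither division by zero nor mat_inv of a singular matrix can create solutions. *)
definition canonical_equation ::
  "nat \<Rightarrow> complex mat \<Rightarrow> real \<Rightarrow> complex \<Rightarrow> complex \<Rightarrow> bool" where
  "canonical_equation M R c z t \<longleftrightarrow>
     (let d = 1 - z * (of_real c)\<^sup>2 * t\<^sup>2;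
          Q = (- z) \<cdot>\<^sub>m 1\<^sub>m M - (z * of_real c * t / d) \<cdot>\<^sub>m R
      in d \<noteq> 0 \<and> invertible_mat Q \<and> t = 1 / of_nat M * mat_trace (R * mat_inv Q))"

definition canonical_solution ::
  "nat \<Rightarrow> complex mat \<Rightarrow> real \<Rightarrow> complex \<Rightarrow> complex \<Rightarrow> bool" where
  "canonical_solution M R c z t \<longleftrightarrow>
     canonical_equation M R c z t \<and> 0 < Im t \<and> 0 < Im (z * t)"

definition t_fun :: "nat \<Rightarrow> complex mat \<Rightarrow> real \<Rightarrow> complex \<Rightarrow> complex" where
  "t_fun M R c z = (THE t. canonical_solution M R c z t)"

definition T_fun :: "nat \<Rightarrow> complex mat \<Rightarrow> real \<Rightarrow> complex \<Rightarrow> complex mat" where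
  "T_fun M R c z =
     (let t = t_fun M R c z
      in - mat_inv (z \<cdot>\<^sub>m 1\<^sub>m M + (z * of_real c * t / (1 - z * (of_real c)\<^sup>2 * t\<^sup>2)) \<cdot>\<^sub>m R))"

end

theory Submission
  imports Defs
    "HOL-Probability.Helly_Selection"
    "HOL-Probability.Giry_Monad"
    "HOL-Complex_Analysis.Conformal_Mappings"
    "HOL-Real_Asymp.Real_Asymp"
    "Jordan_Normal_Form.Spectral_Radius"
begin

text \<open>
  A unitary diagonalization of \<open>R\<close> reduces everything to its eigenvalues \<open>r k\<close>. For \<open>z\<close> in the upper
  half-plane, the two sign conditions on \<open>t\<close> say that \<open>t\<close> lies in an open convex cone, and
  \<open>j x = - 1 / (z x)\<close> is an involution of this cone. The equation becomes
  \<open>t = \<Phi> z t\<close>, where \<open>\<Phi> z t\<close> is the average of \<open>r k * S k\<close> with \<open>S k = j (1 + r k * P)\<close> and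
  \<open>P = j (c t + j (c t))\<close>. All these operations preserve the cone.

  Existence follows from Brouwer's theorem (\<open>\<Phi>_fixed_point_exists\<close>), as \<open>\<Phi> z\<close> is bounded. For
  uniqueness, the imaginary parts of \<open>t\<close> and \<open>z t\<close> at a fixed point satisfy a positive linear system,
  which forces a number \<open>\<delta> z t\<close> to be less than \<open>1\<close> (\<open>\<delta>_less_1\<close>). By the Cauchy-Schwarz inequality, the
  difference quotient of \<open>\<Phi> z\<close> between two fixed points is at most the geometric mean of their two
  values of \<open>\<delta>\<close>, hence less than \<open>1\<close>, so the fixed points coincide. The same estimate with two different parameters \<open>z\<close>
  and \<open>w\<close> shows that the solution \<open>T z\<close> is holomorphic in \<open>z\<close> (\<open>T_holomorphic\<close>).

  Each \<open>S k\<close>, taken at \<open>T z\<close>, is then holomorphic with positive imaginary part, bounded by \<open>1 / Im z\<close>, and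
  asymptotic to \<open>- 1 / z\<close> at \<open>\<i> \<infinity>\<close>. Such a function is the Stieltjes transform of a probability measure
  (\<open>stieltjes_representation\<close>, proved with the Poisson formula and Helly's selection theorem). This
  measure lives on the nonnegative half-line because \<open>z * S k\<close> has positive imaginary part as well, and
  one more term of the expansion at \<open>\<i> \<infinity>\<close> gives its first moment (\<open>S_spectral_measure\<close>).
  The matrix-valued measure has these distributions on its diagonal in the eigenbasis of \<open>R\<close>, and the
  scalar one is their average with weights \<open>r k\<close>. The first moments keep a fixed part of the mass in a
  bounded interval, uniformly in the size of the matrix; this bounds \<open>Im t\<close> from below, and with it
  the denominator \<open>1 - z c\<^sup>2 t\<^sup>2\<close> (\<open>denominator_bound\<close>).
\<close>

section \<open>Stieltjes transforms of probability measures\<close>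

lemma poisson_kernel_has_integral:
  fixes u y :: real
  assumes "y > 0"
  shows "has_bochner_integral lborel (\<lambda>x. y / ((x - u)\<^sup>2 + y\<^sup>2)) pi"
proof -
  let ?f = "\<lambda>x. y / ((x - u)\<^sup>2 + y\<^sup>2)" and ?F = "\<lambda>x. arctan ((x - u) / y)"
  have pos: "(x - u)\<^sup>2 + y\<^sup>2 > 0" for x
    using assms by (simp add: add_nonneg_pos)
  have D: "DERIV ?F x :> ?f x" for x
  proof -
    have "DERIV ?F x :> inverse (1 + ((x - u) / y)\<^sup>2) * (1 / y)"
      using assms by (auto intro!: derivative_eq_intros)
    moreover have "inverse (1 + ((x - u) / y)\<^sup>2) * (1 / y) = ?f x"
      using assms pos[of x] by (simp add: divide_simps power2_eq_square)
    ultimately show ?thesis by simp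
  qed
  have C: "isCont ?f x" for x
    using pos[of x] by (intro continuous_intros) auto
  have top: "filterlim (\<lambda>x. (x - u) / y) at_top at_top"
    using assms by real_asymp
  have bot: "filterlim (\<lambda>x. (x - u) / y) at_bot at_bot"
    using assms by real_asymp
  have A: "((?F \<circ> real_of_ereal) \<longlongrightarrow> -(pi/2)) (at_right (-\<infinity>))"
    unfolding ereal_tendsto_simps
    by (rule filterlim_compose[OF tendsto_arctan_at_bot bot])
  have B: "((?F \<circ> real_of_ereal) \<longlongrightarrow> pi/2) (at_left \<infinity>)"
    unfolding ereal_tendsto_simps
    by (rule filterlim_compose[OF tendsto_arctan_at_top top])
  note * = interval_integral_FTC_nonneg[of "-\<infinity>" "\<infinity>" ?F ?f, OF _ D C _ A B]
  have "set_integrable lborel (einterval (-\<infinity>) \<infinity>) ?f" "(LBINT x=-\<infinity>..\<infinity>. ?f x) = pi/2 - -(pi/2)"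
    by (rule *; use assms pos in \<open>auto intro!: divide_nonneg_pos\<close>)+
  then show ?thesis
    by (simp add: has_bochner_integral_iff set_integrable_def interval_lebesgue_integral_def
        set_lebesgue_integral_def)
qed

text \<open>
  On the real line, the difference of the Cauchy kernels at \<open>z\<close> and \<open>cnj z\<close> is \<open>2 \<i>\<close> times the
  kernel of the formula, and it decays like \<open>1 / \<bar>w\<bar>\<^sup>2\<close>. Multiplied by
  \<open>g w - g z\<close> it has no pole in the closed upper half-plane, so its integral over a half disc
  vanishes by Cauchy's theorem for convex sets, and boundedness of \<open>g\<close> makes the arc negligible.
  Subtracting \<open>g z\<close> first replaces the residue computation by the known mass of the kernel.
\<close>

lemma poisson_formula_half_plane:
  fixes g :: "complex \<Rightarrow> complex"
  assumes hol: "g holomorphic_on {w. Im w > -e}" and e: "e > 0"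
    and bdd: "\<And>w. Im w \<ge> 0 \<Longrightarrow> cmod (g w) \<le> B" and y: "y > 0"
  shows "has_bochner_integral lborel
           (\<lambda>x. (y / ((x - u)\<^sup>2 + y\<^sup>2)) *\<^sub>R g (of_real x)) (of_real pi * g (Complex u y))"
proof -
  define z where "z = Complex u y"
  define d where "d = min e y / 2"
  define S where "S = {w. Im w > -d}"
  have d: "0 < d" "d < e" "d < y" using e y by (auto simp: d_def)
  have S: "open S" "convex S"
    unfolding S_def by (auto simp: open_halfspace_Im_gt convex_halfspace_Im_gt)
  have Ssub: "S \<subseteq> {w. Im w > -e}" using d by (auto simp: S_def)
  have zS: "z \<in> S" using y d by (auto simp: S_def z_def)
  have B0: "B \<ge> 0" using order_trans[OF norm_ge_zero bdd[of 0]] by simp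
  \<comment> \<open>the difference quotient of \<open>g\<close> at \<open>z\<close>, continued holomorphically across \<open>z\<close>\<close>
  define k where "k w = (if w = z then deriv g z else (g w - g z) / (w - z))" for w
  define h where "h w = k w * (2 * \<i> * y / (w - cnj z))" for w
  have holg: "g holomorphic_on S" using hol Ssub by (rule holomorphic_on_subset)
  have "k holomorphic_on S"
  proof -
    have "(\<lambda>w. if w = z then deriv (\<lambda>w. g w - g z) z
           else (g w - g z) / (w - z) - (g z - g z) / (w - z)) holomorphic_on S"
      by (rule pole_theorem) (use holg zS S in \<open>auto intro!: holomorphic_intros simp: interior_open\<close>)
    moreover have "deriv (\<lambda>w. g w - g z) z = deriv g z"
      using holomorphic_derivI[OF holg S(1) zS, of UNIV]
      by (intro DERIV_imp_deriv) (auto intro!: derivative_eq_intros)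
    ultimately show ?thesis by (simp add: k_def[abs_def] cong: if_cong)
  qed
  moreover have cz: "w - cnj z \<noteq> 0" if "w \<in> S" for w
    using that d by (auto simp: S_def z_def complex_eq_iff)
  ultimately have holh: "h holomorphic_on S"
    unfolding h_def by (intro holomorphic_intros) auto
  define H where "H x = (2 * y / ((x - u)\<^sup>2 + y\<^sup>2)) *\<^sub>R (\<i> * (g (of_real x) - g z))" for x
  have pos: "(x - u)\<^sup>2 + y\<^sup>2 > 0" for x
    using y by (simp add: add_nonneg_pos)
  have hH: "h (of_real x) = H x" for x
  proof -
    have nz: "of_real x \<noteq> z" using y by (auto simp: z_def complex_eq_iff)
    have "(of_real x - z) * (of_real x - cnj z) = of_real ((x - u)\<^sup>2 + y\<^sup>2)"
      by (auto simp: z_def complex_eq_iff power2_eq_square algebra_simps)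
    then have "h (of_real x) = (g (of_real x) - g z) * (2 * \<i> * y) / of_real ((x - u)\<^sup>2 + y\<^sup>2)"
      using nz by (simp add: h_def k_def)
    then show ?thesis by (simp add: H_def scaleR_conv_of_real)
  qed
  have contg: "continuous_on UNIV (\<lambda>x::real. g (of_real x))"
  proof (rule continuous_on_compose2[OF holomorphic_on_imp_continuous_on[OF holg]])
    show "range complex_of_real \<subseteq> S" using d by (auto simp: S_def)
  qed (intro continuous_intros)
  have gmeas [measurable]: "(\<lambda>x::real. g (of_real x)) \<in> borel_measurable borel"
    using contg by (rule borel_measurable_continuous_onI)
  have pk: "integrable lborel (\<lambda>x. y / ((x - u)\<^sup>2 + y\<^sup>2))"
    using poisson_kernel_has_integral[OF y] by (simp add: has_bochner_integral_iff)
  have intg: "integrable lborel (\<lambda>x. (y / ((x - u)\<^sup>2 + y\<^sup>2)) *\<^sub>R g (of_real x))"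
  proof (rule Bochner_Integration.integrable_bound[of _ "\<lambda>x. B * (y / ((x - u)\<^sup>2 + y\<^sup>2))"])
    show "integrable lborel (\<lambda>x. B * (y / ((x - u)\<^sup>2 + y\<^sup>2)))" by (rule integrable_mult_right[OF pk])
    show "AE x in lborel. norm ((y / ((x - u)\<^sup>2 + y\<^sup>2)) *\<^sub>R g (complex_of_real x))
         \<le> norm (B * (y / ((x - u)\<^sup>2 + y\<^sup>2)))"
      using bdd B0 y pos by (intro AE_I2) (auto simp: abs_mult divide_simps mult_right_mono)
  qed measurable
  have intc: "has_bochner_integral lborel (\<lambda>x. (y / ((x - u)\<^sup>2 + y\<^sup>2)) *\<^sub>R g z) (pi *\<^sub>R g z)"
    by (rule has_bochner_integral_scaleR_left) (rule poisson_kernel_has_integral[OF y])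
  have Heq: "H x = 2 * \<i> * ((y / ((x - u)\<^sup>2 + y\<^sup>2)) *\<^sub>R g (of_real x) - (y / ((x - u)\<^sup>2 + y\<^sup>2)) *\<^sub>R g z)" for x
    unfolding H_def scaleR_diff_right[symmetric] by (simp add: scaleR_conv_of_real)
  have intH: "integrable lborel H"
    unfolding Heq[abs_def]
    using intg intc by (intro integrable_mult_right Bochner_Integration.integrable_diff) (auto simp: has_bochner_integral_iff)
  define R where "R n = cmod z + 1 + real n" for n :: nat
  have Rpos: "R n > 0" "R n > cmod z" for n
    by (auto simp: R_def add_nonneg_pos intro: add_pos_nonneg)
  have bound: "cmod (LINT x:{-R n..R n}|lborel. H x) \<le> 2 * B * (2 * y) / (R n - cmod z)\<^sup>2 * R n * (pi - 0)" for n
  proof -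
    let ?g = "linepath (complex_of_real (- R n)) (of_real (R n)) +++ part_circlepath 0 (R n) 0 pi"
    have circ: "path_image (part_circlepath 0 (R n) 0 pi) \<subseteq> {w. Im w \<ge> 0 \<and> cmod w = R n}"
      using Rpos[of n] by (auto simp: path_image_part_circlepath norm_mult sin_ge_zero Im_exp)
    have line: "path_image (linepath (complex_of_real (- R n)) (of_real (R n))) \<subseteq> {w. Im w = 0}"
      by (auto simp: closed_segment_def)
    have hint: "h contour_integrable_on linepath (complex_of_real (- R n)) (of_real (R n))"
      "h contour_integrable_on part_circlepath 0 (R n) 0 pi"
      by (rule contour_integrable_holomorphic_simple[OF holh S(1)];
          use circ line d in \<open>auto simp: S_def\<close>)+
    have "(h has_contour_integral 0) ?g"
    proof (rule Cauchy_theorem_convex_simple[OF holh S(2)])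
      show "path_image ?g \<subseteq> S"
        using circ line d by (subst path_image_join) (auto simp: S_def)
    qed auto
    then have "contour_integral (linepath (complex_of_real (- R n)) (of_real (R n))) h
        = - contour_integral (part_circlepath 0 (R n) 0 pi) h"
      using hint contour_integral_unique[of h 0 ?g] by (simp add: eq_neg_iff_add_eq_0)
    moreover have "contour_integral (linepath (complex_of_real (- R n)) (of_real (R n))) h
        = integral {-R n..R n} H"
      using Rpos[of n] by (subst contour_integral_linepath_Reals_eq) (auto simp: hH)
    moreover have "(LINT x:{-R n..R n}|lborel. H x) = integral {-R n..R n} H"
      using intH by (intro set_borel_integral_eq_integral) (auto simp: set_integrable_def intro!: integrable_mult_indicator)
    moreover have "cmod (contour_integral (part_circlepath 0 (R n) 0 pi) h)
        \<le> 2 * B * (2 * y) / (R n - cmod z)\<^sup>2 * R n * (pi - 0)"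
    proof (rule has_contour_integral_bound_part_circlepath[OF has_contour_integral_integral[OF hint(2)]])
      fix w assume "w \<in> path_image (part_circlepath 0 (R n) 0 pi)"
      then have w: "Im w \<ge> 0" "cmod w = R n" using circ by auto
      have nz: "w \<noteq> z" using w Rpos(2)[of n] by auto
      have *: "cmod (w - z) \<ge> R n - cmod z" "cmod (w - cnj z) \<ge> R n - cmod z"
        using w norm_triangle_ineq2[of w z] norm_triangle_ineq2[of w "cnj z"] by auto
      have "cmod (g w - g z) \<le> 2 * B"
        using bdd[of w] bdd[of z] w y norm_triangle_ineq4[of "g w" "g z"] by (auto simp: z_def)
      moreover have "(R n - cmod z) * (R n - cmod z) \<le> cmod (w - z) * cmod (w - cnj z)"
        using * Rpos(2)[of n] by (intro mult_mono) auto
      ultimately have "cmod (g w - g z) * (2 * y) / (cmod (w - z) * cmod (w - cnj z))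
          \<le> 2 * B * (2 * y) / ((R n - cmod z) * (R n - cmod z))"
        using y B0 Rpos(2)[of n] by (intro frac_le mult_right_mono mult_nonneg_nonneg) auto
      then show "cmod (h w) \<le> 2 * B * (2 * y) / (R n - cmod z)\<^sup>2"
        using nz y by (simp add: h_def k_def norm_mult norm_divide power2_eq_square)
    qed (use B0 y Rpos[of n] in auto)
    ultimately show ?thesis by (metis norm_minus_cancel)
  qed
  have lim0: "(\<lambda>n. LINT x:{-R n..R n}|lborel. H x) \<longlonglongrightarrow> 0"
  proof (rule Lim_null_comparison)
    show "\<forall>\<^sub>F n in sequentially. cmod (LINT x:{-R n..R n}|lborel. H x) \<le> 2 * B * (2 * y) / (R n - cmod z)\<^sup>2 * R n * (pi - 0)"
      using bound by simp
    show "(\<lambda>n. 2 * B * (2 * y) / (R n - cmod z)\<^sup>2 * R n * (pi - 0)) \<longlonglongrightarrow> 0"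
      unfolding R_def by real_asymp
  qed
  have "(\<lambda>n. LINT x:{-R n..R n}|lborel. H x) \<longlonglongrightarrow> (LINT x|lborel. H x)"
    unfolding set_lebesgue_integral_def
  proof (rule integral_dominated_convergence[where w="\<lambda>x. norm (H x)"])
    show "AE x in lborel. (\<lambda>n. indicat_real {- R n..R n} x *\<^sub>R H x) \<longlonglongrightarrow> H x"
    proof (rule AE_I2)
      fix x
      obtain m :: nat where m: "\<bar>x\<bar> \<le> real m" using real_arch_simple by blast
      have "\<forall>\<^sub>F n in sequentially. indicat_real {- R n..R n} x *\<^sub>R H x = H x"
        using eventually_ge_at_top[of m]
      proof eventually_elim
        case (elim n)
        have "\<bar>x\<bar> \<le> R n" using m elim norm_ge_zero[of z] unfolding R_def
          by (smt (verit) of_nat_mono)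
        then show ?case by (auto simp: abs_le_iff)
      qed
      then show "(\<lambda>n. indicat_real {- R n..R n} x *\<^sub>R H x) \<longlonglongrightarrow> H x"
        by (rule tendsto_eventually)
    qed
  qed (use intH in \<open>auto split: split_indicator\<close>)
  with lim0 have "(LINT x|lborel. H x) = 0"
    using LIMSEQ_unique by blast
  moreover have "has_bochner_integral lborel H
      (2 * \<i> * ((LINT x|lborel. (y / ((x - u)\<^sup>2 + y\<^sup>2)) *\<^sub>R g (of_real x)) - pi *\<^sub>R g z))"
    unfolding Heq[abs_def]
    by (intro has_bochner_integral_mult_right has_bochner_integral_diff intc has_bochner_integral_integrable intg)
  then have "(LINT x|lborel. H x) = 2 * \<i> * ((LINT x|lborel. (y / ((x - u)\<^sup>2 + y\<^sup>2)) *\<^sub>R g (of_real x)) - pi *\<^sub>R g z)"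
    by (rule has_bochner_integral_integral_eq)
  ultimately show ?thesis using intg by (simp add: has_bochner_integral_iff z_def scaleR_conv_of_real)
qed

lemma has_bochner_integral_real_mono:
  fixes f g :: "'a \<Rightarrow> real"
  assumes "has_bochner_integral M f a" "has_bochner_integral M g b" "\<And>x. f x \<le> g x"
  shows "a \<le> b"
  using assms integral_mono[of M f g] by (auto simp: has_bochner_integral_iff)

text \<open>
  The values of a Stieltjes transform on the imaginary axis give the integrals with the cutoff
  \<open>n\<^sup>2 / (x\<^sup>2 + n\<^sup>2)\<close>, which increases to \<open>1\<close>. Monotone convergence then turns an asymptotic
  expansion at \<open>\<i> \<infinity>\<close> into a statement on masses and moments.
\<close>

lemma has_bochner_integral_from_cutoffs:
  fixes f :: "real \<Rightarrow> real"
  assumes M: "sets M = sets borel" and f: "f \<in> borel_measurable borel" "\<And>x. f x \<ge> 0"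
    and int: "\<And>n. integrable M (\<lambda>x. f x * ((real n)\<^sup>2 / (x\<^sup>2 + (real n)\<^sup>2)))"
    and lim: "(\<lambda>n. LINT x|M. f x * ((real n)\<^sup>2 / (x\<^sup>2 + (real n)\<^sup>2))) \<longlonglongrightarrow> L"
  shows "has_bochner_integral M f L"
proof -
  have mono: "m \<le> n \<Longrightarrow> (real m)\<^sup>2 / (x\<^sup>2 + (real m)\<^sup>2) \<le> (real n)\<^sup>2 / (x\<^sup>2 + (real n)\<^sup>2)" for m n :: nat and x :: real
  proof (cases "m = 0 \<or> x = 0")
    case False
    assume "m \<le> n"
    then have "(real m)\<^sup>2 * x\<^sup>2 \<le> (real n)\<^sup>2 * x\<^sup>2" by (intro mult_right_mono power_mono) auto
    then show ?thesis using False by (simp add: divide_simps add_nonneg_pos pos_add_strict algebra_simps)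
  qed auto
  have 1: "AE x in M. mono (\<lambda>n. f x * ((real n)\<^sup>2 / (x\<^sup>2 + (real n)\<^sup>2)))"
    using f mono by (intro AE_I2 monoI mult_left_mono) auto
  have 2: "AE x in M. 0 \<le> f x * ((real n)\<^sup>2 / (x\<^sup>2 + (real n)\<^sup>2))" for n :: nat
    using f by (intro AE_I2) auto
  have 3: "AE x in M. (\<lambda>n. f x * ((real n)\<^sup>2 / (x\<^sup>2 + (real n)\<^sup>2))) \<longlonglongrightarrow> f x"
  proof (rule AE_I2)
    fix x :: real
    have "(\<lambda>n. (real n)\<^sup>2 / (x\<^sup>2 + (real n)\<^sup>2)) \<longlonglongrightarrow> 1" by real_asymp
    from tendsto_mult[OF tendsto_const[of "f x"] this]
    show "(\<lambda>n. f x * ((real n)\<^sup>2 / (x\<^sup>2 + (real n)\<^sup>2))) \<longlonglongrightarrow> f x" by simp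
  qed
  have 4: "f \<in> borel_measurable M" using f M by (metis measurable_cong_sets)
  show ?thesis
    using integral_monotone_convergence_nonneg[OF int 1 2 3 lim 4]
    by (simp add: has_bochner_integral_iff)
qed

lemma (in real_distribution) integrable_resolvent:
  assumes "Im z > 0"
  shows "integrable M (\<lambda>x. 1 / (of_real x - z))"
proof (rule integrable_const_bound[of _ "1 / Im z"])
  show "AE x in M. cmod (1 / (of_real x - z)) \<le> 1 / Im z"
  proof (rule AE_I2)
    fix x
    have "Im z \<le> cmod (of_real x - z)"
      using abs_Im_le_cmod[of "of_real x - z"] assms by simp
    then show "cmod (1 / (of_real x - z)) \<le> 1 / Im z"
      using assms by (simp add: norm_divide divide_simps)
  qed
qed measurable

lemma (in real_distribution) stieltjes_transform_bound:
  assumes "Im z > 0"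
  shows "cmod (LINT x|M. 1 / (of_real x - z)) \<le> 1 / Im z"
proof -
  have "cmod (LINT x|M. 1 / (of_real x - z)) \<le> (LINT x|M. 1 / Im z)"
  proof (rule Bochner_Integration.integral_norm_bound_integral[OF integrable_resolvent[OF assms]])
    fix x
    have "Im z \<le> cmod (of_real x - z)"
      using abs_Im_le_cmod[of "of_real x - z"] assms by simp
    then show "cmod (1 / (of_real x - z)) \<le> 1 / Im z"
      using assms by (simp add: norm_divide divide_simps)
  qed simp
  then show ?thesis using prob_space by simp
qed

lemma (in real_distribution) stieltjes_transform_Im:
  assumes "y > 0"
  shows "Im (LINT x|M. 1 / (of_real x - Complex u y)) = (LINT x|M. y / ((x - u)\<^sup>2 + y\<^sup>2))"
    "integrable M (\<lambda>x. y / ((x - u)\<^sup>2 + y\<^sup>2))"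
proof -
  have *: "Im (1 / (of_real x - Complex u y)) = y / ((x - u)\<^sup>2 + y\<^sup>2)" for x
    by (simp add: Im_divide)
  have i: "integrable M (\<lambda>x. 1 / (of_real x - Complex u y))" using integrable_resolvent assms by simp
  show "Im (LINT x|M. 1 / (of_real x - Complex u y)) = (LINT x|M. y / ((x - u)\<^sup>2 + y\<^sup>2))"
    using integral_Im[OF i] by (simp only: *)
  show "integrable M (\<lambda>x. y / ((x - u)\<^sup>2 + y\<^sup>2))"
    using integrable_Im[OF i] by (simp only: *)
qed

text \<open>
  Differentiation under the integral: the remainder of the difference quotient of
  \<open>1 / (x - z)\<close> is bounded by a multiple of \<open>\<bar>w - z\<bar>\<close> uniformly in \<open>x\<close>.
\<close>

lemma (in real_distribution) stieltjes_transform_holomorphic: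
  "(\<lambda>z. LINT x|M. 1 / (of_real x - z)) holomorphic_on {z. Im z > 0}"
  unfolding holomorphic_on_def
proof
  fix z assume "z \<in> {z. Im z > 0}"
  then have z: "Im z > 0" by simp
  let ?S = "\<lambda>z. LINT x|M. 1 / (of_real x - z)"
  have lb: "Im w \<le> cmod (of_real x - w)" for w and x
    using abs_Im_le_cmod[of "of_real x - w"] by simp
  have i2: "integrable M (\<lambda>x. 1 / (of_real x - z)\<^sup>2)"
  proof (rule integrable_const_bound[of _ "1 / (Im z)\<^sup>2"])
    show "AE x in M. cmod (1 / (of_real x - z)\<^sup>2) \<le> 1 / (Im z)\<^sup>2"
      using z lb by (intro AE_I2) (auto simp: norm_divide norm_power intro!: frac_le power_mono)
  qed measurable
  define D where "D = (LINT x|M. 1 / (of_real x - z)\<^sup>2)"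
  have est: "cmod ((?S w - ?S z) / (w - z) - D) \<le> cmod (w - z) * (2 / Im z ^ 3)"
    if w: "w \<noteq> z" "cmod (w - z) < Im z / 2" for w
  proof -
    have Imw: "Im w \<ge> Im z / 2" using abs_Im_le_cmod[of "w - z"] w by simp
    then have Imw': "Im w > 0" using z by simp
    have nz: "of_real x - w \<noteq> 0" "of_real x - z \<noteq> 0" for x :: real
      using z Imw' by (auto simp: complex_eq_iff)
    have iw: "integrable M (\<lambda>x. 1 / (of_real x - w))" and iz: "integrable M (\<lambda>x. 1 / (of_real x - z))"
      using integrable_resolvent z Imw' by auto
    have eq: "(1 / (of_real x - w) - 1 / (of_real x - z)) / (w - z) - 1 / (of_real x - z)\<^sup>2 =
       (w - z) / ((of_real x - w) * (of_real x - z)\<^sup>2)" for x :: real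
      using nz[of x] w by (simp add: divide_simps power2_eq_square)
    have "(?S w - ?S z) / (w - z) - D = (LINT x|M. (1 / (of_real x - w) - 1 / (of_real x - z)) / (w - z) - 1 / (of_real x - z)\<^sup>2)"
      using iw iz i2 by (simp add: D_def)
    also have "\<dots> = (LINT x|M. (w - z) / ((of_real x - w) * (of_real x - z)\<^sup>2))"
      unfolding eq ..
    also have "cmod \<dots> \<le> (LINT x|M. cmod (w - z) * (2 / Im z ^ 3))"
    proof (rule Bochner_Integration.integral_norm_bound_integral)
      show bd: "cmod ((w - z) / ((of_real x - w) * (of_real x - z)\<^sup>2)) \<le> cmod (w - z) * (2 / Im z ^ 3)" for x
      proof -
        have "Im z / 2 * (Im z)\<^sup>2 \<le> cmod (of_real x - w) * (cmod (of_real x - z))\<^sup>2"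
          using lb[of w x] lb[of z x] Imw z by (intro mult_mono power_mono) auto
        then have "cmod (w - z) / (cmod (of_real x - w) * (cmod (of_real x - z))\<^sup>2) \<le> cmod (w - z) / (Im z / 2 * (Im z)\<^sup>2)"
          using z by (intro divide_left_mono mult_pos_pos) (use nz in auto)
        then show ?thesis by (simp add: norm_divide norm_mult norm_power power3_eq_cube power2_eq_square mult_ac)
      qed
      show "integrable M (\<lambda>x. (w - z) / ((of_real x - w) * (of_real x - z)\<^sup>2))"
        by (rule integrable_const_bound[of _ "cmod (w - z) * (2 / Im z ^ 3)"], use bd in auto)
    qed simp
    finally show ?thesis using prob_space by simp
  qed
  have "((\<lambda>w. (?S w - ?S z) / (w - z) - D) \<longlongrightarrow> 0) (at z)"
  proof (rule Lim_null_comparison)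
    show "\<forall>\<^sub>F w in at z. cmod ((?S w - ?S z) / (w - z) - D) \<le> cmod (w - z) * (2 / Im z ^ 3)"
      unfolding eventually_at using z est by (intro exI[of _ "Im z / 2"]) (auto simp: dist_norm)
    have "((\<lambda>w. cmod (w - z) * (2 / Im z ^ 3)) \<longlongrightarrow> cmod (z - z) * (2 / Im z ^ 3)) (at z)"
      by (intro tendsto_intros)
    then show "((\<lambda>w. cmod (w - z) * (2 / Im z ^ 3)) \<longlongrightarrow> 0) (at z)" by simp
  qed
  then have "((\<lambda>w. (?S w - ?S z) / (w - z)) \<longlongrightarrow> D) (at z)"
    by (simp add: LIM_zero_iff)
  then have "(?S has_field_derivative D) (at z)" by (simp add: has_field_derivative_iff)
  then show "?S field_differentiable at z within {z. Im z > 0}"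
    by (metis field_differentiable_at_within field_differentiable_def)
qed

text \<open>
  By the Poisson formula on the line of height \<open>e\<close>, the function \<open>Im f / \<pi>\<close> on this line is
  the density of a probability measure \<open>D e\<close>, whose Poisson integral at \<open>u + \<i> y\<close> is the imaginary
  part of \<open>f\<close> at height \<open>y + e\<close>. The normalization at \<open>\<i> \<infinity>\<close> gives total mass \<open>1\<close> and, since it
  holds uniformly in \<open>e \<le> 1\<close>, also tightness. By Helly's theorem a subsequence of the
  measures with \<open>e \<longrightarrow> 0\<close> converges weakly, and the Stieltjes transform of the limit has the same
  imaginary part as \<open>f\<close>. A holomorphic function with real values is constant, and both functions
  tend to \<open>0\<close> along the imaginary axis.
\<close>

theorem stieltjes_representation:
  fixes f :: "complex \<Rightarrow> complex"
  assumes hol: "f holomorphic_on {z. Im z > 0}"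
    and Im: "\<And>z. Im z > 0 \<Longrightarrow> Im (f z) \<ge> 0"
    and bdd: "\<And>z. Im z > 0 \<Longrightarrow> cmod (f z) \<le> 1 / Im z"
    and lim: "((\<lambda>y. y * Im (f (Complex 0 y))) \<longlongrightarrow> 1) at_top"
  obtains M where "real_distribution M" "\<And>z. Im z > 0 \<Longrightarrow> f z = (LINT x|M. 1 / (of_real x - z))"
proof -
  define D where "D e = density lborel (\<lambda>x. ennreal (Im (f (Complex x e)) / pi))" for e
  have contf: "continuous_on {z. Im z > 0} f" using hol by (rule holomorphic_on_imp_continuous_on)
  have meas: "(\<lambda>x. Im (f (Complex x e)) / pi) \<in> borel_measurable borel" if "e > 0" for e
  proof (rule borel_measurable_continuous_onI)
    have "continuous_on UNIV (\<lambda>x. f (Complex x e))"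
      by (rule continuous_on_compose2[OF contf]) (use that in \<open>auto intro!: continuous_intros simp: complex_eq_iff Complex_eq\<close>)
    then show "continuous_on UNIV (\<lambda>x. Im (f (Complex x e)) / pi)" by (intro continuous_intros) auto
  qed
  have poisson: "has_bochner_integral lborel (\<lambda>x. Im (f (Complex x e)) / pi * (y / ((x - u)\<^sup>2 + y\<^sup>2))) (Im (f (Complex u (y + e))))"
    if "e > 0" "y > 0" for e y u
  proof -
    have "has_bochner_integral lborel (\<lambda>x. (y / ((x - u)\<^sup>2 + y\<^sup>2)) *\<^sub>R f (of_real x + e * \<i>)) (of_real pi * f (Complex u y + e * \<i>))"
    proof (rule poisson_formula_half_plane[where e=e and B="1/e"])
      show "(\<lambda>w. f (w + e * \<i>)) holomorphic_on {w. - e < Im w}"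
        by (rule holomorphic_on_compose_gen[OF _ hol, unfolded o_def]) (use that in \<open>auto intro!: holomorphic_intros\<close>)
      show "cmod (f (w + e * \<i>)) \<le> 1 / e" if "0 \<le> Im w" for w
        using bdd[of "w + e * \<i>"] that \<open>e > 0\<close> by (auto intro!: order_trans[OF bdd] frac_le)
    qed (use that in auto)
    from has_bochner_integral_Im[OF this]
    have "has_bochner_integral lborel (\<lambda>x. (y / ((x - u)\<^sup>2 + y\<^sup>2)) * Im (f (of_real x + e * \<i>))) (pi * Im (f (Complex u y + e * \<i>)))"
      by simp
    from has_bochner_integral_divide_zero[OF this, of pi]
    have "has_bochner_integral lborel (\<lambda>x. (y / ((x - u)\<^sup>2 + y\<^sup>2)) * Im (f (of_real x + e * \<i>)) / pi) (Im (f (Complex u y + e * \<i>)))"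
      by simp
    moreover have "of_real x + e * \<i> = Complex x e" "Complex u y + e * \<i> = Complex u (y + e)" for x
      by (simp_all add: complex_eq_iff)
    ultimately show ?thesis by (simp add: mult.commute)
  qed
  have intD: "has_bochner_integral (D e) h I" 
    if "e > 0" "has_bochner_integral lborel (\<lambda>x. Im (f (Complex x e)) / pi * h x) I" "h \<in> borel_measurable borel" for e I and h :: "real \<Rightarrow> real"
    unfolding D_def using that(2,3) meas[OF that(1)] Im that(1)
    by (intro has_bochner_integral_density) auto
  have rd: "real_distribution (D e)" if e: "e > 0" for e
  proof -
    have 1: "has_bochner_integral lborel (\<lambda>x. Im (f (Complex x e)) / pi * ((real n)\<^sup>2 / (x\<^sup>2 + (real n)\<^sup>2))) (real n * Im (f (Complex 0 (real n + e))))" for n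
    proof (cases "n = 0")
      case False
      then have "has_bochner_integral lborel (\<lambda>x. real n * (Im (f (Complex x e)) / pi * (real n / ((x - 0)\<^sup>2 + (real n)\<^sup>2)))) (real n * Im (f (Complex 0 (real n + e))))"
        using e by (intro has_bochner_integral_mult_right poisson) auto
      then show ?thesis by (simp add: power2_eq_square mult_ac)
    qed (simp add: has_bochner_integral_zero)
    have "has_bochner_integral lborel (\<lambda>x. Im (f (Complex x e)) / pi) 1"
    proof (rule has_bochner_integral_from_cutoffs)
      show "(\<lambda>x. Im (f (Complex x e)) / pi) \<in> borel_measurable borel" by (rule meas[OF e])
      show "0 \<le> Im (f (Complex x e)) / pi" for x using Im e by simp
      show "integrable lborel (\<lambda>x. Im (f (Complex x e)) / pi * ((real n)\<^sup>2 / (x\<^sup>2 + (real n)\<^sup>2)))" for n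
        using 1[of n] by (simp add: has_bochner_integral_iff)
      have "((\<lambda>y. y / (y + e) * ((y + e) * Im (f (Complex 0 (y + e))))) \<longlongrightarrow> 1 * 1) at_top"
      proof (intro tendsto_mult)
        show "((\<lambda>y. y / (y + e)) \<longlongrightarrow> 1) at_top" by real_asymp
        have "filterlim (\<lambda>y. y + e) at_top at_top" by real_asymp
        from filterlim_compose[OF lim this]
        show "((\<lambda>y. (y + e) * Im (f (Complex 0 (y + e)))) \<longlongrightarrow> 1) at_top" .
      qed
      from filterlim_compose[OF this filterlim_real_sequentially]
      have "(\<lambda>n. real n / (real n + e) * ((real n + e) * Im (f (Complex 0 (real n + e))))) \<longlonglongrightarrow> 1" by simp
      moreover have "real n / (real n + e) * ((real n + e) * Im (f (Complex 0 (real n + e)))) =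
         (LINT x|lborel. Im (f (Complex x e)) / pi * ((real n)\<^sup>2 / (x\<^sup>2 + (real n)\<^sup>2)))" for n
        using 1[of n] e by (simp add: has_bochner_integral_iff)
      ultimately show "(\<lambda>n. LINT x|lborel. Im (f (Complex x e)) / pi * ((real n)\<^sup>2 / (x\<^sup>2 + (real n)\<^sup>2))) \<longlonglongrightarrow> 1"
        by simp
    qed simp
    then have nn: "(\<integral>\<^sup>+x. ennreal (Im (f (Complex x e)) / pi) \<partial>lborel) = 1"
      using Im e by (subst nn_integral_eq_integral) (auto simp: has_bochner_integral_iff)
    note [measurable] = meas[OF e]
    interpret prob_space "D e"
      by standard (simp add: D_def emeasure_density nn)
    show ?thesis by standard (auto simp: D_def)
  qed
  define m where "m n = D (1 / real (Suc n))" for n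
  have ep: "1 / real (Suc n) > 0" for n by simp
  have m_rd: "real_distribution (m n)" for n unfolding m_def by (rule rd[OF ep])
  have m_int: "has_bochner_integral (m n) (\<lambda>x. y / ((x - u)\<^sup>2 + y\<^sup>2)) (Im (f (Complex u (y + 1 / real (Suc n)))))"
    if "y > 0" for n y u
    unfolding m_def by (rule intD[OF ep]) (use poisson[OF ep that] in auto)
  \<comment> \<open>The mass outside \<open>{-y<..y}\<close> is at most twice \<open>1 - y Im (f (\<i> (y + e)))\<close>, as the weight
    \<open>1 - y\<^sup>2 / (x\<^sup>2 + y\<^sup>2)\<close> is at least \<open>1 / 2\<close> there.\<close>
  have "tight m"
    unfolding tight_def
  proof (intro conjI allI impI)
    fix q :: real assume q: "q > 0"
    have "((\<lambda>y. y * Im (f (Complex 0 y))) \<longlongrightarrow> 1) at_top" by (rule lim)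
    then have "\<forall>\<^sub>F y in at_top. y * Im (f (Complex 0 y)) > 1 - q / 4"
      by (rule order_tendstoD) (use q in simp)
    moreover have "\<forall>\<^sub>F y in at_top. y / (y + 1) > 1 - q / 4"
      by (rule order_tendstoD[of _ 1]) (real_asymp, use q in simp)
    ultimately have "\<forall>\<^sub>F y in at_top. (y > 0 \<and> y / (y + 1) > 1 - q / 4) \<and> (\<forall>y'\<ge>y. y' * Im (f (Complex 0 y')) > 1 - q / 4)"
      by (intro eventually_conj eventually_all_ge_at_top eventually_gt_at_top)
    then obtain y where y: "y > 0" "y / (y + 1) > 1 - q / 4"
      and yf: "\<And>y'. y' \<ge> y \<Longrightarrow> y' * Im (f (Complex 0 y')) > 1 - q / 4"
      using eventually_happens'[OF trivial_limit_at_top_linorder] by blast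
    show "\<exists>a b. a < b \<and> (\<forall>n. measure (m n) {a<..b} > 1 - q)"
    proof (rule exI[of _ "-y"], rule exI[of _ y], intro conjI allI)
      fix n
      interpret real_distribution "m n" by (rule m_rd)
      define e where "e = 1 / real (Suc n)"
      have e: "0 < e" "e \<le> 1" by (auto simp: e_def)
      let ?h = "\<lambda>x. y / ((x - 0)\<^sup>2 + y\<^sup>2)"
      have h: "has_bochner_integral (m n) ?h (Im (f (Complex 0 (y + e))))"
        using m_int[OF y(1), of n 0] by (simp add: e_def)
      have ind: "has_bochner_integral (m n) (\<lambda>x. indicat_real (- {-y<..y}) x) (measure (m n) (- {-y<..y}))"
        by (rule has_bochner_integral_real_indicator) (auto simp: less_top[symmetric])
      have "measure (m n) (- {-y<..y}) / 2 \<le> 1 - y * Im (f (Complex 0 (y + e)))"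
      proof (rule has_bochner_integral_real_mono)
        show "has_bochner_integral (m n) (\<lambda>x. indicat_real (- {-y<..y}) x / 2) (measure (m n) (- {-y<..y}) / 2)"
          using has_bochner_integral_divide_zero[OF ind] by simp
        have "has_bochner_integral (m n) (\<lambda>x. 1) (1::real)"
          using prob_space by (simp add: has_bochner_integral_iff)
        then show "has_bochner_integral (m n) (\<lambda>x. 1 - y * ?h x) (1 - y * Im (f (Complex 0 (y + e))))"
          by (intro has_bochner_integral_diff has_bochner_integral_mult_right h)
        fix x
        show "indicat_real (- {-y<..y}) x / 2 \<le> 1 - y * ?h x"
        proof (cases "x \<in> {-y<..y}")
          case False
          then have "y\<^sup>2 \<le> x\<^sup>2" using y by (auto intro!: abs_le_square_iff[THEN iffD1])
          moreover have "x\<^sup>2 + y\<^sup>2 > 0" using y(1) by (simp add: add_nonneg_pos)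
          ultimately show ?thesis using False y(1) by (simp add: divide_simps power2_eq_square)
        next
          case True
          have "x\<^sup>2 + y\<^sup>2 > 0" using y(1) by (simp add: add_nonneg_pos)
          then show ?thesis using True by (simp add: divide_simps power2_eq_square)
        qed
      qed
      moreover have "y * Im (f (Complex 0 (y + e))) > 1 - q / 2"
      proof -
        have "1 - q / 2 \<le> (1 - q / 4) * (1 - q / 4)" by (simp add: algebra_simps)
        have E: "y / (y + 1) \<le> y / (y + e)" using y e by (intro divide_left_mono) auto
        have F: "(y + e) * Im (f (Complex 0 (y + e))) > 1 - q / 4" using yf[of "y + e"] e by simp
        have G: "y * Im (f (Complex 0 (y + e))) = y / (y + e) * ((y + e) * Im (f (Complex 0 (y + e))))"
          using y e by simp
        show ?thesis
        proof (cases "q < 4")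
          case True
          have "(1 - q / 4) * (1 - q / 4) < y / (y + e) * ((y + e) * Im (f (Complex 0 (y + e))))"
            using E F y(2) True by (intro mult_strict_mono) auto
          then show ?thesis using G \<open>1 - q / 2 \<le> _\<close> by simp
        next
          case False
          have "y * Im (f (Complex 0 (y + e))) \<ge> 0" using y e by (auto intro!: mult_nonneg_nonneg Im)
          then show ?thesis using False by simp
        qed
      qed
      moreover have "measure (m n) (- {-y<..y}) = 1 - measure (m n) {-y<..y}"
        using prob_compl[of "{-y<..y}"] by (simp add: Compl_eq_Diff_UNIV)
      ultimately show "measure (m n) {-y<..y} > 1 - q" by simp
    qed (use y in simp)
  qed (rule m_rd)
  from tight_imp_convergent_subsubsequence[OF this strict_mono_id] obtain r M
    where r: "strict_mono (r :: nat \<Rightarrow> nat)" and M: "real_distribution M" "weak_conv_m (m \<circ> id \<circ> r) M"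
    by blast
  interpret real_distribution M by (rule M)
  let ?F = "\<lambda>z. LINT x|M. 1 / (of_real x - z)"
  have Imeq: "Im (f z) = Im (?F z)" if "Im z > 0" for z
  proof -
    define u y where "u = Re z" and "y = Im z"
    have z: "z = Complex u y" and y: "y > 0" using that by (auto simp: u_def y_def)
    have pos: "(x - u)\<^sup>2 + y\<^sup>2 > 0" for x
      using y by (simp add: add_nonneg_pos)
    have "(\<lambda>n. integral\<^sup>L (m (r n)) (\<lambda>x. y / ((x - u)\<^sup>2 + y\<^sup>2))) \<longlonglongrightarrow> integral\<^sup>L M (\<lambda>x. y / ((x - u)\<^sup>2 + y\<^sup>2))"
    proof (rule weak_conv_imp_integral_bdd_continuous_conv[where B="1/y"])
      show "real_distribution (m (r n))" for n by (rule m_rd)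
      show "weak_conv_m (\<lambda>n. m (r n)) M" using M(2) by (simp add: o_def)
      show "isCont (\<lambda>x. y / ((x - u)\<^sup>2 + y\<^sup>2)) x" for x
        using pos[of x] by (intro continuous_intros) auto
      show "norm (y / ((x - u)\<^sup>2 + y\<^sup>2)) \<le> 1 / y" for x
        using y pos[of x] by (simp add: divide_simps power2_eq_square)
    qed (rule M(1))
    moreover have "integral\<^sup>L (m (r n)) (\<lambda>x. y / ((x - u)\<^sup>2 + y\<^sup>2)) = Im (f (Complex u (y + 1 / real (Suc (r n)))))" for n
      using m_int[OF y, of "r n" u] by (simp add: has_bochner_integral_iff)
    moreover have "(\<lambda>n. Im (f (Complex u (y + 1 / real (Suc (r n)))))) \<longlonglongrightarrow> Im (f (Complex u y))"
    proof (intro tendsto_Im continuous_on_tendsto_compose[OF contf])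
      have "(\<lambda>n. y + 1 / real (Suc n)) \<longlonglongrightarrow> y" by real_asymp
      from LIMSEQ_subseq_LIMSEQ[OF this r]
      have "(\<lambda>n. y + 1 / real (Suc (r n))) \<longlonglongrightarrow> y" by (simp add: o_def)
      then show "(\<lambda>n. Complex u (y + 1 / real (Suc (r n)))) \<longlonglongrightarrow> Complex u y"
        by (intro tendsto_Complex tendsto_const)
      show "\<forall>\<^sub>F n in sequentially. Complex u (y + 1 / real (Suc (r n))) \<in> {z. 0 < Im z}"
        using y by (intro always_eventually) (auto intro!: add_pos_pos)
    qed (use y in simp)
    ultimately have "Im (f (Complex u y)) = integral\<^sup>L M (\<lambda>x. y / ((x - u)\<^sup>2 + y\<^sup>2))"
      using LIMSEQ_unique by auto
    then show ?thesis unfolding z stieltjes_transform_Im(1)[OF y] .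
  qed
  have holF: "(\<lambda>z. f z - ?F z) holomorphic_on {z. Im z > 0}"
    using hol stieltjes_transform_holomorphic by (intro holomorphic_intros)
  have "(\<lambda>z. f z - ?F z) constant_on {z. Im z > 0}"
  proof (rule ccontr)
    assume nc: "\<not> ?thesis"
    have "open ((\<lambda>z. f z - ?F z) ` {z. Im z > 0})"
      by (rule open_mapping_thm[OF holF _ _ _ _ nc])
        (auto simp: open_halfspace_Im_gt convex_connected convex_halfspace_Im_gt)
    moreover have "(\<lambda>z. f z - ?F z) ` {z. Im z > 0} \<subseteq> {w. Im w = 0}"
      using Imeq by auto
    ultimately have "(\<lambda>z. f z - ?F z) ` {z. Im z > 0} \<subseteq> interior {w. Im w = 0}"
      by (rule interior_maximal[rotated])
    then have "f \<i> - ?F \<i> \<in> interior {w. Im w = 0}" by auto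
    then obtain e where e: "e > 0" "ball (f \<i> - ?F \<i>) e \<subseteq> {w. Im w = 0}"
      by (auto simp: mem_interior)
    have "f \<i> - ?F \<i> + (e/2) * \<i> \<in> ball (f \<i> - ?F \<i>) e" using e by (simp add: dist_norm norm_mult)
    with e have "Im (f \<i> - ?F \<i> + (e/2) * \<i>) = 0" by blast
    then show False using e Imeq[of \<i>] by simp
  qed
  then obtain k where k: "\<And>z. Im z > 0 \<Longrightarrow> f z - ?F z = k"
    by (auto simp: constant_on_def)
  have "cmod k \<le> 0"
  proof (rule tendsto_lowerbound[where F=at_top])
    show "((\<lambda>y::real. 2 / y) \<longlongrightarrow> 0) at_top" by real_asymp
    have *: "cmod k \<le> 2 / y" if "y > 0" for y
    proof -
      have "cmod k \<le> cmod (f (Complex 0 y)) + cmod (?F (Complex 0 y))"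
        using k[of "Complex 0 y"] that norm_triangle_ineq4[of "f (Complex 0 y)" "?F (Complex 0 y)"] by simp
      also have "\<dots> \<le> 1 / y + 1 / y"
        using bdd[of "Complex 0 y"] stieltjes_transform_bound[of "Complex 0 y"] that by (intro add_mono) auto
      finally show ?thesis by simp
    qed
    show "\<forall>\<^sub>F y in at_top. cmod k \<le> 2 / y"
      using eventually_gt_at_top[of "0::real"] by eventually_elim (rule *)
  qed auto
  then have "k = 0" by simp
  then show ?thesis using that[OF M(1)] k by (metis eq_iff_diff_eq_0)
qed


text \<open>
  The mass of \<open>{u - e..u + e}\<close> is at most \<open>2 e Im (F (u + \<i> e))\<close>. For \<open>u < 0\<close> the sign of
  \<open>Im (z F z)\<close> bounds \<open>Im F\<close> by \<open>e Re F / \<bar>u\<bar>\<close>, where \<open>Re F \<le> 1 / \<bar>u\<bar>\<close>, so this mass is \<open>O(e\<^sup>2)\<close>. Hence the distribution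
  function has derivative \<open>0\<close> on the negative half-line; it is constant there, equal to its limit
  \<open>0\<close> at \<open>-\<infinity>\<close>.
\<close>

lemma (in real_distribution) nonneg_support_of_stieltjes_transform:
  defines "F \<equiv> \<lambda>z. LINT x|M. 1 / (of_real x - z)"
  assumes Imz: "\<And>z. Im z > 0 \<Longrightarrow> Im (z * F z) \<ge> 0"
    and bdd: "\<And>z. Im z > 0 \<Longrightarrow> Re z < 0 \<Longrightarrow> cmod (F z) \<le> 1 / cmod z"
  shows "measure M {..<0} = 0"
proof -
  have small: "measure M {u - e..u + e} \<le> 2 * e\<^sup>2 / u\<^sup>2" if u: "u < 0" and e: "e > 0" for u e
  proof -
    have ind: "has_bochner_integral M (indicat_real {u-e..u+e}) (measure M {u-e..u+e})"
      by (rule has_bochner_integral_real_indicator) (auto simp: less_top[symmetric])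
    have "measure M {u-e..u+e} / (2 * e) \<le> Im (F (Complex u e))"
    proof (rule has_bochner_integral_real_mono)
      show "has_bochner_integral M (\<lambda>x. indicat_real {u-e..u+e} x / (2 * e)) (measure M {u-e..u+e} / (2 * e))"
        by (rule has_bochner_integral_divide_zero[OF ind])
      show "has_bochner_integral M (\<lambda>x. e / ((x - u)\<^sup>2 + e\<^sup>2)) (Im (F (Complex u e)))"
        using stieltjes_transform_Im[OF e, of u] by (simp add: F_def has_bochner_integral_iff)
      fix x
      show "indicat_real {u-e..u+e} x / (2 * e) \<le> e / ((x - u)\<^sup>2 + e\<^sup>2)"
      proof (cases "x \<in> {u-e..u+e}")
        case True
        then have "\<bar>x - u\<bar> \<le> \<bar>e\<bar>" using e by (simp add: abs_le_iff)
        then have "(x - u)\<^sup>2 \<le> e\<^sup>2" by (simp only: abs_le_square_iff)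
        moreover have "(x - u)\<^sup>2 + e\<^sup>2 > 0" using e by (simp add: add_nonneg_pos)
        ultimately show ?thesis using True e by (simp add: divide_simps power2_eq_square)
      qed (use e in auto)
    qed
    moreover have "Im (F (Complex u e)) \<le> e / u\<^sup>2"
    proof -
      let ?w = "F (Complex u e)"
      have "0 \<le> u * Im ?w + e * Re ?w" using Imz[of "Complex u e"] e by simp
      moreover have "Re ?w \<le> 1 / \<bar>u\<bar>"
      proof -
        have "Re ?w \<le> 1 / cmod (Complex u e)"
          using bdd[of "Complex u e"] complex_Re_le_cmod[of ?w] u e by simp
        also have "\<dots> \<le> 1 / \<bar>u\<bar>"
          using u abs_Re_le_cmod[of "Complex u e"] by (intro frac_le) auto
        finally show ?thesis .
      qed
      then have "e * Re ?w \<le> e * (1 / \<bar>u\<bar>)" using e by (intro mult_left_mono) auto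
      ultimately have "(- u) * Im ?w \<le> e / (- u)" using u by simp
      moreover have "u\<^sup>2 > 0" using u by simp
      ultimately show ?thesis using u by (simp add: pos_le_divide_eq field_simps power2_eq_square)
    qed
    ultimately have "measure M {u-e..u+e} / (2 * e) \<le> e / u\<^sup>2" by simp
    from mult_right_mono[OF this, of "2 * e"] show ?thesis using e by (simp add: power2_eq_square mult_ac)
  qed
  have "(cdf M has_field_derivative 0) (at u)" if u: "u < 0" for u
    unfolding has_field_derivative_iff
  proof (rule Lim_null_comparison)
    show "\<forall>\<^sub>F v in at u. norm ((cdf M v - cdf M u) / (v - u)) \<le> \<bar>v - u\<bar> * (2 / u\<^sup>2)"
      unfolding eventually_at
    proof (intro exI[of _ 1] conjI ballI impI)
      fix v assume v: "v \<noteq> u \<and> dist v u < 1"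
      have "\<bar>cdf M v - cdf M u\<bar> \<le> measure M {u - \<bar>v - u\<bar>..u + \<bar>v - u\<bar>}"
      proof (cases "u < v")
        case True
        then show ?thesis using cdf_nondecreasing[of u v]
          by (auto simp: cdf_diff_eq intro!: finite_measure_mono)
      next
        case False
        then show ?thesis using cdf_nondecreasing[of v u] v
          by (subst abs_minus_commute) (auto simp: cdf_diff_eq intro!: finite_measure_mono)
      qed
      also have "\<dots> \<le> 2 * \<bar>v - u\<bar>\<^sup>2 / u\<^sup>2" using v by (intro small u) auto
      finally have "\<bar>cdf M v - cdf M u\<bar> / \<bar>v - u\<bar> \<le> 2 * \<bar>v - u\<bar>\<^sup>2 / u\<^sup>2 / \<bar>v - u\<bar>"
        by (rule divide_right_mono) simp
      then show "norm ((cdf M v - cdf M u) / (v - u)) \<le> \<bar>v - u\<bar> * (2 / u\<^sup>2)"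
        using v by (simp add: abs_divide power2_eq_square mult_ac del: abs_mult_self_eq)
    qed simp
    have "((\<lambda>v. \<bar>v - u\<bar> * (2 / u\<^sup>2)) \<longlongrightarrow> \<bar>u - u\<bar> * (2 / u\<^sup>2)) (at u)"
      by (intro tendsto_intros)
    then show "((\<lambda>v. \<bar>v - u\<bar> * (2 / u\<^sup>2)) \<longlongrightarrow> 0) (at u)" by simp
  qed
  then have "\<exists>k. \<forall>u\<in>{..<0}. cdf M u = k"
    by (intro has_field_derivative_zero_constant) (auto intro: has_field_derivative_at_within)
  then obtain k where k: "\<And>u. u < 0 \<Longrightarrow> cdf M u = k" by auto
  have "\<forall>\<^sub>F u in at_bot. cdf M u = k"
    using eventually_gt_at_bot[of "0::real"] by eventually_elim (rule k)
  with cdf_lim_at_bot have "((\<lambda>_::real. k) \<longlongrightarrow> 0) at_bot"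
    by (rule Lim_transform_eventually)
  then have k0: "k = 0" by (simp add: tendsto_const_iff)
  have "\<forall>\<^sub>F u in at_left (0::real). cdf M u = 0"
    by (rule eventually_at_leftI[of "-1"]) (use k k0 in auto)
  with cdf_at_left have "((\<lambda>_::real. 0) \<longlongrightarrow> measure M {..<0}) (at_left 0)"
    by (rule Lim_transform_eventually)
  then show ?thesis using tendsto_unique[OF _ _ tendsto_const] trivial_limit_at_left_real by blast
qed

text \<open>
  For \<open>z = \<i> n\<close> one has \<open>z / (x - z) + 1 = x / (x - z)\<close>, and the real part of \<open>- z x / (x - z)\<close> is
  \<open>x\<close> times the cutoff \<open>n\<^sup>2 / (x\<^sup>2 + n\<^sup>2)\<close>.
\<close>

lemma (in real_distribution) first_moment_from_stieltjes_transform: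
  defines "F \<equiv> \<lambda>z. LINT x|M. 1 / (of_real x - z)"
  assumes supp: "measure M {..<0} = 0"
    and lim: "((\<lambda>y. Re (- (\<i> * of_real y) * (\<i> * of_real y * F (\<i> * of_real y) + 1))) \<longlongrightarrow> L) at_top"
  shows "has_bochner_integral M (\<lambda>x. x) L"
proof -
  have AE: "AE x in M. x \<ge> 0"
  proof (rule AE_I)
    show "emeasure M {..<0} = 0" using supp by (simp add: emeasure_eq_measure)
  qed auto
  have *: "has_bochner_integral M (\<lambda>x. x * ((real n)\<^sup>2 / (x\<^sup>2 + (real n)\<^sup>2)))
     (Re (- (\<i> * of_real (real n)) * (\<i> * of_real (real n) * F (\<i> * of_real (real n)) + 1)))" for n :: nat
  proof (cases "n = 0")
    case False
    let ?z = "\<i> * of_real (real n)"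
    have "has_bochner_integral M (\<lambda>x. 1 / (of_real x - ?z)) (F ?z)"
      using integrable_resolvent[of ?z] False by (simp add: F_def has_bochner_integral_iff)
    moreover have "has_bochner_integral M (\<lambda>x. 1) (1 :: complex)"
      using prob_space by (simp add: has_bochner_integral_iff)
    ultimately have "has_bochner_integral M (\<lambda>x. - ?z * (?z * (1 / (of_real x - ?z)) + 1)) (- ?z * (?z * F ?z + 1))"
      by (intro has_bochner_integral_mult_right has_bochner_integral_add)
    from has_bochner_integral_Re[OF this]
    have "has_bochner_integral M (\<lambda>x. Re (- ?z * (?z * (1 / (of_real x - ?z)) + 1))) (Re (- ?z * (?z * F ?z + 1)))" .
    moreover have "Re (- ?z * (?z * (1 / (of_real x - ?z)) + 1)) = x * ((real n)\<^sup>2 / (x\<^sup>2 + (real n)\<^sup>2))" for x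
    proof -
      have "x\<^sup>2 + (real n)\<^sup>2 > 0" using False by (simp add: add_nonneg_pos)
      then show ?thesis using False by (simp add: Im_divide Re_divide divide_simps power2_eq_square) 
    qed
    ultimately show ?thesis by simp
  qed (simp add: has_bochner_integral_zero)
  have eqAE: "AE x in M. max x 0 * ((real n)\<^sup>2 / (x\<^sup>2 + (real n)\<^sup>2)) = x * ((real n)\<^sup>2 / (x\<^sup>2 + (real n)\<^sup>2))" for n
    using AE by eventually_elim simp
  have **: "has_bochner_integral M (\<lambda>x. max x 0 * ((real n)\<^sup>2 / (x\<^sup>2 + (real n)\<^sup>2)))
     (Re (- (\<i> * of_real (real n)) * (\<i> * of_real (real n) * F (\<i> * of_real (real n)) + 1)))" for n :: nat
    using *[of n] eqAE[of n] by (subst has_bochner_integral_cong_AE) auto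
  have "has_bochner_integral M (\<lambda>x. max x 0) L"
  proof (rule has_bochner_integral_from_cutoffs)
    show "integrable M (\<lambda>x. max x 0 * ((real n)\<^sup>2 / (x\<^sup>2 + (real n)\<^sup>2)))" for n :: nat
      using **[of n] by (simp add: has_bochner_integral_iff)
    show "(\<lambda>n. LINT x|M. max x 0 * ((real n)\<^sup>2 / (x\<^sup>2 + (real n)\<^sup>2))) \<longlonglongrightarrow> L"
      using filterlim_compose[OF lim filterlim_real_sequentially] **
      by (simp add: has_bochner_integral_iff)
  qed auto
  moreover have "AE x in M. max x 0 = x" using AE by eventually_elim simp
  ultimately show ?thesis by (subst (asm) has_bochner_integral_cong_AE) auto
qed

section \<open>The equation for the eigenvalues\<close>

lemma Im_minus_inverse: "Im (- 1 / w) = Im w / (cmod w)\<^sup>2"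
  by (simp add: Im_divide cmod_power2)

lemma weighted_Cauchy_Schwarz:
  fixes f g :: "'a \<Rightarrow> complex" and a :: "'a \<Rightarrow> real"
  shows "cmod (\<Sum>k\<in>A. of_real ((a k)\<^sup>2) * f k * g k)
      \<le> sqrt (\<Sum>k\<in>A. (a k)\<^sup>2 * (cmod (f k))\<^sup>2) * sqrt (\<Sum>k\<in>A. (a k)\<^sup>2 * (cmod (g k))\<^sup>2)"
proof -
  have "cmod (\<Sum>k\<in>A. of_real ((a k)\<^sup>2) * f k * g k) \<le> (\<Sum>k\<in>A. cmod (of_real ((a k)\<^sup>2) * f k * g k))"
    by (rule norm_sum)
  also have "\<dots> = (\<Sum>k\<in>A. (\<bar>a k\<bar> * cmod (f k)) * (\<bar>a k\<bar> * cmod (g k)))"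
    by (intro sum.cong) (auto simp: norm_mult norm_power power2_eq_square mult_ac)
  also have "\<dots> \<le> sqrt ((\<Sum>k\<in>A. (\<bar>a k\<bar> * cmod (f k))\<^sup>2) * (\<Sum>k\<in>A. (\<bar>a k\<bar> * cmod (g k))\<^sup>2))"
    by (rule real_le_rsqrt[OF Cauchy_Schwarz_ineq_sum])
  finally show ?thesis by (simp add: real_sqrt_mult power_mult_distrib)
qed

lemma Im_of_real_mult:
  "Im (of_real x * w) = x * Im w" "Im (w * of_real x) = x * Im w" "Im (z * (of_real x * w)) = x * Im (z * w)"
  by (simp_all add: times_complex.sel algebra_simps)

text \<open>
  The numbers \<open>Im t\<close> and \<open>Im (z * t)\<close> are the two coordinates of all estimates below, so products
  must not be expanded into real and imaginary parts.
\<close>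

declare times_complex.sel [simp del] Im_of_real_mult [simp]

text \<open>
  For \<open>z\<close> in the upper half-plane these are the \<open>t \<noteq> 0\<close> with argument strictly between \<open>0\<close> and
  \<open>\<pi> - arg z\<close>: an open convex cone, mapped to itself by \<open>x \<mapsto> - 1 / (z x)\<close>.
\<close>

definition sector :: "complex \<Rightarrow> complex set" where
  "sector z = {t. 0 < Im t \<and> 0 < Im (z * t)}"

text \<open>
  The equation in the eigenvalues \<open>r k\<close> of the matrix. The right-hand side \<open>\<Phi> z t\<close> is assembled from
  positive combinations and the involution \<open>j x = - 1 / (z x)\<close> of the cone:
  with \<open>J = j (c t)\<close> and \<open>Q = c t + J\<close> one has \<open>P = j Q\<close> and \<open>S = j (1 + r P)\<close>. The definition of
  \<open>P\<close> is instead the rational expression \<open>c t / (1 - z c\<^sup>2 t\<^sup>2)\<close>, which makes sense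
  at \<open>t = 0\<close> too. The constant \<open>m\<close> is the mass of the measure whose Stieltjes transform is the solution.
\<close>

locale canonical_system =
  fixes n :: nat and r :: "nat \<Rightarrow> real" and c :: real
  assumes n: "n \<ge> 1" and r: "\<And>k. k < n \<Longrightarrow> r k > 0" and c: "c > 0"
begin

definition J :: "complex \<Rightarrow> complex \<Rightarrow> complex" where
  "J z t = - 1 / (z * (of_real c * t))"

definition Q :: "complex \<Rightarrow> complex \<Rightarrow> complex" where
  "Q z t = of_real c * t + J z t"

definition P :: "complex \<Rightarrow> complex \<Rightarrow> complex" where
  "P z t = of_real c * t / (1 - z * (of_real c)\<^sup>2 * t\<^sup>2)"

definition S :: "complex \<Rightarrow> complex \<Rightarrow> nat \<Rightarrow> complex" where
  "S z t k = - 1 / (z * (1 + of_real (r k) * P z t))"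

definition \<Phi> :: "complex \<Rightarrow> complex \<Rightarrow> complex" where
  "\<Phi> z t = (1 / of_nat n) * (\<Sum>k<n. of_real (r k) * S z t k)"

definition m :: real where "m = (1 / real n) * (\<Sum>k<n. r k)"

lemma m_pos: "m > 0"
proof -
  have "(\<Sum>k<n. r k) > 0" using n r by (intro sum_pos) (auto simp: lessThan_empty_iff)
  then show ?thesis using n by (simp add: m_def)
qed

text \<open>
  The involution exchanges the two coordinates \<open>Im x\<close> and \<open>Im (z x)\<close>, up to positive factors. This
  lemma and the analogous ones for \<open>Q\<close>, \<open>P\<close>, \<open>S\<close> and \<open>\<Phi>\<close> keep track of the factors.
\<close>

lemma Im_J:
  assumes "Im z > 0" "t \<noteq> 0"
  shows "Im (J z t) = (cmod (J z t))\<^sup>2 * (c * Im (z * t))"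
    and "Im (z * J z t) = (cmod z)\<^sup>2 * (cmod (J z t))\<^sup>2 * (c * Im t)"
proof -
  have z: "z \<noteq> 0" using assms by auto
  have *: "(cmod (J z t))\<^sup>2 = 1 / (cmod (z * (of_real c * t)))\<^sup>2"
    by (simp add: J_def norm_divide power_divide)
  show "Im (J z t) = (cmod (J z t))\<^sup>2 * (c * Im (z * t))"
    unfolding * unfolding J_def Im_minus_inverse mult.left_commute[of z "of_real c"] by simp
  have "z * J z t = - 1 / (of_real c * t)" using z by (simp add: J_def)
  then show "Im (z * J z t) = (cmod z)\<^sup>2 * (cmod (J z t))\<^sup>2 * (c * Im t)"
    unfolding * using z by (simp only: Im_minus_inverse) (simp add: norm_mult power_mult_distrib)
qed

lemma Im_Q:
  assumes "Im z > 0" "t \<noteq> 0"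
  shows "Im (Q z t) = c * (Im t + (cmod (J z t))\<^sup>2 * Im (z * t))"
    and "Im (z * Q z t) = c * (Im (z * t) + (cmod z)\<^sup>2 * (cmod (J z t))\<^sup>2 * Im t)"
proof -
  show "Im (Q z t) = c * (Im t + (cmod (J z t))\<^sup>2 * Im (z * t))"
    using Im_J(1)[OF assms] by (simp add: Q_def algebra_simps)
  have "z * Q z t = of_real c * (z * t) + z * J z t" by (simp add: Q_def algebra_simps)
  then have "Im (z * Q z t) = c * Im (z * t) + Im (z * J z t)" by simp
  then show "Im (z * Q z t) = c * (Im (z * t) + (cmod z)\<^sup>2 * (cmod (J z t))\<^sup>2 * Im t)"
    unfolding Im_J(2)[OF assms] by (simp add: algebra_simps)
qed

lemma Im_pos_if_closed_sector:
  assumes "Im z > 0" "t \<noteq> 0" "Im t \<ge> 0" "Im (z * t) \<ge> 0"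
  shows "Im t > 0 \<or> Im (z * t) > 0"
proof (rule ccontr)
  assume "\<not> ?thesis"
  then have "Im t = 0" "Im (z * t) = 0" using assms by auto
  then have "Re t = 0" using assms by (simp add: times_complex.sel)
  then show False using \<open>Im t = 0\<close> assms by (simp add: complex_eq_iff)
qed

lemma J_nz: "Im z > 0 \<Longrightarrow> t \<noteq> 0 \<Longrightarrow> J z t \<noteq> 0"
  using c by (auto simp: J_def)

text \<open>
  A nonzero point of the closed cone, even on its boundary, is sent into the open cone, because
  there \<open>c t\<close> and \<open>J\<close> lie on opposite boundary rays. This is what makes a fixed point in
  the closed cone an interior one.
\<close>

lemma Q_sector:
  assumes "Im z > 0" "t \<noteq> 0" "Im t \<ge> 0" "Im (z * t) \<ge> 0"
  shows "Q z t \<in> sector z"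
proof -
  have pos: "Im t > 0 \<or> Im (z * t) > 0" by (rule Im_pos_if_closed_sector[OF assms])
  have z: "cmod z > 0" using assms by auto
  have j: "cmod (J z t) > 0" using J_nz[OF assms(1,2)] by simp
  define u v where "u = (cmod (J z t))\<^sup>2" and "v = (cmod z)\<^sup>2 * (cmod (J z t))\<^sup>2"
  have uv: "u > 0" "v > 0" using z j by (auto simp: u_def v_def)
  have "0 < Im t + u * Im (z * t)" "0 < Im (z * t) + v * Im t"
    using pos uv assms(3,4) by (metis add_pos_nonneg add_nonneg_pos mult_pos_pos mult_nonneg_nonneg less_imp_le)+
  then show ?thesis using c by (simp add: sector_def Im_Q[OF assms(1,2)] u_def v_def)
qed

lemma P_eq:
  assumes "Im z > 0" "t \<noteq> 0" "Im t \<ge> 0" "Im (z * t) \<ge> 0"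
  shows "1 - z * (of_real c)\<^sup>2 * t\<^sup>2 \<noteq> 0" "P z t = - 1 / (z * Q z t)"
    "1 - z * (of_real c)\<^sup>2 * t\<^sup>2 = - (z * of_real c * t) * Q z t"
proof -
  have z: "z \<noteq> 0" using assms by auto
  have q: "Q z t \<noteq> 0" using Q_sector[OF assms] by (auto simp: sector_def)
  show *: "1 - z * (of_real c)\<^sup>2 * t\<^sup>2 = - (z * of_real c * t) * Q z t"
    using z c assms by (simp add: Q_def J_def divide_simps) (simp add: power2_eq_square algebra_simps)
  show "1 - z * (of_real c)\<^sup>2 * t\<^sup>2 \<noteq> 0" unfolding * using z q c assms by simp
  show "P z t = - 1 / (z * Q z t)"
    unfolding P_def * using z q c assms by (simp add: divide_simps)
qed

lemma Im_P:
  assumes "Im z > 0" "t \<noteq> 0" "Im t \<ge> 0" "Im (z * t) \<ge> 0"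
  shows "Im (P z t) = (cmod (P z t))\<^sup>2 * Im (z * Q z t)"
    and "Im (z * P z t) = (cmod z)\<^sup>2 * (cmod (P z t))\<^sup>2 * Im (Q z t)"
proof -
  have z: "z \<noteq> 0" using assms by auto
  have *: "(cmod (P z t))\<^sup>2 = 1 / (cmod (z * Q z t))\<^sup>2"
    by (simp add: P_eq(2)[OF assms] norm_divide power_divide)
  show "Im (P z t) = (cmod (P z t))\<^sup>2 * Im (z * Q z t)"
    unfolding * unfolding P_eq(2)[OF assms] Im_minus_inverse by simp
  have "z * P z t = - 1 / Q z t" using z by (simp add: P_eq(2)[OF assms])
  then show "Im (z * P z t) = (cmod z)\<^sup>2 * (cmod (P z t))\<^sup>2 * Im (Q z t)"
    unfolding * using z by (simp only: Im_minus_inverse) (simp add: norm_mult power_mult_distrib)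
qed

lemma P_sector:
  assumes "Im z > 0" "t \<noteq> 0" "Im t \<ge> 0" "Im (z * t) \<ge> 0"
  shows "P z t \<in> sector z"
proof -
  have q: "Q z t \<in> sector z" by (rule Q_sector[OF assms])
  then have "P z t \<noteq> 0" using assms by (auto simp: P_eq(2)[OF assms] sector_def)
  then show ?thesis using q assms by (auto simp: sector_def Im_P[OF assms] intro!: mult_pos_pos)
qed

lemma P_closed_sector:
  assumes "Im z > 0" "Im t \<ge> 0" "Im (z * t) \<ge> 0"
  shows "Im (P z t) \<ge> 0" "Im (z * P z t) \<ge> 0"
  using P_sector[of z t] assms by (cases "t = 0"; auto simp: sector_def P_def)+

lemma S_denominator:
  assumes "Im z > 0" "Im t \<ge> 0" "Im (z * t) \<ge> 0" "k < n"
  shows "Im (z * (1 + of_real (r k) * P z t)) \<ge> Im z"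
proof -
  have "Im (z * (1 + of_real (r k) * P z t)) = Im z + r k * Im (z * P z t)"
    by (simp add: distrib_left)
  then show ?thesis using P_closed_sector(2)[OF assms(1-3)] r[OF assms(4)] by simp
qed

lemma S_denominator_nz:
  assumes "Im z > 0" "Im t \<ge> 0" "Im (z * t) \<ge> 0" "k < n"
  shows "z \<noteq> 0" "1 + of_real (r k) * P z t \<noteq> 0"
proof -
  have "z * (1 + of_real (r k) * P z t) \<noteq> 0" using S_denominator[OF assms] assms by (metis less_le_not_le zero_complex.sel(2))
  then show "z \<noteq> 0" "1 + of_real (r k) * P z t \<noteq> 0" by auto
qed

lemma S_bound:
  assumes "Im z > 0" "Im t \<ge> 0" "Im (z * t) \<ge> 0" "k < n"
  shows "cmod (S z t k) \<le> 1 / Im z"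
proof -
  have "Im z \<le> cmod (z * (1 + of_real (r k) * P z t))"
    using S_denominator[OF assms] abs_Im_le_cmod[of "z * (1 + of_real (r k) * P z t)"] by linarith
  then show ?thesis using assms(1) unfolding S_def norm_divide by (intro frac_le) auto
qed

lemma Im_S:
  assumes "Im z > 0" "Im t \<ge> 0" "Im (z * t) \<ge> 0" "k < n"
  shows "Im (S z t k) = (cmod (S z t k))\<^sup>2 * (Im z + r k * Im (z * P z t))"
    and "Im (z * S z t k) = (cmod z)\<^sup>2 * (cmod (S z t k))\<^sup>2 * (r k * Im (P z t))"
proof -
  let ?x = "1 + of_real (r k) * P z t"
  have z: "z \<noteq> 0" using assms by auto
  have *: "(cmod (S z t k))\<^sup>2 = 1 / (cmod (z * ?x))\<^sup>2"
    by (simp add: S_def norm_divide power_divide)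
  have e: "Im (z * ?x) = Im z + r k * Im (z * P z t)" "Im ?x = r k * Im (P z t)" by (simp_all add: distrib_left)
  show "Im (S z t k) = (cmod (S z t k))\<^sup>2 * (Im z + r k * Im (z * P z t))"
    unfolding * unfolding S_def Im_minus_inverse e by simp
  have "z * S z t k = - 1 / ?x" using z by (simp add: S_def)
  then have "Im (z * S z t k) = Im ?x / (cmod ?x)\<^sup>2" by (simp only: Im_minus_inverse)
  then show "Im (z * S z t k) = (cmod z)\<^sup>2 * (cmod (S z t k))\<^sup>2 * (r k * Im (P z t))"
    unfolding * e using z by (simp add: norm_mult power_mult_distrib)
qed

lemma S_sector:
  assumes "Im z > 0" "t \<noteq> 0" "Im t \<ge> 0" "Im (z * t) \<ge> 0" "k < n"
  shows "S z t k \<in> sector z"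
proof -
  have p: "P z t \<in> sector z" by (rule P_sector[OF assms(1-4)])
  have "S z t k \<noteq> 0" using S_denominator_nz[OF assms(1,3-5)] by (simp add: S_def)
  then show ?thesis using p assms(1) r[OF assms(5)]
    by (auto simp: sector_def Im_S[OF assms(1,3-5)] intro!: mult_pos_pos add_pos_pos)
qed

lemma Im_\<Phi>:
  "Im (\<Phi> z t) = (1 / real n) * (\<Sum>k<n. r k * Im (S z t k))"
  "Im (z * \<Phi> z t) = (1 / real n) * (\<Sum>k<n. r k * Im (z * S z t k))"
proof -
  have *: "w * \<Phi> z t = of_real (1 / real n) * (\<Sum>k<n. of_real (r k) * (w * S z t k))" for w
    by (simp add: \<Phi>_def sum_distrib_left mult_ac)
  show "Im (\<Phi> z t) = (1 / real n) * (\<Sum>k<n. r k * Im (S z t k))"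
    using arg_cong[OF *[of 1], of Im] by (simp del: of_real_divide)
  show "Im (z * \<Phi> z t) = (1 / real n) * (\<Sum>k<n. r k * Im (z * S z t k))"
    using arg_cong[OF *[of z], of Im] by (simp del: of_real_divide)
qed

lemma \<Phi>_sector:
  assumes "Im z > 0" "t \<noteq> 0" "Im t \<ge> 0" "Im (z * t) \<ge> 0"
  shows "\<Phi> z t \<in> sector z"
proof -
  have "0 < (\<Sum>k<n. r k * Im (S z t k))" "0 < (\<Sum>k<n. r k * Im (z * S z t k))"
    using S_sector[OF assms] r n
    by (auto simp: sector_def lessThan_empty_iff intro!: sum_pos mult_pos_pos)
  then show ?thesis using n by (simp add: sector_def Im_\<Phi>)
qed

lemma \<Phi>_bound:
  assumes "Im z > 0" "Im t \<ge> 0" "Im (z * t) \<ge> 0"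
  shows "cmod (\<Phi> z t) \<le> m / Im z"
proof -
  have "cmod (\<Sum>k<n. of_real (r k) * S z t k) \<le> (\<Sum>k<n. cmod (of_real (r k) * S z t k))"
    by (rule norm_sum)
  also have "\<dots> \<le> (\<Sum>k<n. r k * (1 / Im z))"
  proof (rule sum_mono)
    fix k assume "k \<in> {..<n}"
    then have k: "k < n" by simp
    then have "r k * cmod (S z t k) \<le> r k * (1 / Im z)"
      using S_bound[OF assms] r by (intro mult_left_mono) (auto simp: less_imp_le)
    then show "cmod (of_real (r k) * S z t k) \<le> r k * (1 / Im z)"
      using r[OF k] by (simp add: norm_mult)
  qed
  finally have "cmod (\<Sum>k<n. of_real (r k) * S z t k) \<le> (\<Sum>k<n. r k) * (1 / Im z)"
    by (simp only: sum_distrib_right)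
  then have "(1 / real n) * cmod (\<Sum>k<n. of_real (r k) * S z t k) \<le> (1 / real n) * ((\<Sum>k<n. r k) * (1 / Im z))"
    by (rule mult_left_mono) simp
  then show ?thesis by (simp add: \<Phi>_def m_def norm_mult norm_divide)
qed

text \<open>
  Brouwer's theorem on the closed cone cut off at radius \<open>m / Im z\<close>, which \<open>\<Phi> z\<close> maps to itself. The
  fixed point is not \<open>0\<close>, since \<open>\<Phi> z 0 = - m / z\<close>.
\<close>

lemma \<Phi>_fixed_point_exists:
  assumes z: "Im z > 0"
  shows "\<exists>t\<in>sector z. \<Phi> z t = t"
proof -
  define X where "X = {t. 0 \<le> Im t} \<inter> {t. 0 \<le> Im (z * t)} \<inter> cball 0 (m / Im z)"
  have "closed {t. 0 \<le> Im t}" "closed {t. 0 \<le> Im (z * t)}"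
    by (intro closed_Collect_le continuous_intros)+
  then have comp: "compact X" unfolding X_def by (intro closed_Int_compact closed_Int) auto
  have "convex {t. 0 \<le> Im t}" by (rule convex_halfspace_Im_ge)
  moreover have "convex {t. 0 \<le> Im (z * t)}"
    unfolding convex_def by (auto simp: distrib_left intro!: add_nonneg_nonneg mult_nonneg_nonneg)
  ultimately have conv: "convex X" unfolding X_def by (intro convex_Int convex_cball)
  have ne: "X \<noteq> {}" using z m_pos by (auto simp: X_def ex_in_conv[symmetric] intro!: exI[of _ 0])
  have Xs: "Im t \<ge> 0" "Im (z * t) \<ge> 0" if "t \<in> X" for t using that by (auto simp: X_def)
  have d: "1 - z * (of_real c)\<^sup>2 * t\<^sup>2 \<noteq> 0" if "t \<in> X" for t
    using P_eq(1)[OF z _ Xs[OF that]] by (cases "t = 0") auto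
  have "continuous_on X (\<Phi> z)"
    unfolding \<Phi>_def S_def P_def
    using d S_denominator_nz[OF z Xs, unfolded P_def] by (intro continuous_intros) auto
  moreover have "\<Phi> z \<in> X \<rightarrow> X"
  proof
    fix t assume t: "t \<in> X"
    have "Im (\<Phi> z t) \<ge> 0 \<and> Im (z * \<Phi> z t) \<ge> 0"
      unfolding Im_\<Phi> using Im_S[OF z Xs[OF t]] P_closed_sector[OF z Xs[OF t]] r z n
      by (auto intro!: sum_nonneg mult_nonneg_nonneg add_nonneg_nonneg divide_nonneg_nonneg simp: less_imp_le)
    then show "\<Phi> z t \<in> X" using \<Phi>_bound[OF z Xs[OF t]] by (simp add: X_def)
  qed
  ultimately obtain t where t: "t \<in> X" "\<Phi> z t = t"
    using brouwer[OF comp conv ne] by blast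
  have "t \<noteq> 0"
  proof
    assume "t = 0"
    then have "z * \<Phi> z 0 = 0" using t by simp
    moreover have "z \<noteq> 0" using z by auto
    then have "z * \<Phi> z 0 = - of_real m"
      using n by (auto simp: \<Phi>_def S_def P_def m_def sum_distrib_left sum_divide_distrib sum_negf)
    ultimately show False using m_pos by simp
  qed
  then have "\<Phi> z t \<in> sector z" using \<Phi>_sector z Xs[OF t(1)] by blast
  then show ?thesis using t by auto
qed

text \<open>
  The factor \<open>\<delta>\<close> dominates the derivative of \<open>\<Phi> z\<close> at \<open>t\<close>, and its square root enters the
  comparison of two points.
\<close>

definition \<sigma> :: "complex \<Rightarrow> complex \<Rightarrow> real" where
  "\<sigma> z t = (1 / real n) * (\<Sum>k<n. (r k)\<^sup>2 * (cmod (S z t k))\<^sup>2)"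

definition \<delta> :: "complex \<Rightarrow> complex \<Rightarrow> real" where
  "\<delta> z t = c * (cmod z)\<^sup>2 * (cmod (P z t))\<^sup>2 * (1 + cmod z * (cmod (J z t))\<^sup>2) * \<sigma> z t"

lemma sectorD:
  assumes "t \<in> sector z" "Im z > 0"
  shows "t \<noteq> 0" "Im t > 0" "Im (z * t) > 0" "Im t \<ge> 0" "Im (z * t) \<ge> 0" "z \<noteq> 0"
  using assms by (auto simp: sector_def)

lemma \<sigma>_nonneg: "\<sigma> z t \<ge> 0"
  by (auto simp: \<sigma>_def intro!: sum_nonneg divide_nonneg_nonneg)

text \<open>
  At a fixed point, follow both coordinates through the definition of \<open>\<Phi>\<close>. They satisfy a
  linear system with nonnegative coefficients, in which only the first equation has the extra
  positive term coming from \<open>Im z\<close>. The weights of the combination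
  \<open>\<bar>z\<bar> Im t + Im (z t)\<close> form a left eigenvector of the coefficient matrix with eigenvalue \<open>\<delta> z t\<close>,
  which must therefore be less than \<open>1\<close>.
\<close>

lemma \<delta>_less_1:
  assumes z: "Im z > 0" and t: "t \<in> sector z" and fp: "\<Phi> z t = t"
  shows "\<delta> z t < 1"
proof -
  note tt = sectorD[OF t z]
  define p j s where "p = (cmod (P z t))\<^sup>2" and "j = (cmod (J z t))\<^sup>2" and "s = \<sigma> z t"
  define a b Z where "a = Im t" and "b = Im (z * t)" and "Z = cmod z"
  have Z: "Z > 0" using z by (auto simp: Z_def)
  have ab: "a > 0" "b > 0" using tt by (auto simp: a_def b_def)
  have q: "Im (Q z t) = c * (a + j * b)" "Im (z * Q z t) = c * (b + Z\<^sup>2 * j * a)"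
    using Im_Q[OF z tt(1)] by (simp_all add: a_def b_def j_def Z_def)
  have p: "Im (P z t) = p * (c * (b + Z\<^sup>2 * j * a))" "Im (z * P z t) = Z\<^sup>2 * p * (c * (a + j * b))"
    using Im_P[OF z tt(1,4,5)] by (simp_all only: p_def Z_def q[symmetric, unfolded Z_def])
  have "a = (1 / real n) * (\<Sum>k<n. r k * ((cmod (S z t k))\<^sup>2 * Im z)) + s * Im (z * P z t)"
  proof -
    have "a = (1 / real n) * (\<Sum>k<n. r k * ((cmod (S z t k))\<^sup>2 * (Im z + r k * Im (z * P z t))))"
      using Im_\<Phi>(1)[of z t] Im_S(1)[OF z tt(4,5)] by (simp add: fp a_def)
    also have "(\<Sum>k<n. r k * ((cmod (S z t k))\<^sup>2 * (Im z + r k * Im (z * P z t)))) =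
      (\<Sum>k<n. r k * ((cmod (S z t k))\<^sup>2 * Im z)) + (\<Sum>k<n. (r k)\<^sup>2 * (cmod (S z t k))\<^sup>2) * Im (z * P z t)"
      unfolding sum_distrib_right sum.distrib[symmetric]
      by (intro sum.cong) (auto simp: algebra_simps power2_eq_square)
    finally show ?thesis by (simp add: s_def \<sigma>_def algebra_simps)
  qed
  moreover have "(1 / real n) * (\<Sum>k<n. r k * ((cmod (S z t k))\<^sup>2 * Im z)) > 0"
  proof -
    have "(\<Sum>k<n. r k * ((cmod (S z t k))\<^sup>2 * Im z)) > 0"
    proof (rule sum_pos)
      fix k assume "k \<in> {..<n}"
      then have "k < n" by simp
      from S_sector[OF z tt(1,4,5) this] have "S z t k \<noteq> 0" by (auto simp: sector_def)
      then show "r k * ((cmod (S z t k))\<^sup>2 * Im z) > 0" using r[OF \<open>k < n\<close>] z by simp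
    qed (use n in \<open>auto simp: lessThan_empty_iff\<close>)
    then show ?thesis using n by simp
  qed
  ultimately have A: "a > s * Im (z * P z t)" by linarith
  have B: "b = Z\<^sup>2 * s * Im (P z t)"
  proof -
    have "b = (1 / real n) * (\<Sum>k<n. r k * (Z\<^sup>2 * (cmod (S z t k))\<^sup>2 * (r k * Im (P z t))))"
      using Im_\<Phi>(2)[of z t] Im_S(2)[OF z tt(4,5)] by (simp add: fp b_def Z_def)
    also have "(\<Sum>k<n. r k * (Z\<^sup>2 * (cmod (S z t k))\<^sup>2 * (r k * Im (P z t)))) =
      Z\<^sup>2 * (\<Sum>k<n. (r k)\<^sup>2 * (cmod (S z t k))\<^sup>2) * Im (P z t)"
      by (simp add: sum_distrib_right sum_distrib_left algebra_simps power2_eq_square)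
    finally show ?thesis by (simp add: s_def \<sigma>_def)
  qed
  have "\<delta> z t * (Z * a + b) = Z * (s * Im (z * P z t)) + Z\<^sup>2 * s * Im (P z t)"
    unfolding p \<delta>_def p_def[symmetric] j_def[symmetric] s_def[symmetric] Z_def[symmetric]
    by (simp add: algebra_simps power2_eq_square)
  also have "\<dots> < Z * a + b" using A B Z by simp
  finally have "\<delta> z t * (Z * a + b) < 1 * (Z * a + b)" by simp
  then show ?thesis using ab Z by (simp only: mult_less_cancel_right_pos add_pos_pos mult_pos_pos)
qed

text \<open>
  \<open>D\<close> and \<open>E\<close> are the divided differences of \<open>\<Phi>\<close> in \<open>t\<close> and in \<open>z\<close>. They allow different
  parameters \<open>z\<close> and \<open>w\<close>, so that the same estimate gives uniqueness (\<open>w = z\<close>) and the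
  regularity of the solution in \<open>z\<close> (\<open>w \<longrightarrow> z\<close>).
\<close>

definition SS2 where "SS2 z t w s = (1 / of_nat n) * (\<Sum>k<n. of_real ((r k)\<^sup>2) * S z t k * S w s k)"

definition D where
  "D z t w s = of_real c * z * w * P z t * P w s * (1 + z * J z t * J w s) * SS2 z t w s"

definition E where
  "E z t w s = (1 / of_nat n) * (\<Sum>k<n. of_real (r k) * S z t k * S w s k)
     - z * P z t * P w s * J z t * SS2 z t w s"

lemma \<Phi>_diff:
  assumes z: "Im z > 0" and t: "t \<in> sector z" and w: "Im w > 0" and s: "s \<in> sector w"
  shows "\<Phi> z t - \<Phi> w s = (z - w) * E z t w s + (t - s) * D z t w s"
proof -
  note tt = sectorD[OF t z] and ss = sectorD[OF s w]
  define A where "A = (1 / of_nat n) * (\<Sum>k<n. of_real (r k) * S z t k * S w s k)"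
  have qz: "Q z t \<noteq> 0" and qw: "Q w s \<noteq> 0"
    using Q_sector[OF z tt(1,4,5)] Q_sector[OF w ss(1,4,5)] by (auto simp: sector_def)
  have J: "J z t - J w s = of_real c * z * J z t * J w s * (t - s) - (z - w) * J z t / w"
    using tt(1,6) ss(1,6) c by (simp add: J_def divide_simps) (simp add: algebra_simps)
  have "z * P z t - w * P w s = (z * P z t) * (w * P w s) * (Q z t - Q w s)"
    unfolding P_eq(2)[OF z tt(1,4,5)] P_eq(2)[OF w ss(1,4,5)]
    using qz qw tt(6) ss(6) by (simp add: divide_simps) 
  also have "Q z t - Q w s = of_real c * (t - s) + (J z t - J w s)"
    by (simp add: Q_def algebra_simps)
  finally have P: "z * P z t - w * P w s = z * w * P z t * P w s *
     (of_real c * (1 + z * J z t * J w s) * (t - s) - (z - w) * J z t / w)"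
    unfolding J by (simp add: algebra_simps)
  have S: "S z t k - S w s k = S z t k * S w s k * ((z - w) + of_real (r k) * (z * P z t - w * P w s))" if "k < n" for k
    using S_denominator_nz[OF z tt(4,5) that] S_denominator_nz[OF w ss(4,5) that]
    by (simp add: S_def divide_simps) (simp add: algebra_simps)
  have "\<Phi> z t - \<Phi> w s = (1 / of_nat n) * (\<Sum>k<n. of_real (r k) * (S z t k - S w s k))"
    by (simp add: \<Phi>_def sum_subtractf algebra_simps)
  also have "(\<Sum>k<n. of_real (r k) * (S z t k - S w s k)) =
     (\<Sum>k<n. (z - w) * (of_real (r k) * S z t k * S w s k) + (z * P z t - w * P w s) * (of_real ((r k)\<^sup>2) * S z t k * S w s k))"
    by (intro sum.cong) (auto simp: S algebra_simps power2_eq_square)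
  also have "\<dots> = (z - w) * (\<Sum>k<n. of_real (r k) * S z t k * S w s k)
       + (z * P z t - w * P w s) * (\<Sum>k<n. of_real ((r k)\<^sup>2) * S z t k * S w s k)"
    by (simp add: sum.distrib sum_distrib_left)
  finally have fin: "\<Phi> z t - \<Phi> w s = (z - w) * A + (z * P z t - w * P w s) * SS2 z t w s"
    unfolding SS2_def A_def distrib_left by (simp only: mult.left_commute)
  have zP: "z * P z t - w * P w s = z * P z t * P w s *
     (w * of_real c * (1 + z * J z t * J w s) * (t - s) - (z - w) * J z t)"
    unfolding P using ss(6) by (simp add: right_diff_distrib mult_ac)
  then show ?thesis unfolding fin zP E_def D_def A_def[symmetric] by (simp add: algebra_simps)
qed

lemma SS2_bound: "cmod (SS2 z t w s) \<le> sqrt (\<sigma> z t) * sqrt (\<sigma> w s)"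
proof -
  have "cmod (SS2 z t w s) = (1 / real n) * cmod (\<Sum>k<n. of_real ((r k)\<^sup>2) * S z t k * S w s k)"
    by (simp add: SS2_def norm_mult norm_divide)
  also have "\<dots> \<le> (1 / real n) * (sqrt (\<Sum>k<n. (r k)\<^sup>2 * (cmod (S z t k))\<^sup>2) * sqrt (\<Sum>k<n. (r k)\<^sup>2 * (cmod (S w s k))\<^sup>2))"
    by (intro mult_left_mono weighted_Cauchy_Schwarz) auto
  also have "\<dots> = sqrt (\<sigma> z t) * sqrt (\<sigma> w s)"
    using n by (simp add: \<sigma>_def real_sqrt_mult real_sqrt_divide)
  finally show ?thesis .
qed

text \<open>
  The Cauchy-Schwarz inequality, applied to the sum over \<open>k\<close> and to \<open>1 + \<bar>z\<bar> \<bar>J\<bar> \<bar>J'\<bar>\<close>. This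
  produces \<open>1 + \<bar>z\<bar> \<bar>J'\<bar>\<^sup>2\<close> where \<open>\<delta> w s\<close> has \<open>1 + \<bar>w\<bar> \<bar>J'\<bar>\<^sup>2\<close>; the last factor makes up for it.
\<close>

lemma D_bound:
  assumes "cmod z > 0" "cmod w > 0"
  shows "(cmod (D z t w s))\<^sup>2 \<le> \<delta> z t * \<delta> w s * max 1 (cmod z / cmod w)"
proof -
  define p j a where "p = cmod (P z t)" and "j = cmod (J z t)" and "a = \<sigma> z t"
  define p' j' a' where "p' = cmod (P w s)" and "j' = cmod (J w s)" and "a' = \<sigma> w s"
  define Z W where "Z = cmod z" and "W = cmod w"
  have ZW: "Z > 0" "W > 0" using assms by (auto simp: Z_def W_def)
  have nn: "p \<ge> 0" "j \<ge> 0" "a \<ge> 0" "p' \<ge> 0" "j' \<ge> 0" "a' \<ge> 0"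
    by (auto simp: p_def j_def a_def p'_def j'_def a'_def \<sigma>_nonneg)
  have "cmod (1 + z * J z t * J w s) \<le> 1 + Z * j * j'"
    using norm_triangle_ineq[of 1 "z * J z t * J w s"] by (simp add: norm_mult Z_def j_def j'_def)
  then have "cmod (D z t w s) \<le> c * Z * W * p * p' * (1 + Z * j * j') * (sqrt a * sqrt a')"
    unfolding D_def norm_mult p_def p'_def Z_def W_def a_def a'_def j_def j'_def
    using c SS2_bound[of z t w s] by (intro mult_mono) (auto intro!: mult_nonneg_nonneg add_nonneg_nonneg)
  then have "(cmod (D z t w s))\<^sup>2 \<le> (c * Z * W * p * p' * (1 + Z * j * j') * (sqrt a * sqrt a'))\<^sup>2"
    by (intro power_mono) auto
  also have "\<dots> = (c * Z\<^sup>2 * p\<^sup>2 * a) * (c * W\<^sup>2 * p'\<^sup>2 * a') * (1 + Z * j * j')\<^sup>2"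
    using nn by (simp add: power_mult_distrib power2_eq_square algebra_simps)
  also have "\<dots> \<le> (c * Z\<^sup>2 * p\<^sup>2 * a) * (c * W\<^sup>2 * p'\<^sup>2 * a') * ((1 + Z * j\<^sup>2) * ((1 + W * j'\<^sup>2) * max 1 (Z / W)))"
  proof (rule mult_left_mono)
    have "(1 + Z * j * j')\<^sup>2 \<le> (1 + Z * j\<^sup>2) * (1 + Z * j'\<^sup>2)"
    proof -
      have "(1 + Z * j\<^sup>2) * (1 + Z * j'\<^sup>2) - (1 + Z * j * j')\<^sup>2 = Z * (j - j')\<^sup>2"
        by (simp add: power2_eq_square algebra_simps)
      moreover have "Z * (j - j')\<^sup>2 \<ge> 0" using ZW by simp
      ultimately show ?thesis by linarith
    qed
    also have "1 + Z * j'\<^sup>2 \<le> (1 + W * j'\<^sup>2) * max 1 (Z / W)"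
    proof -
      have "Z = W * (Z / W)" using ZW by simp
      also have "\<dots> \<le> W * max 1 (Z / W)" using ZW by (intro mult_left_mono) auto
      finally have "Z * j'\<^sup>2 \<le> W * max 1 (Z / W) * j'\<^sup>2" by (rule mult_right_mono) simp
      moreover have "1 \<le> max 1 (Z / W)" by simp
      ultimately show ?thesis by (simp add: algebra_simps)
    qed
    finally show "(1 + Z * j * j')\<^sup>2 \<le> (1 + Z * j\<^sup>2) * ((1 + W * j'\<^sup>2) * max 1 (Z / W))"
      using ZW by (simp add: mult_left_mono)
  qed (use nn c in \<open>auto intro!: mult_nonneg_nonneg\<close>)
  also have "\<dots> = \<delta> z t * \<delta> w s * max 1 (cmod z / cmod w)"
    unfolding \<delta>_def by (simp add: p_def j_def a_def p'_def j'_def a'_def Z_def W_def mult_ac)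
  finally show ?thesis .
qed

lemma \<delta>_nonneg: "\<delta> z t \<ge> 0"
  using c \<sigma>_nonneg by (auto simp: \<delta>_def intro!: mult_nonneg_nonneg add_nonneg_nonneg)

lemma \<Phi>_fixed_point_unique:
  assumes z: "Im z > 0" and t: "t \<in> sector z" "\<Phi> z t = t" and s: "s \<in> sector z" "\<Phi> z s = s"
  shows "s = t"
proof -
  have Z: "cmod z > 0" using z by auto
  have "(cmod (D z t z s))\<^sup>2 \<le> \<delta> z t * \<delta> z s"
    using D_bound[OF Z Z, of t s] Z by simp
  also have "\<dots> < 1 * 1"
    using \<delta>_less_1[OF z t] \<delta>_less_1[OF z s] \<delta>_nonneg by (intro mult_strict_mono') auto
  finally have "D z t z s \<noteq> 1" by auto
  moreover have "(t - s) * (1 - D z t z s) = 0"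
    using \<Phi>_diff[OF z t(1) z s(1)] t s by (simp add: algebra_simps)
  ultimately show ?thesis by simp
qed

definition T :: "complex \<Rightarrow> complex" where
  "T z = (THE t. t \<in> sector z \<and> \<Phi> z t = t)"

lemma T_eqI: "Im z > 0 \<Longrightarrow> t \<in> sector z \<Longrightarrow> \<Phi> z t = t \<Longrightarrow> T z = t"
  unfolding T_def using \<Phi>_fixed_point_unique by (intro the_equality) auto

lemma T: assumes "Im z > 0" shows "T z \<in> sector z" "\<Phi> z (T z) = T z"
proof -
  obtain t where "t \<in> sector z" "\<Phi> z t = t" using \<Phi>_fixed_point_exists[OF assms] by auto
  moreover from this have "T z = t" using T_eqI assms by blast
  ultimately show "T z \<in> sector z" "\<Phi> z (T z) = T z" by auto
qed

lemmas T_sectorD = sectorD[OF T(1)]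

lemma T_bound: "Im z > 0 \<Longrightarrow> cmod (T z) \<le> m / Im z"
  using \<Phi>_bound[of z "T z"] T[of z] T_sectorD[of z] by simp


text \<open>
  For \<open>w\<close> close to \<open>z\<close> the divided difference \<open>D\<close> stays below a constant \<open>q < 1\<close>, although nothing is
  known yet about \<open>T w\<close>: besides \<open>\<delta> z (T z)\<close>, only \<open>\<delta> w (T w) < 1\<close> enters. The latter
  inequality also bounds the product of \<open>P w (T w)\<close> and \<open>SS2\<close> in \<open>E\<close>.
\<close>

lemma T_lipschitz_at:
  assumes z: "Im z > 0"
  shows "\<exists>C. \<forall>\<^sub>F w in at z. cmod (T z - T w) \<le> C * cmod (z - w)"
proof -
  define t where "t = T z"
  have t: "t \<in> sector z" "\<Phi> z t = t" using T[OF z] by (auto simp: t_def)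
  note tt = sectorD[OF t(1) z]
  define d where "d = \<delta> z t"
  have d: "0 \<le> d" "d < 1" using \<delta>_less_1[OF z t] \<delta>_nonneg by (auto simp: d_def)
  define q where "q = sqrt ((1 + d) / 2)"
  have q: "q < 1" "q\<^sup>2 = (1 + d) / 2" "q \<ge> 0" using d by (auto simp: q_def)
  have Z: "cmod z > 0" using tt by simp
  define K where "K = m / (Im z * (Im z / 2)) + cmod z * cmod (P z t) * cmod (J z t) * sqrt (\<sigma> z t) * (2 / (sqrt c * cmod z))"
  have "((\<lambda>w. d * max 1 (cmod z / cmod w)) \<longlongrightarrow> d * max 1 (cmod z / cmod z)) (at z)"
    using Z by (intro tendsto_intros) auto
  then have "((\<lambda>w. d * max 1 (cmod z / cmod w)) \<longlongrightarrow> d) (at z)" using Z by simp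
  then have ev1: "\<forall>\<^sub>F w in at z. d * max 1 (cmod z / cmod w) < (1 + d) / 2"
    by (rule order_tendstoD) (use d in simp)
  have ev2: "\<forall>\<^sub>F w in at z. Im w > Im z / 2"
    by (rule order_tendstoD[of Im "Im z"]) (use z in \<open>auto intro!: tendsto_intros\<close>)
  have ev3: "\<forall>\<^sub>F w in at z. cmod w > cmod z / 2"
    by (rule order_tendstoD[of cmod "cmod z"]) (use Z in \<open>auto intro!: tendsto_intros\<close>)
  from ev1 ev2 ev3 have "\<forall>\<^sub>F w in at z. cmod (T z - T w) \<le> (K / (1 - q)) * cmod (z - w)"
  proof eventually_elim
    case (elim w)
    define s where "s = T w"
    have w: "Im w > 0" using elim z by simp
    have s: "s \<in> sector w" "\<Phi> w s = s" using T[OF w] by (auto simp: s_def)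
    note ss = sectorD[OF s(1) w]
    have W: "cmod w > 0" using ss by simp
    have "(cmod (D z t w s))\<^sup>2 \<le> d * \<delta> w s * max 1 (cmod z / cmod w)"
      using D_bound[OF Z W, of t s] by (simp add: d_def)
    also have "\<dots> = (d * max 1 (cmod z / cmod w)) * \<delta> w s" by (simp add: mult_ac)
    also have "\<dots> \<le> (d * max 1 (cmod z / cmod w)) * 1"
      using \<delta>_less_1[OF w s] d by (intro mult_left_mono mult_nonneg_nonneg) auto
    also have "\<dots> \<le> q\<^sup>2" using elim q by simp
    finally have Dq: "cmod (D z t w s) \<le> q" using q(3) by (rule power2_le_imp_le)
    then have Dq': "cmod (1 - D z t w s) \<ge> 1 - q"
      using norm_triangle_ineq2[of 1 "D z t w s"] by simp
    have "(t - s) * (1 - D z t w s) = (z - w) * E z t w s"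
      using \<Phi>_diff[OF z t(1) w s(1)] t s by (simp add: algebra_simps)
    then have eq: "cmod (t - s) * cmod (1 - D z t w s) = cmod (z - w) * cmod (E z t w s)"
      by (metis norm_mult)
    have "cmod (E z t w s) \<le> K"
    proof -
      have "cmod ((1 / of_nat n) * (\<Sum>k<n. of_real (r k) * S z t k * S w s k)) \<le> m * (1 / Im z * (1 / Im w))"
      proof -
        have "cmod (\<Sum>k<n. of_real (r k) * S z t k * S w s k) \<le> (\<Sum>k<n. cmod (of_real (r k) * S z t k * S w s k))"
          by (rule norm_sum)
        also have "\<dots> \<le> (\<Sum>k<n. r k * (1 / Im z * (1 / Im w)))"
        proof (rule sum_mono)
          fix k assume "k \<in> {..<n}"
          then have k: "k < n" by simp
          have "r k * (cmod (S z t k) * cmod (S w s k)) \<le> r k * (1 / Im z * (1 / Im w))"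
            using S_bound[OF z tt(4,5) k] S_bound[OF w ss(4,5) k] r[OF k] z
            by (intro mult_left_mono mult_mono) auto
          then show "cmod (of_real (r k) * S z t k * S w s k) \<le> r k * (1 / Im z * (1 / Im w))"
            using r[OF k] by (simp add: norm_mult mult_ac)
        qed
        also have "\<dots> = (\<Sum>k<n. r k) * (1 / Im z * (1 / Im w))" by (simp only: sum_distrib_right)
        finally have "(1 / real n) * cmod (\<Sum>k<n. of_real (r k) * S z t k * S w s k) \<le> (1 / real n) * ((\<Sum>k<n. r k) * (1 / Im z * (1 / Im w)))"
          by (rule mult_left_mono) simp
        then show ?thesis by (simp add: norm_mult norm_divide m_def)
      qed
      also have "\<dots> \<le> m / (Im z * (Im z / 2))"
      proof -
        have "1 / Im w \<le> 1 / (Im z / 2)" using z elim by (intro frac_le) auto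
        then have "m * (1 / Im z * (1 / Im w)) \<le> m * (1 / Im z * (1 / (Im z / 2)))"
          using m_pos z by (intro mult_left_mono) auto
        then show ?thesis by simp
      qed
      finally have E1: "cmod ((1 / of_nat n) * (\<Sum>k<n. of_real (r k) * S z t k * S w s k)) \<le> m / (Im z * (Im z / 2))" .
      have "c * (cmod w)\<^sup>2 * (cmod (P w s))\<^sup>2 * 1 * \<sigma> w s \<le> \<delta> w s"
        unfolding \<delta>_def using c \<sigma>_nonneg W by (intro mult_mono mult_nonneg_nonneg) auto
      then have "(sqrt c * cmod w * cmod (P w s) * sqrt (\<sigma> w s))\<^sup>2 \<le> 1\<^sup>2"
        using \<delta>_less_1[OF w s] c \<sigma>_nonneg by (simp add: power_mult_distrib)
      then have "sqrt c * cmod w * cmod (P w s) * sqrt (\<sigma> w s) \<le> 1"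
        by (rule power2_le_imp_le) simp
      then have "cmod (P w s) * sqrt (\<sigma> w s) \<le> 1 / (sqrt c * cmod w)"
        using c W by (simp add: pos_le_divide_eq mult_ac)
      also have "\<dots> \<le> 1 / (sqrt c * (cmod z / 2))"
        using c Z elim by (intro divide_left_mono mult_left_mono mult_pos_pos) auto
      finally have PW: "cmod (P w s) * sqrt (\<sigma> w s) \<le> 2 / (sqrt c * cmod z)" by simp
      have "cmod (z * P z t * P w s * J z t * SS2 z t w s) = cmod z * cmod (P z t) * cmod (J z t) * (cmod (P w s) * cmod (SS2 z t w s))"
        by (simp add: norm_mult mult_ac)
      also have "\<dots> \<le> cmod z * cmod (P z t) * cmod (J z t) * (cmod (P w s) * (sqrt (\<sigma> z t) * sqrt (\<sigma> w s)))"
        by (intro mult_left_mono SS2_bound mult_nonneg_nonneg) auto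
      also have "\<dots> = cmod z * cmod (P z t) * cmod (J z t) * sqrt (\<sigma> z t) * (cmod (P w s) * sqrt (\<sigma> w s))"
        by (simp add: mult_ac)
      also have "\<dots> \<le> cmod z * cmod (P z t) * cmod (J z t) * sqrt (\<sigma> z t) * (2 / (sqrt c * cmod z))"
        by (intro mult_left_mono PW mult_nonneg_nonneg) (auto simp: \<sigma>_nonneg)
      finally show ?thesis unfolding E_def K_def using E1
        by (intro order_trans[OF norm_triangle_ineq4] add_mono)
    qed
    then have "cmod (z - w) * cmod (E z t w s) \<le> cmod (z - w) * K" by (rule mult_left_mono) simp
    moreover have "cmod (t - s) * (1 - q) \<le> cmod (t - s) * cmod (1 - D z t w s)"
      using Dq' by (rule mult_left_mono) simp
    ultimately have "cmod (t - s) * (1 - q) \<le> cmod (z - w) * K" using eq by simp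
    then show ?case using q by (simp add: pos_le_divide_eq t_def s_def mult_ac)
  qed
  then show ?thesis ..
qed

lemma T_tendsto: assumes z: "Im z > 0" shows "(T \<longlongrightarrow> T z) (at z)"
proof -
  obtain C where C: "\<forall>\<^sub>F w in at z. cmod (T z - T w) \<le> C * cmod (z - w)" using T_lipschitz_at[OF z] ..
  have "((\<lambda>w. T w - T z) \<longlongrightarrow> 0) (at z)"
  proof (rule Lim_null_comparison)
    show "\<forall>\<^sub>F w in at z. cmod (T w - T z) \<le> C * cmod (z - w)"
      using C by (simp add: norm_minus_commute)
    have "((\<lambda>w. C * cmod (z - w)) \<longlongrightarrow> C * cmod (z - z)) (at z)" by (intro tendsto_intros)
    then show "((\<lambda>w. C * cmod (z - w)) \<longlongrightarrow> 0) (at z)" by simp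
  qed
  then show ?thesis by (simp add: LIM_zero_iff)
qed

text \<open>
  The difference quotient of \<open>T\<close> equals \<open>E / (1 - D)\<close>, and it converges because \<open>T\<close> is continuous and
  \<open>D \<noteq> 1\<close> in the limit.
\<close>

lemma T_holomorphic: "T holomorphic_on {z. Im z > 0}"
  unfolding holomorphic_on_def
proof
  fix z assume "z \<in> {z. Im z > 0}"
  then have z: "Im z > 0" by simp
  note t = T[OF z] and tt = T_sectorD[OF z z]
  have Jl: "((\<lambda>w. J w (T w)) \<longlongrightarrow> J z (T z)) (at z)"
    unfolding J_def by (intro tendsto_intros T_tendsto z) (use tt c in auto)
  have Pl: "((\<lambda>w. P w (T w)) \<longlongrightarrow> P z (T z)) (at z)"
    unfolding P_def by (intro tendsto_intros T_tendsto z P_eq(1)) (use tt z in auto)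
  have Sl: "((\<lambda>w. S w (T w) k) \<longlongrightarrow> S z (T z) k) (at z)" if "k < n" for k
    unfolding S_def by (intro tendsto_intros Pl) (use S_denominator_nz[OF z tt(4,5) that] in auto)
  have SSl: "((\<lambda>w. SS2 z (T z) w (T w)) \<longlongrightarrow> SS2 z (T z) z (T z)) (at z)"
    unfolding SS2_def by (intro tendsto_intros Sl) auto
  have Dl: "((\<lambda>w. D z (T z) w (T w)) \<longlongrightarrow> D z (T z) z (T z)) (at z)"
    unfolding D_def by (intro tendsto_intros Pl Jl SSl)
  have El: "((\<lambda>w. E z (T z) w (T w)) \<longlongrightarrow> E z (T z) z (T z)) (at z)"
    unfolding E_def by (intro tendsto_intros Pl Sl SSl) auto
  have Z: "cmod z > 0" using tt by simp
  have "(cmod (D z (T z) z (T z)))\<^sup>2 \<le> \<delta> z (T z) * \<delta> z (T z)"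
    using D_bound[OF Z Z, of "T z" "T z"] Z by simp
  also have "\<dots> < 1 * 1"
    using \<delta>_less_1[OF z t] \<delta>_nonneg by (intro mult_strict_mono') auto
  finally have D1: "1 - D z (T z) z (T z) \<noteq> 0" by auto
  define F where "F w = E z (T z) w (T w) / (1 - D z (T z) w (T w))" for w
  have Fl: "(F \<longlongrightarrow> F z) (at z)"
    unfolding F_def by (intro tendsto_intros El Dl D1)
  have "((\<lambda>w. 1 - D z (T z) w (T w)) \<longlongrightarrow> 1 - D z (T z) z (T z)) (at z)"
    by (intro tendsto_intros Dl)
  then have ev1: "\<forall>\<^sub>F w in at z. 1 - D z (T z) w (T w) \<noteq> 0"
    by (rule tendsto_imp_eventually_ne) (rule D1)
  have ev2: "\<forall>\<^sub>F w in at z. Im w > 0"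
    by (rule order_tendstoD[of Im "Im z"]) (use z in \<open>auto intro!: tendsto_intros\<close>)
  have ev3: "\<forall>\<^sub>F w in at z. w \<noteq> z" by (auto simp: eventually_at intro: exI[of _ 1])
  from ev1 ev2 ev3 have "\<forall>\<^sub>F w in at z. F w = (T w - T z) / (w - z)"
  proof eventually_elim
    case (elim w)
    have "T z - T w = (z - w) * E z (T z) w (T w) + (T z - T w) * D z (T z) w (T w)"
      using \<Phi>_diff[OF z t(1) elim(2) T(1)[OF elim(2)]] t(2) T(2)[OF elim(2)] by simp
    then have "(T w - T z) * (1 - D z (T z) w (T w)) = E z (T z) w (T w) * (w - z)"
      by (simp add: algebra_simps)
    then show ?case using elim by (simp add: F_def frac_eq_eq mult_ac)
  qed
  with Fl have "((\<lambda>w. (T w - T z) / (w - z)) \<longlongrightarrow> F z) (at z)"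
    by (rule Lim_transform_eventually)
  then have "(T has_field_derivative F z) (at z)" by (simp add: has_field_derivative_iff)
  then show "T field_differentiable at z within {z. Im z > 0}"
    by (metis field_differentiable_at_within field_differentiable_def)
qed

lemma S_holomorphic:
  assumes "k < n" shows "(\<lambda>z. S z (T z) k) holomorphic_on {z. Im z > 0}"
proof -
  have P: "(\<lambda>z. P z (T z)) holomorphic_on {z. Im z > 0}"
    unfolding P_def by (intro holomorphic_intros T_holomorphic P_eq(1)) (auto dest: T_sectorD)
  show ?thesis unfolding S_def
    by (intro holomorphic_intros P)
      (use S_denominator_nz[OF _ _ _ assms] T_sectorD in auto)
qed

text \<open>
  The bound \<open>\<bar>t\<bar> \<le> m / y\<close> gives \<open>P \<longrightarrow> 0\<close>, hence \<open>z S \<longrightarrow> -1\<close>. Averaging, \<open>z t \<longrightarrow> - m\<close> and therefore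
  \<open>z P \<longrightarrow> - c m\<close>, which is the next term in the expansion of \<open>S\<close>.
\<close>

lemma asymptotics_imaginary_axis:
  shows "k < n \<Longrightarrow> ((\<lambda>y. \<i> * of_real y * S (\<i> * of_real y) (T (\<i> * of_real y)) k) \<longlongrightarrow> -1) at_top"
    and "k < n \<Longrightarrow> ((\<lambda>y. - (\<i> * of_real y) * (\<i> * of_real y * S (\<i> * of_real y) (T (\<i> * of_real y)) k + 1))
            \<longlongrightarrow> of_real (c * m * r k)) at_top"
proof -
  define z where "z y = \<i> * of_real y" for y :: real
  define t where "t y = T (z y)" for y
  have Imz: "Im (z y) = y" for y by (simp add: z_def times_complex.sel)
  have ev: "\<forall>\<^sub>F y in at_top. (0::real) < y" by (rule eventually_gt_at_top)
  have tb: "cmod (t y) \<le> m / y" if "y > 0" for y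
    using T_bound[of "z y"] that by (simp add: t_def Imz)
  have "((\<lambda>y. z y * (of_real c)\<^sup>2 * (t y)\<^sup>2) \<longlongrightarrow> 0) at_top"
  proof (rule Lim_null_comparison)
    show "\<forall>\<^sub>F y in at_top. cmod (z y * (of_real c)\<^sup>2 * (t y)\<^sup>2) \<le> y * c\<^sup>2 * (m / y)\<^sup>2"
      using ev
    proof eventually_elim
      case (elim y)
      then show ?case using c tb[OF elim]
        by (auto simp: norm_mult norm_power z_def intro!: mult_left_mono power_mono)
    qed
    have "((\<lambda>y::real. 1 / y) \<longlongrightarrow> 0) at_top" by real_asymp
    from tendsto_mult[OF tendsto_const[of "c\<^sup>2 * m\<^sup>2"] this]
    have "((\<lambda>y. c\<^sup>2 * m\<^sup>2 * (1 / y)) \<longlongrightarrow> 0) at_top" by simp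
    moreover have "\<forall>\<^sub>F y in at_top. c\<^sup>2 * m\<^sup>2 * (1 / y) = y * c\<^sup>2 * (m / y)\<^sup>2"
      using ev by eventually_elim (simp add: power2_eq_square)
    ultimately show "((\<lambda>y. y * c\<^sup>2 * (m / y)\<^sup>2) \<longlongrightarrow> 0) at_top"
      by (rule Lim_transform_eventually)
  qed
  then have dl: "((\<lambda>y. 1 - z y * (of_real c)\<^sup>2 * (t y)\<^sup>2) \<longlongrightarrow> 1 - 0) at_top"
    by (intro tendsto_intros)
  have tl: "(t \<longlongrightarrow> 0) at_top"
  proof (rule Lim_null_comparison)
    show "\<forall>\<^sub>F y in at_top. cmod (t y) \<le> m / y" using ev by eventually_elim (rule tb)
    have "((\<lambda>y. a / y) \<longlongrightarrow> 0) at_top" for a :: real by real_asymp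
    then show "((\<lambda>y. m / y) \<longlongrightarrow> 0) at_top" .
  qed
  have "((\<lambda>y. P (z y) (t y)) \<longlongrightarrow> of_real c * 0 / (1 - 0)) at_top"
    unfolding P_def by (intro tendsto_intros tl dl) auto
  then have Pl: "((\<lambda>y. P (z y) (t y)) \<longlongrightarrow> 0) at_top" by simp
  have zS: "z y * S (z y) (t y) k = - 1 / (1 + of_real (r k) * P (z y) (t y))" if "y > 0" for y k
    using that by (simp add: S_def z_def)
  have Sl: "((\<lambda>y. z y * S (z y) (t y) k) \<longlongrightarrow> -1) at_top" for k
  proof -
    have "((\<lambda>y. - 1 / (1 + of_real (r k) * P (z y) (t y))) \<longlongrightarrow> - 1 / (1 + of_real (r k) * 0)) at_top"
      by (intro tendsto_intros Pl) auto
    then have "((\<lambda>y. - 1 / (1 + of_real (r k) * P (z y) (t y))) \<longlongrightarrow> - 1) at_top" by simp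
    moreover have "\<forall>\<^sub>F y in at_top. - 1 / (1 + of_real (r k) * P (z y) (t y)) = z y * S (z y) (t y) k"
      using ev by eventually_elim (simp add: zS)
    ultimately show ?thesis by (rule Lim_transform_eventually)
  qed
  show "((\<lambda>y. \<i> * of_real y * S (\<i> * of_real y) (T (\<i> * of_real y)) k) \<longlongrightarrow> -1) at_top"
    using Sl[of k] by (simp add: z_def t_def)
  have "((\<lambda>y. (1 / of_nat n) * (\<Sum>k<n. of_real (r k) * (z y * S (z y) (t y) k))) \<longlongrightarrow> (1 / of_nat n) * (\<Sum>k<n. of_real (r k) * -1)) at_top"
    by (intro tendsto_intros Sl)
  moreover have "\<forall>\<^sub>F y in at_top. (1 / of_nat n) * (\<Sum>k<n. of_real (r k) * (z y * S (z y) (t y) k)) = z y * t y"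
    using ev
  proof eventually_elim
    case (elim y)
    have "z y * t y = z y * \<Phi> (z y) (t y)" using T(2)[of "z y"] elim by (simp add: t_def Imz)
    then show ?case by (simp add: \<Phi>_def sum_distrib_left mult_ac)
  qed
  ultimately have "((\<lambda>y. z y * t y) \<longlongrightarrow> (1 / of_nat n) * (\<Sum>k<n. of_real (r k) * -1)) at_top"
    by (rule Lim_transform_eventually)
  then have ztl: "((\<lambda>y. z y * t y) \<longlongrightarrow> - of_real m) at_top" by (simp add: m_def sum_negf)
  have zPl: "((\<lambda>y. z y * P (z y) (t y)) \<longlongrightarrow> - (of_real c * of_real m)) at_top"
  proof -
    have "((\<lambda>y. of_real c * (z y * t y) / (1 - z y * (of_real c)\<^sup>2 * (t y)\<^sup>2)) \<longlongrightarrow> of_real c * - of_real m / (1 - 0)) at_top"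
      by (intro tendsto_intros ztl dl) auto
    then show ?thesis by (simp add: P_def mult_ac)
  qed
  assume k: "k < n"
  have "((\<lambda>y. - of_real (r k) * (z y * P (z y) (t y)) / (1 + of_real (r k) * P (z y) (t y))) \<longlongrightarrow>
       - of_real (r k) * (- (of_real c * of_real m)) / (1 + of_real (r k) * 0)) at_top"
    by (intro tendsto_intros Pl zPl) auto
  moreover have "\<forall>\<^sub>F y in at_top. - of_real (r k) * (z y * P (z y) (t y)) / (1 + of_real (r k) * P (z y) (t y))
      = - z y * (z y * S (z y) (t y) k + 1)"
    using ev
  proof eventually_elim
    case (elim y)
    have "1 + of_real (r k) * P (z y) (t y) \<noteq> 0"
      using S_denominator_nz(2)[OF _ _ _ k, of "z y" "t y"] T_sectorD[of "z y"] elim by (simp add: t_def Imz)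
    then show ?case unfolding zS[OF elim] by (simp add: field_simps)
  qed
  ultimately have "((\<lambda>y. - z y * (z y * S (z y) (t y) k + 1)) \<longlongrightarrow>
       - of_real (r k) * (- (of_real c * of_real m)) / (1 + of_real (r k) * 0)) at_top"
    by (rule Lim_transform_eventually)
  then show "((\<lambda>y. - (\<i> * of_real y) * (\<i> * of_real y * S (\<i> * of_real y) (T (\<i> * of_real y)) k + 1))
            \<longlongrightarrow> of_real (c * m * r k)) at_top"
    by (simp add: z_def t_def mult_ac)
qed

text \<open>
  For \<open>Re z < 0\<close> the cone lies in the right half-plane, so that \<open>\<bar>1 + r P\<bar> \<ge> 1\<close>.
\<close>

lemma S_bound_left_half_plane:
  assumes "Im z > 0" "Re z < 0" "k < n"
  shows "cmod (S z (T z) k) \<le> 1 / cmod z"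
proof -
  have "P z (T z) \<in> sector z" using T_sectorD[OF assms(1,1)] P_sector assms by auto
  then have "Re z * Im (P z (T z)) + Im z * Re (P z (T z)) > 0" "Im (P z (T z)) > 0"
    by (auto simp: sector_def times_complex.sel)
  then have "Im z * Re (P z (T z)) > 0"
    using mult_neg_pos[of "Re z" "Im (P z (T z))"] assms by linarith
  then have "Re (P z (T z)) > 0" using assms by (simp add: zero_less_mult_iff)
  then have "1 \<le> Re (1 + of_real (r k) * P z (T z))" using r[OF assms(3)] by (simp add: times_complex.sel)
  then have "1 \<le> cmod (1 + of_real (r k) * P z (T z))" using complex_Re_le_cmod order_trans by blast
  then have "cmod z * 1 \<le> cmod z * cmod (1 + of_real (r k) * P z (T z))" by (rule mult_left_mono) simp
  moreover have "cmod z > 0" using assms by auto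
  ultimately show ?thesis unfolding S_def norm_divide norm_mult by (intro frac_le) auto
qed

text \<open>
  The representation theorem applies to each eigenvalue separately: the cone condition provides the
  signs, and the asymptotics at \<open>\<i> \<infinity>\<close> the mass and the first moment.
\<close>

theorem S_spectral_measure:
  assumes k: "k < n"
  shows "\<exists>M. real_distribution M \<and> measure M {..<0} = 0 \<and>
    (\<forall>z. Im z > 0 \<longrightarrow> S z (T z) k = (LINT x|M. 1 / (of_real x - z))) \<and>
    has_bochner_integral M (\<lambda>x. x) (c * m * r k)"
proof -
  have SS: "S z (T z) k \<in> sector z" if "Im z > 0" for z
    using S_sector[OF that _ _ _ k] T_sectorD[OF that that] by blast
  obtain M where M: "real_distribution M" "\<And>z. Im z > 0 \<Longrightarrow> S z (T z) k = (LINT x|M. 1 / (of_real x - z))"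
  proof (rule stieltjes_representation[of "\<lambda>z. S z (T z) k"])
    show "(\<lambda>z. S z (T z) k) holomorphic_on {z. 0 < Im z}" by (rule S_holomorphic[OF k])
    show "0 \<le> Im (S z (T z) k)" if "Im z > 0" for z using SS[OF that] by (simp add: sector_def)
    show "cmod (S z (T z) k) \<le> 1 / Im z" if "Im z > 0" for z
      using S_bound[OF that _ _ k] T_sectorD[OF that that] by blast
    have "((\<lambda>y. - Re (\<i> * of_real y * S (\<i> * of_real y) (T (\<i> * of_real y)) k)) \<longlongrightarrow> - Re (-1)) at_top"
      by (intro tendsto_intros asymptotics_imaginary_axis(1) k)
    moreover have "\<i> * of_real y = Complex 0 y" for y by (simp add: complex_eq_iff times_complex.sel)
    ultimately show "((\<lambda>y. y * Im (S (Complex 0 y) (T (Complex 0 y)) k)) \<longlongrightarrow> 1) at_top"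
      by (simp add: times_complex.sel)
  qed blast
  interpret real_distribution M by (rule M)
  have supp: "measure M {..<0} = 0"
  proof (rule nonneg_support_of_stieltjes_transform)
    show "0 \<le> Im (z * (LINT x|M. 1 / (of_real x - z)))" if "Im z > 0" for z
      using SS[OF that] M(2)[OF that] by (simp add: sector_def)
    show "cmod (LINT x|M. 1 / (of_real x - z)) \<le> 1 / cmod z" if "Im z > 0" "Re z < 0" for z
      using S_bound_left_half_plane[OF that k] M(2)[OF that(1)] by simp
  qed
  have "has_bochner_integral M (\<lambda>x. x) (c * m * r k)"
  proof (rule first_moment_from_stieltjes_transform[OF supp])
    have "((\<lambda>y. Re (- (\<i> * of_real y) * (\<i> * of_real y * S (\<i> * of_real y) (T (\<i> * of_real y)) k + 1)))
            \<longlongrightarrow> Re (of_real (c * m * r k))) at_top"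
      by (intro tendsto_Re asymptotics_imaginary_axis(2) k)
    then have "((\<lambda>y. Re (- (\<i> * of_real y) * (\<i> * of_real y * S (\<i> * of_real y) (T (\<i> * of_real y)) k + 1)))
            \<longlongrightarrow> c * m * r k) at_top" by (simp only: Re_complex_of_real)
    moreover have "\<forall>\<^sub>F y in at_top. Re (- (\<i> * of_real y) * (\<i> * of_real y * S (\<i> * of_real y) (T (\<i> * of_real y)) k + 1))
      = Re (- (\<i> * of_real y) * (\<i> * of_real y * (LINT x|M. 1 / (of_real x - \<i> * of_real y)) + 1))"
      using eventually_gt_at_top[of "0::real"]
    proof eventually_elim
      case (elim y)
      then have "Im (\<i> * of_real y) > 0" by (simp add: times_complex.sel)
      then show ?case using M(2) by simp
    qed
    ultimately show "((\<lambda>y. Re (- (\<i> * of_real y) * (\<i> * of_real y * (LINT x|M. 1 / (of_real x - \<i> * of_real y)) + 1)))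
            \<longlongrightarrow> c * m * r k) at_top" by (rule Lim_transform_eventually)
  qed
  with M supp show ?thesis by blast
qed

text \<open>
  Since \<open>1 - z c\<^sup>2 t\<^sup>2 = - z c t Q\<close> and \<open>\<bar>z Q\<bar> \<ge> Im (z Q)\<close>, the denominator is at least
  \<open>Im t / \<bar>t\<bar>\<close>, where \<open>\<bar>t\<bar> \<le> b / Im z\<close>. For a lower bound on \<open>Im t\<close> the spectral measures must
  not escape to infinity: their first moments are at most \<open>C b\<^sup>2 = \<eta> / 2\<close>, so integrating
  \<open>1 - x / \<eta>\<close> as in Markov's inequality leaves at least half of the mass in \<open>{0..\<eta>}\<close>, on which
  the Poisson kernel is bounded below.
  This gives a bound of order \<open>(\<eta>\<^sup>2 + \<bar>z\<bar>\<^sup>2) / (Im z)\<^sup>2\<close>, and \<open>2 \<eta> Im z \<le> \<eta>\<^sup>2 + \<bar>z\<bar>\<^sup>2\<close> yields the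
  stated one.
\<close>

theorem denominator_bound:
  assumes ab: "\<And>k. k < n \<Longrightarrow> a \<le> r k" "\<And>k. k < n \<Longrightarrow> r k \<le> b" "a > 0" and C: "c \<le> C"
    and z: "Im z > 0"
  defines "\<eta> \<equiv> 2 * C * b\<^sup>2"
  shows "1 / cmod (1 - z * (of_real c * T z)\<^sup>2) \<le> (2 * b / (a * \<eta>)) * (\<eta>\<^sup>2 + (cmod z)\<^sup>2)\<^sup>2 / (Im z) ^ 3"
proof -
  note t = T[OF z] and tt = T_sectorD[OF z z]
  define y where "y = Im z"
  have y: "y > 0" using z by (simp add: y_def)
  have b: "b > 0" using ab(1)[of 0] ab(2)[of 0] ab(3) n by simp
  have Cp: "C > 0" using C c by simp
  have \<eta>: "\<eta> > 0" using Cp b by (simp add: \<eta>_def)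
  have mb: "a \<le> m" "m \<le> b"
  proof -
    have "(\<Sum>k<n. a) \<le> (\<Sum>k<n. r k)" "(\<Sum>k<n. r k) \<le> (\<Sum>k<n. b)" by (intro sum_mono; simp add: ab)+
    then show "a \<le> m" "m \<le> b" using n by (auto simp: m_def field_simps)
  qed
  define L where "L = y / (4 * (\<eta>\<^sup>2 + (cmod z)\<^sup>2))"
  have den: "\<eta>\<^sup>2 + (cmod z)\<^sup>2 > 0" using \<eta> by (simp add: add_pos_nonneg)
  have L0: "L > 0" using y den by (simp add: L_def)
  have ImS: "Im (S z (T z) k) \<ge> L" if k: "k < n" for k
  proof -
    obtain M where M: "real_distribution M" "measure M {..<0} = 0"
      "S z (T z) k = (LINT x|M. 1 / (of_real x - z))" "has_bochner_integral M (\<lambda>x. x) (c * m * r k)"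
      using S_spectral_measure[OF k] z by blast
    interpret real_distribution M by (rule M)
    have AE: "AE x in M. x \<ge> 0"
    proof (rule AE_I)
      show "emeasure M {..<0} = 0" using M(2) by (simp add: emeasure_eq_measure)
    qed auto
    have zc: "z = Complex (Re z) y" by (simp add: y_def)
    have f: "Im (S z (T z) k) = (LINT x|M. y / ((x - Re z)\<^sup>2 + y\<^sup>2))" "integrable M (\<lambda>x. y / ((x - Re z)\<^sup>2 + y\<^sup>2))"
      using stieltjes_transform_Im[OF y, of "Re z"] M(3) zc by auto
    have g: "has_bochner_integral M (\<lambda>x. 2 * L * (1 - x / \<eta>)) (2 * L * (1 - c * m * r k / \<eta>))"
    proof -
      have "has_bochner_integral M (\<lambda>x. 1) (1::real)" using prob_space by (simp add: has_bochner_integral_iff)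
      then show ?thesis
        by (intro has_bochner_integral_mult_right has_bochner_integral_diff has_bochner_integral_divide_zero M(4))
    qed
    have "AE x in M. 2 * L * (1 - x / \<eta>) \<le> y / ((x - Re z)\<^sup>2 + y\<^sup>2)"
      using AE
    proof eventually_elim
      case (elim x)
      have p: "(x - Re z)\<^sup>2 + y\<^sup>2 > 0" using y by (simp add: add_nonneg_pos)
      show ?case
      proof (cases "x \<le> \<eta>")
        case True
        have "(x - Re z)\<^sup>2 + y\<^sup>2 \<le> 2 * (x\<^sup>2 + (cmod z)\<^sup>2)"
        proof -
          have "2 * (x\<^sup>2 + (cmod z)\<^sup>2) - ((x - Re z)\<^sup>2 + y\<^sup>2) = (x + Re z)\<^sup>2 + y\<^sup>2"
            unfolding cmod_power2 y_def by (simp add: power2_eq_square algebra_simps)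
          moreover have "(x + Re z)\<^sup>2 + y\<^sup>2 \<ge> 0" by simp
          ultimately show ?thesis by linarith
        qed
        also have "\<dots> \<le> 2 * (\<eta>\<^sup>2 + (cmod z)\<^sup>2)" using True elim by (simp add: power_mono)
        finally have "y / (2 * (\<eta>\<^sup>2 + (cmod z)\<^sup>2)) \<le> y / ((x - Re z)\<^sup>2 + y\<^sup>2)"
          using y p by (intro divide_left_mono) auto
        moreover have "2 * L * (1 - x / \<eta>) \<le> 2 * L * 1" using L0 elim \<eta> by (intro mult_left_mono) auto
        moreover have "2 * (y / (4 * X)) = y / (2 * X)" for X :: real by simp
        then have "2 * L = y / (2 * (\<eta>\<^sup>2 + (cmod z)\<^sup>2))" unfolding L_def .
        ultimately show ?thesis by simp
      next
        case False
        then have "1 - x / \<eta> \<le> 0" using \<eta> by simp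
        then have "2 * L * (1 - x / \<eta>) \<le> 0" using L0 by (intro mult_nonneg_nonpos) auto
        also have "0 \<le> y / ((x - Re z)\<^sup>2 + y\<^sup>2)" using y p by simp
        finally show ?thesis .
      qed
    qed
    then have "(LINT x|M. 2 * L * (1 - x / \<eta>)) \<le> Im (S z (T z) k)"
      unfolding f(1) by (rule integral_mono_AE[OF integrable.intros[OF g] f(2)])
    then have "2 * L * (1 - c * m * r k / \<eta>) \<le> Im (S z (T z) k)"
      by (simp only: has_bochner_integral_integral_eq[OF g])
    moreover have "c * m * r k / \<eta> \<le> 1 / 2"
    proof -
      have "c * m * r k \<le> C * b * b"
        using C c mb ab(2)[OF k] r[OF k] m_pos b Cp by (intro mult_mono mult_nonneg_nonneg) auto
      then show ?thesis using \<eta> by (simp add: \<eta>_def power2_eq_square divide_simps)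
    qed
    then have "2 * L * (1 / 2) \<le> 2 * L * (1 - c * m * r k / \<eta>)"
      using L0 by (intro mult_left_mono) auto
    ultimately show ?thesis by simp
  qed
  have Imt: "Im (T z) \<ge> a * L"
  proof -
    have "Im (T z) = (1 / real n) * (\<Sum>k<n. r k * Im (S z (T z) k))"
      using Im_\<Phi>(1)[of z "T z"] t(2) by simp
    also have "\<dots> \<ge> (1 / real n) * (\<Sum>k<n. a * L)"
      using ab ImS L0 by (intro mult_left_mono sum_mono mult_mono) (auto intro: less_imp_le r)
    finally show ?thesis using n by simp
  qed
  have tp: "cmod (T z) > 0" using tt by simp
  have "Im (T z) / cmod (T z) \<le> cmod (1 - z * (of_real c * T z)\<^sup>2)"
  proof -
    have "1 - z * (of_real c * T z)\<^sup>2 = - (z * of_real c * T z) * Q z (T z)"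
      using P_eq(3)[OF z tt(1,4,5)] by (simp add: power_mult_distrib mult_ac)
    then have *: "cmod (1 - z * (of_real c * T z)\<^sup>2) = cmod (T z) * c * cmod (z * Q z (T z))"
      using c by (simp add: norm_mult mult_ac)
    have J2: "(cmod z)\<^sup>2 * (cmod (J z (T z)))\<^sup>2 = 1 / (c * cmod (T z))\<^sup>2"
      using c tt by (simp add: J_def norm_mult norm_divide power_mult_distrib power_divide)
    have "cmod (z * Q z (T z)) \<ge> Im (z * Q z (T z))"
      using abs_Im_le_cmod[of "z * Q z (T z)"] by linarith
    also have "Im (z * Q z (T z)) = c * (Im (z * T z) + (1 / (c * cmod (T z))\<^sup>2) * Im (T z))"
      unfolding Im_Q(2)[OF z tt(1)] J2 ..
    finally have "cmod (z * Q z (T z)) \<ge> c * (Im (z * T z) + (1 / (c * cmod (T z))\<^sup>2) * Im (T z))" .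
    moreover have "c * (Im (z * T z) + (1 / (c * cmod (T z))\<^sup>2) * Im (T z)) \<ge> c * (0 + (1 / (c * cmod (T z))\<^sup>2) * Im (T z))"
      using c tt(5) by (intro mult_left_mono add_mono) auto
    ultimately have "cmod (z * Q z (T z)) \<ge> c * ((1 / (c * cmod (T z))\<^sup>2) * Im (T z))" by simp
    then have "cmod (T z) * c * (c * ((1 / (c * cmod (T z))\<^sup>2) * Im (T z))) \<le> cmod (T z) * c * cmod (z * Q z (T z))"
      using c by (intro mult_left_mono) auto
    moreover have "cmod (T z) * c * (c * ((1 / (c * cmod (T z))\<^sup>2) * Im (T z))) = Im (T z) / cmod (T z)"
      using c tp by (simp add: power2_eq_square)
    ultimately show ?thesis unfolding * by simp
  qed
  moreover have "a * L / (b / y) \<le> Im (T z) / cmod (T z)"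
  proof -
    have "cmod (T z) \<le> b / y" using T_bound[OF z] mb y by (simp add: y_def divide_simps)
    then show ?thesis using Imt tp tt(4) L0 ab(3) by (intro frac_le) auto
  qed
  ultimately have "a * L / (b / y) \<le> cmod (1 - z * (of_real c * T z)\<^sup>2)" by simp
  moreover have pos: "a * L / (b / y) > 0" using L0 ab b y by simp
  ultimately have "1 / cmod (1 - z * (of_real c * T z)\<^sup>2) \<le> 1 / (a * L / (b / y))"
    by (intro frac_le) simp_all
  also have "\<dots> = (4 * b / a) * (\<eta>\<^sup>2 + (cmod z)\<^sup>2) / y\<^sup>2"
  proof -
    have "1 / (a * (y / (4 * X)) / (b / y)) = (4 * b / a) * X / y\<^sup>2" if "X > 0" for X
      using y ab(3) b that by (simp add: power2_eq_square mult_ac)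
    from this[OF den] show ?thesis unfolding L_def .
  qed
  also have "\<dots> = (4 * b / a) * (\<eta>\<^sup>2 + (cmod z)\<^sup>2) * y / y ^ 3"
    using y by (simp add: power2_eq_square power3_eq_cube)
  also have "\<dots> \<le> (4 * b / a) * (\<eta>\<^sup>2 + (cmod z)\<^sup>2) * ((\<eta>\<^sup>2 + (cmod z)\<^sup>2) / (2 * \<eta>)) / y ^ 3"
  proof -
    have "y\<^sup>2 \<le> (cmod z)\<^sup>2" using abs_Im_le_cmod[of z] y by (intro power_mono) (auto simp: y_def)
    moreover have "0 \<le> (\<eta> - y)\<^sup>2" by simp
    ultimately have "y * (2 * \<eta>) \<le> \<eta>\<^sup>2 + (cmod z)\<^sup>2" by (simp add: power2_eq_square algebra_simps)
    then have "y \<le> (\<eta>\<^sup>2 + (cmod z)\<^sup>2) / (2 * \<eta>)" using \<eta> by (simp add: pos_le_divide_eq)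
    then show ?thesis using den ab b y by (intro divide_right_mono mult_left_mono) auto
  qed
  also have "\<dots> = (2 * b / (a * \<eta>)) * (\<eta>\<^sup>2 + (cmod z)\<^sup>2)\<^sup>2 / (Im z) ^ 3"
  proof -
    have "(4 * b / a) * X * (X / (2 * \<eta>)) / Y = (2 * b / (a * \<eta>)) * X\<^sup>2 / Y" for X Y :: real
      by (simp add: power2_eq_square mult_ac)
    then show ?thesis unfolding y_def .
  qed
  finally show ?thesis .
qed

end

declare times_complex.sel [simp] Im_of_real_mult [simp del]

section \<open>Diagonalization of Hermitian matrices\<close>

lemma mat_adjoint_dim: "dim_row (mat_adjoint A) = dim_col A" "dim_col (mat_adjoint A) = dim_row A"
  unfolding mat_adjoint_def by simp_all

lemma mat_adjoint_carrier: "A \<in> carrier_mat m n \<Longrightarrow> mat_adjoint A \<in> carrier_mat n m"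
  by (rule carrier_matI) (simp_all add: mat_adjoint_dim)

lemma mat_adjoint_index:
  assumes "A \<in> carrier_mat m n" "i < n" "j < m"
  shows "mat_adjoint A $$ (i, j) = conjugate (A $$ (j, i))"
  using assms unfolding mat_adjoint_def by (simp add: mat_of_rows_def)

lemma mat_mult_index:
  fixes A B :: "complex mat"
  assumes "A \<in> carrier_mat m n" "B \<in> carrier_mat n k" "i < m" "j < k"
  shows "(A * B) $$ (i, j) = (\<Sum>l<n. A $$ (i, l) * B $$ (l, j))"
  using assms by (simp add: scalar_prod_def atLeast0LessThan)

lemma mat_adjoint_mult:
  fixes A B :: "complex mat"
  assumes A: "A \<in> carrier_mat m n" and B: "B \<in> carrier_mat n k"
  shows "mat_adjoint (A * B) = mat_adjoint B * mat_adjoint A"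
proof (rule eq_matI)
  have AB: "A * B \<in> carrier_mat m k" using A B by simp
  note c = mat_adjoint_carrier[OF AB] mat_adjoint_carrier[OF A] mat_adjoint_carrier[OF B]
  show "dim_row (mat_adjoint (A * B)) = dim_row (mat_adjoint B * mat_adjoint A)"
    "dim_col (mat_adjoint (A * B)) = dim_col (mat_adjoint B * mat_adjoint A)"
    by (simp_all add: mat_adjoint_dim)
  fix i j assume "i < dim_row (mat_adjoint B * mat_adjoint A)" "j < dim_col (mat_adjoint B * mat_adjoint A)"
  then have ij: "i < k" "j < m" using A B by (simp_all add: mat_adjoint_dim)
  show "mat_adjoint (A * B) $$ (i, j) = (mat_adjoint B * mat_adjoint A) $$ (i, j)"
    unfolding mat_adjoint_index[OF AB ij] mat_mult_index[OF A B ij(2,1)]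
      mat_mult_index[OF c(3,2) ij]
    using ij by (simp add: mat_adjoint_index[OF A] mat_adjoint_index[OF B] mult.commute)
qed

lemma mat_adjoint_adjoint:
  fixes A :: "complex mat"
  assumes A: "A \<in> carrier_mat m n"
  shows "mat_adjoint (mat_adjoint A) = A"
  by (rule eq_matI)
    (use A in \<open>simp_all add: mat_adjoint_dim mat_adjoint_index[OF mat_adjoint_carrier[OF A]] mat_adjoint_index[OF A]\<close>)

lemma cscalar_prod_sum:
  fixes v w :: "complex vec"
  assumes "v \<in> carrier_vec n" "w \<in> carrier_vec n"
  shows "v \<bullet>c w = (\<Sum>i<n. v $ i * cnj (w $ i))"
  using assms by (simp add: scalar_prod_def atLeast0LessThan)

lemma mat_vec_index:
  fixes A :: "complex mat"
  assumes "A \<in> carrier_mat m n" "x \<in> carrier_vec n" "i < m"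
  shows "(A *\<^sub>v x) $ i = (\<Sum>l<n. A $$ (i, l) * x $ l)"
  using assms by (simp add: scalar_prod_def atLeast0LessThan)

text \<open>
  Complete \<open>v\<close> to a basis, orthogonalize it by Gram-Schmidt, which keeps \<open>v\<close> as its
  first vector, and normalize.
\<close>

lemma unitary_completion:
  fixes v :: "complex vec"
  assumes v: "v \<in> carrier_vec n" and v0: "v \<noteq> 0\<^sub>v n"
  obtains W \<alpha> where "W \<in> carrier_mat n n" "mat_adjoint W * W = 1\<^sub>m n" "col W 0 = \<alpha> \<cdot>\<^sub>v v"
proof -
  interpret cof_vec_space n "TYPE(complex)" .
  define b where "b = basis_completion v"
  define ws where "ws = gram_schmidt n b"
  from basis_completion[OF v v0, folded b_def]
  have dist_b: "distinct b" and indep: "\<not> lin_dep (set b)" and b: "set b \<subseteq> carrier_vec n"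
    and hdb: "hd b = v" and len_b: "length b = n" by auto
  have n: "n \<noteq> 0" using v v0 by (metis carrier_vecD eq_vecI index_zero_vec(2) less_nat_zero_code)
  from hdb len_b n obtain vs where bv: "b = v # vs" by (cases b) auto
  from gram_schmidt_result[OF b dist_b indep refl, folded ws_def]
  have ws: "set ws \<subseteq> carrier_vec n" "corthogonal ws" "length ws = n"
    by (auto simp: len_b)
  have hdws: "hd ws = v" using gram_schmidt_hd[OF v, of vs, folded bv] by (simp add: ws_def)
  define nrm where "nrm w = (\<Sum>i<n. (cmod (w $ i))\<^sup>2)" for w :: "complex vec"
  have wsi: "ws ! i \<in> carrier_vec n" if "i < n" for i using ws that by auto
  have sq: "w \<bullet>c w = of_real (nrm w)" if "w \<in> carrier_vec n" for w
    unfolding cscalar_prod_sum[OF that that] nrm_def by (simp add: complex_norm_square[symmetric])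
  have pos: "nrm (ws ! i) > 0" if "i < n" for i
  proof -
    have "ws ! i \<bullet>c ws ! i \<noteq> 0" using corthogonalD[OF ws(2)] that ws(3) by auto
    then have "nrm (ws ! i) \<noteq> 0" using sq[OF wsi[OF that]] by auto
    moreover have "nrm (ws ! i) \<ge> 0" by (simp add: nrm_def sum_nonneg)
    ultimately show ?thesis by simp
  qed
  define u where "u i = complex_of_real (1 / sqrt (nrm (ws ! i)))" for i
  define W where "W = Matrix.mat n n (\<lambda>(i, j). u j * (ws ! j) $ i)"
  have W: "W \<in> carrier_mat n n" by (simp add: W_def)
  have Wi: "W $$ (i, j) = u j * (ws ! j) $ i" if "i < n" "j < n" for i j
    using that by (simp add: W_def)
  have "mat_adjoint W * W = 1\<^sub>m n"
  proof (rule eq_matI)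
    fix i j assume "i < dim_row (1\<^sub>m n)" "j < dim_col (1\<^sub>m n)"
    then have ij: "i < n" "j < n" by auto
    have "(mat_adjoint W * W) $$ (i, j) = (\<Sum>l<n. cnj (u i * (ws ! i) $ l) * (u j * (ws ! j) $ l))"
      unfolding mat_mult_index[OF mat_adjoint_carrier[OF W] W ij]
      using ij Wi by (intro sum.cong) (auto simp: mat_adjoint_index[OF W])
    also have "\<dots> = cnj (u i) * u j * (ws ! j \<bullet>c ws ! i)"
      unfolding cscalar_prod_sum[OF wsi[OF ij(2)] wsi[OF ij(1)]] sum_distrib_left
      by (intro sum.cong) (auto simp: mult_ac)
    also have "\<dots> = (1\<^sub>m n) $$ (i, j)"
    proof (cases "i = j")
      case True
      have "of_real (1 / sqrt (nrm (ws ! i))) * of_real (1 / sqrt (nrm (ws ! i))) * complex_of_real (nrm (ws ! i)) = 1"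
        unfolding of_real_mult[symmetric] using pos[OF ij(1)] by simp
      then show ?thesis using True ij sq[OF wsi[OF ij(1)]] by (simp add: u_def)
    next
      case False
      then have "ws ! j \<bullet>c ws ! i = 0" using corthogonalD[OF ws(2)] ij ws(3) by auto
      then show ?thesis using False ij by simp
    qed
    finally show "(mat_adjoint W * W) $$ (i, j) = (1\<^sub>m n) $$ (i, j)" .
  qed (use W mat_adjoint_carrier[OF W] in auto)
  moreover have "col W 0 = u 0 \<cdot>\<^sub>v v"
  proof (rule eq_vecI)
    have "ws ! 0 = v" using hdws ws(3) n by (metis hd_conv_nth list.size(3))
    then show "col W 0 $ i = (u 0 \<cdot>\<^sub>v v) $ i" if "i < dim_vec (u 0 \<cdot>\<^sub>v v)" for i
      using that n v by (auto simp: W_def)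
  qed (use W v in auto)
  ultimately show ?thesis using that W by blast
qed

definition unitary_mat :: "nat \<Rightarrow> complex mat \<Rightarrow> bool" where
  "unitary_mat n U \<longleftrightarrow> U \<in> carrier_mat n n \<and> mat_adjoint U * U = 1\<^sub>m n"

lemma unitary_matD:
  assumes "unitary_mat n U"
  shows "U \<in> carrier_mat n n" "mat_adjoint U \<in> carrier_mat n n" "mat_adjoint U * U = 1\<^sub>m n" "U * mat_adjoint U = 1\<^sub>m n"
proof -
  show U: "U \<in> carrier_mat n n" "mat_adjoint U * U = 1\<^sub>m n" using assms by (auto simp: unitary_mat_def)
  show "mat_adjoint U \<in> carrier_mat n n" by (rule mat_adjoint_carrier[OF U(1)])
  then show "U * mat_adjoint U = 1\<^sub>m n" using mat_mult_left_right_inverse[OF _ U(1) U(2)] by simp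
qed

definition spectral_mat :: "nat \<Rightarrow> complex mat \<Rightarrow> (nat \<Rightarrow> complex) \<Rightarrow> complex mat" where
  "spectral_mat n U f = U * mat_diag n f * mat_adjoint U"

text \<open>
  Induction on the size. In a unitary basis starting with an eigenvector for \<open>e\<close>, the first column
  of the matrix is \<open>e\<close> followed by zeros, and by symmetry so is the first row; the
  remaining block is again Hermitian.
\<close>

theorem hermitian_diagonalization:
  assumes "A \<in> carrier_mat n n" "mat_adjoint A = A"
  shows "\<exists>U r. unitary_mat n U \<and> A = spectral_mat n U (\<lambda>k. complex_of_real (r k))"
  using assms
proof (induction n arbitrary: A)
  case 0
  have "unitary_mat 0 A" unfolding unitary_mat_def using 0
    by (auto intro!: eq_matI simp: mat_adjoint_carrier)
  moreover have "A = spectral_mat 0 A (\<lambda>k. complex_of_real 0)" using 0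
    by (auto intro!: eq_matI simp: spectral_mat_def)
  ultimately show ?case by (intro exI[of _ A] exI[of _ "\<lambda>_. 0"]) simp
next
  case (Suc n A)
  let ?N = "Suc n"
  note A = Suc.prems(1)
  obtain e where "e \<in> spectrum A" using spectrum_non_empty[OF A] by auto
  then have "eigenvalue A e" by (simp add: spectrum_def)
  then obtain v where v: "v \<in> carrier_vec ?N" "v \<noteq> 0\<^sub>v ?N" "A *\<^sub>v v = e \<cdot>\<^sub>v v"
    using A by (auto simp: eigenvalue_def eigenvector_def)
  obtain W \<alpha> where W: "W \<in> carrier_mat ?N ?N" "mat_adjoint W * W = 1\<^sub>m ?N" "col W 0 = \<alpha> \<cdot>\<^sub>v v"
    using unitary_completion[OF v(1,2)] by blast
  have W': "mat_adjoint W \<in> carrier_mat ?N ?N" by (rule mat_adjoint_carrier[OF W(1)])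
  have WW': "W * mat_adjoint W = 1\<^sub>m ?N" by (rule mat_mult_left_right_inverse[OF W' W(1) W(2)])
  define B where "B = mat_adjoint W * (A * W)"
  have AW: "A * W \<in> carrier_mat ?N ?N" using A W by simp
  have B: "B \<in> carrier_mat ?N ?N" using W' AW by (simp add: B_def)
  have Bh: "mat_adjoint B = B"
    unfolding B_def mat_adjoint_mult[OF W' AW] mat_adjoint_mult[OF A W(1)] mat_adjoint_adjoint[OF W(1)] Suc.prems(2)
    by (rule assoc_mult_mat[OF W' A W(1)])
  have Bsym: "B $$ (j, i) = cnj (B $$ (i, j))" if "i < ?N" "j < ?N" for i j
    using mat_adjoint_index[OF B that(2,1)] Bh by simp
  have B0: "B $$ (i, 0) = (if i = 0 then e else 0)" if i: "i < ?N" for i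
  proof -
    have 1: "(A * W) $$ (l, 0) = e * W $$ (l, 0)" if l: "l < ?N" for l
    proof -
      have "(A * W) $$ (l, 0) = row A l \<bullet> col W 0" using l A W by simp
      also have "\<dots> = \<alpha> * (row A l \<bullet> v)" unfolding W(3) using A v l by simp
      also have "row A l \<bullet> v = (A *\<^sub>v v) $ l" using A l by simp
      also have "\<dots> = e * v $ l" using v l by simp
      also have "\<alpha> * (e * v $ l) = e * (col W 0 $ l)" unfolding W(3) using v l by simp
      also have "col W 0 $ l = W $$ (l, 0)" using W(1) l by simp
      finally show ?thesis .
    qed
    have "B $$ (i, 0) = (\<Sum>l<?N. mat_adjoint W $$ (i, l) * (A * W) $$ (l, 0))"
      unfolding B_def by (rule mat_mult_index[OF W' AW i]) simp
    also have "\<dots> = e * (\<Sum>l<?N. mat_adjoint W $$ (i, l) * W $$ (l, 0))"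
      unfolding sum_distrib_left by (intro sum.cong) (auto simp: 1)
    also have "(\<Sum>l<?N. mat_adjoint W $$ (i, l) * W $$ (l, 0)) = (mat_adjoint W * W) $$ (i, 0)"
      by (rule mat_mult_index[OF W' W(1) i, symmetric]) simp
    finally show ?thesis using i by (simp add: W(2))
  qed
  have "e = cnj e" using Bsym[of 0 0, unfolded B0[of 0, simplified]] by simp
  then have e_real: "of_real (Re e) = e" by (simp add: complex_eq_iff)
  have B0': "B $$ (0, j) = (if j = 0 then e else 0)" if j: "j < ?N" for j
    using Bsym[OF j, of 0, unfolded B0[OF j]] \<open>e = cnj e\<close> by (cases "j = 0") simp_all
  define C where "C = Matrix.mat n n (\<lambda>(i, j). B $$ (Suc i, Suc j))"
  have C: "C \<in> carrier_mat n n" by (simp add: C_def)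
  have "mat_adjoint C = C"
  proof (rule eq_matI)
    fix i j assume "i < dim_row C" "j < dim_col C"
    then have ij: "i < n" "j < n" using C by simp_all
    then show "mat_adjoint C $$ (i, j) = C $$ (i, j)"
      using Bsym[of "Suc j" "Suc i"] unfolding mat_adjoint_index[OF C ij] by (simp add: C_def)
  qed (use C in \<open>simp_all add: mat_adjoint_dim\<close>)
  from Suc.IH[OF C this] obtain V s where V: "unitary_mat n V"
    and Ceq: "C = spectral_mat n V (\<lambda>k. complex_of_real (s k))" by blast
  note Vc = unitary_matD[OF V]
  define V1 where "V1 = Matrix.mat ?N ?N (\<lambda>(i, j). case i of 0 \<Rightarrow> (case j of 0 \<Rightarrow> 1 | Suc j' \<Rightarrow> 0)
     | Suc i' \<Rightarrow> (case j of 0 \<Rightarrow> 0 | Suc j' \<Rightarrow> V $$ (i', j')))"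
  define r where "r = case_nat (Re e) s"
  have V1: "V1 \<in> carrier_mat ?N ?N" by (simp add: V1_def)
  have V1': "mat_adjoint V1 \<in> carrier_mat ?N ?N" by (rule mat_adjoint_carrier[OF V1])
  have V1i: "V1 $$ (0, 0) = 1" "i < n \<Longrightarrow> V1 $$ (Suc i, 0) = 0" "i < n \<Longrightarrow> V1 $$ (0, Suc i) = 0"
    "i < n \<Longrightarrow> j < n \<Longrightarrow> V1 $$ (Suc i, Suc j) = V $$ (i, j)" for i j
    by (auto simp: V1_def)
  have V1V1: "mat_adjoint V1 * V1 = 1\<^sub>m ?N"
  proof (rule eq_matI)
    fix i j assume "i < dim_row (1\<^sub>m ?N)" "j < dim_col (1\<^sub>m ?N)"
    then have ij: "i < ?N" "j < ?N" by auto
    have VV: "(\<Sum>l<n. cnj (V $$ (l, i')) * V $$ (l, j')) = (if i' = j' then 1 else 0)" if "i' < n" "j' < n" for i' j'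
      using mat_mult_index[OF Vc(2,1) that] mat_adjoint_index[OF Vc(1) that(1)] Vc(3) that by simp
    have "(mat_adjoint V1 * V1) $$ (i, j) = (\<Sum>l<?N. cnj (V1 $$ (l, i)) * V1 $$ (l, j))"
      unfolding mat_mult_index[OF V1' V1 ij] using ij by (intro sum.cong) (auto simp: mat_adjoint_index[OF V1])
    also have "\<dots> = cnj (V1 $$ (0, i)) * V1 $$ (0, j) + (\<Sum>l<n. cnj (V1 $$ (Suc l, i)) * V1 $$ (Suc l, j))"
      by (simp add: sum.lessThan_Suc_shift del: sum.lessThan_Suc)
    also have "\<dots> = (1\<^sub>m ?N) $$ (i, j)"
      using ij by (cases i; cases j) (auto simp: V1i VV)
    finally show "(mat_adjoint V1 * V1) $$ (i, j) = (1\<^sub>m ?N) $$ (i, j)" .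
  qed (use V1 V1' in auto)
  define Dr where "Dr = mat_diag ?N (\<lambda>k. complex_of_real (r k))"
  have Dr: "Dr \<in> carrier_mat ?N ?N" by (simp add: Dr_def)
  have Beq: "B = V1 * Dr * mat_adjoint V1"
  proof (rule eq_matI)
    fix i j assume "i < dim_row (V1 * Dr * mat_adjoint V1)" "j < dim_col (V1 * Dr * mat_adjoint V1)"
    then have ij: "i < ?N" "j < ?N" using V1 V1' by auto
    have VD: "V1 * Dr \<in> carrier_mat ?N ?N" using V1 Dr by simp
    have VDi: "(V1 * Dr) $$ (i, l) = V1 $$ (i, l) * of_real (r l)" if "l < ?N" for l
      unfolding Dr_def mat_diag_mult_right[OF V1] using ij that by simp
    have CC: "(\<Sum>l<n. V $$ (i', l) * of_real (s l) * cnj (V $$ (j', l))) = B $$ (Suc i', Suc j')" if "i' < n" "j' < n" for i' j'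
    proof -
      have Vd: "V * mat_diag n (\<lambda>k. complex_of_real (s k)) \<in> carrier_mat n n" using Vc by simp
      have "C $$ (i', j') = (\<Sum>l<n. (V * mat_diag n (\<lambda>k. complex_of_real (s k))) $$ (i', l) * mat_adjoint V $$ (l, j'))"
        unfolding Ceq spectral_mat_def by (rule mat_mult_index[OF Vd Vc(2) that])
      also have "\<dots> = (\<Sum>l<n. V $$ (i', l) * of_real (s l) * cnj (V $$ (j', l)))"
        unfolding mat_diag_mult_right[OF Vc(1)] using that
        by (intro sum.cong) (auto simp: mat_adjoint_index[OF Vc(1)])
      finally show ?thesis using that by (simp add: C_def)
    qed
    have "(V1 * Dr * mat_adjoint V1) $$ (i, j) = (\<Sum>l<?N. V1 $$ (i, l) * of_real (r l) * cnj (V1 $$ (j, l)))"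
      unfolding mat_mult_index[OF VD V1' ij] using ij
      by (intro sum.cong) (auto simp: mat_adjoint_index[OF V1] VDi)
    also have "\<dots> = V1 $$ (i, 0) * of_real (Re e) * cnj (V1 $$ (j, 0)) + (\<Sum>l<n. V1 $$ (i, Suc l) * of_real (s l) * cnj (V1 $$ (j, Suc l)))"
      by (simp add: sum.lessThan_Suc_shift r_def del: sum.lessThan_Suc)
    also have "\<dots> = B $$ (i, j)"
    proof (cases i)
      case 0
      then show ?thesis
        using ij B0' e_real by (cases j) (auto simp: V1i)
    next
      case (Suc i')
      then show ?thesis using ij B0 CC by (cases j) (auto simp: V1i)
    qed
    finally show "B $$ (i, j) = (V1 * Dr * mat_adjoint V1) $$ (i, j)" by simp
  qed (use B V1 V1' in auto)
  define U where "U = W * V1"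
  have U: "U \<in> carrier_mat ?N ?N" using W V1 by (simp add: U_def)
  have Uadj: "mat_adjoint U = mat_adjoint V1 * mat_adjoint W"
    unfolding U_def by (rule mat_adjoint_mult[OF W(1) V1])
  have "mat_adjoint U * U = mat_adjoint V1 * (mat_adjoint W * W) * V1"
    unfolding Uadj unfolding U_def
    using V1 V1' W(1) W' by (simp add: assoc_mult_mat[of _ ?N ?N _ ?N _ ?N] mult_carrier_mat[of _ ?N ?N _ ?N])
  then have "unitary_mat ?N U" using U V1V1 V1' by (simp add: unitary_mat_def W(2))
  moreover have "A = spectral_mat ?N U (\<lambda>k. complex_of_real (r k))"
  proof -
    have "A = (W * mat_adjoint W) * A * (W * mat_adjoint W)" using A by (simp add: WW')
    also have "\<dots> = W * B * mat_adjoint W"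
      unfolding B_def using A W(1) W' by (simp add: assoc_mult_mat[of _ ?N ?N _ ?N _ ?N] mult_carrier_mat[of _ ?N ?N _ ?N])
    also have "\<dots> = U * Dr * mat_adjoint U"
      unfolding Beq Uadj unfolding U_def using V1 V1' W(1) W' Dr by (simp add: assoc_mult_mat[of _ ?N ?N _ ?N _ ?N] mult_carrier_mat[of _ ?N ?N _ ?N])
    finally show ?thesis by (simp add: spectral_mat_def Dr_def)
  qed
  ultimately show ?case by blast
qed

section \<open>Functions of a diagonalized matrix\<close>

text \<open>
  In a fixed unitary basis \<open>U\<close>, \<open>H f\<close> is the matrix with eigenvalues \<open>f 0, \<dots>, f (n - 1)\<close>. All
  matrices of the statement have this form, and the map \<open>H\<close> turns matrix operations into
  operations on eigenvalues.
\<close>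

locale spectral_calculus =
  fixes n :: nat and U :: "complex mat"
  assumes U: "unitary_mat n U"
begin

abbreviation H where "H \<equiv> spectral_mat n U"

lemmas Uc = unitary_matD[OF U]

lemma H_carrier [simp]: "H f \<in> carrier_mat n n"
  unfolding spectral_mat_def by (rule mult_carrier_mat[OF mult_carrier_mat[OF Uc(1) mat_diag_dim] Uc(2)])

lemma H_dim [simp]: "dim_row (H f) = n" "dim_col (H f) = n"
  by (rule carrier_matD[OF H_carrier])+

lemma H_index:
  assumes "i < n" "j < n"
  shows "H f $$ (i, j) = (\<Sum>k<n. f k * (U $$ (i, k) * cnj (U $$ (j, k))))"
proof -
  have Ud: "U * mat_diag n f \<in> carrier_mat n n" using Uc by simp
  show ?thesis
    unfolding spectral_mat_def mat_mult_index[OF Ud Uc(2) assms]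
    unfolding mat_diag_mult_right[OF Uc(1)] using assms
    by (intro sum.cong) (auto simp: mat_adjoint_index[OF Uc(1)])
qed

lemma H_cong: "(\<And>k. k < n \<Longrightarrow> f k = g k) \<Longrightarrow> H f = H g"
  by (rule eq_matI) (simp_all add: H_index)

lemma H_add: "H f + H g = H (\<lambda>k. f k + g k)"
  by (rule eq_matI) (simp_all add: H_index sum.distrib distrib_right)

lemma H_diff: "H f - H g = H (\<lambda>k. f k - g k)"
  by (rule eq_matI) (simp_all add: H_index sum_subtractf left_diff_distrib)

lemma H_smult: "a \<cdot>\<^sub>m H f = H (\<lambda>k. a * f k)"
  by (rule eq_matI) (simp_all add: H_index sum_distrib_left mult_ac)

lemma H_uminus: "- H f = H (\<lambda>k. - f k)"
  by (rule eq_matI) (simp_all add: H_index sum_negf)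

lemma H_mult: "H f * H g = H (\<lambda>k. f k * g k)"
proof -
  have "H f * H g = U * (mat_diag n f * ((mat_adjoint U * U) * mat_diag n g)) * mat_adjoint U"
    unfolding spectral_mat_def using Uc(1,2)
    by (simp add: assoc_mult_mat[of _ n n _ n _ n] mult_carrier_mat[of _ n n _ n] del: mat_diag_diag)
  then show ?thesis by (simp add: Uc(3) spectral_mat_def left_mult_one_mat[OF mat_diag_dim])
qed

lemma H_one: "H (\<lambda>k. 1) = 1\<^sub>m n"
  unfolding spectral_mat_def mat_diag_one using Uc by simp

lemma H_zero: "H (\<lambda>k. 0) = 0\<^sub>m n n"
  by (rule eq_matI) (auto simp: H_index)

lemma H_adjoint: "mat_adjoint (H f) = H (\<lambda>k. cnj (f k))"
proof (rule eq_matI)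
  fix i j assume "i < dim_row (H (\<lambda>k. cnj (f k)))" "j < dim_col (H (\<lambda>k. cnj (f k)))"
  then have ij: "i < n" "j < n" by auto
  then show "mat_adjoint (H f) $$ (i, j) = H (\<lambda>k. cnj (f k)) $$ (i, j)"
    by (simp add: mat_adjoint_index[OF H_carrier] H_index mult_ac)
qed (use mat_adjoint_carrier[OF H_carrier, of f] in auto)

lemma U_columns:
  assumes "i < n" "j < n"
  shows "(\<Sum>l<n. cnj (U $$ (l, i)) * U $$ (l, j)) = (if i = j then 1 else 0)"
  using mat_mult_index[OF Uc(2,1) assms] mat_adjoint_index[OF Uc(1) assms(1)] Uc(3) assms by simp

lemma H_trace: "mat_trace (H f) = (\<Sum>k<n. f k)"
proof -
  have "mat_trace (H f) = (\<Sum>i<n. \<Sum>k<n. f k * (U $$ (i, k) * cnj (U $$ (i, k))))"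
    by (simp add: mat_trace_def H_index)
  also have "\<dots> = (\<Sum>k<n. f k * (\<Sum>i<n. cnj (U $$ (i, k)) * U $$ (i, k)))"
    unfolding sum_distrib_left by (subst sum.swap) (simp add: mult_ac)
  finally show ?thesis by (simp add: U_columns)
qed

definition coord :: "complex vec \<Rightarrow> nat \<Rightarrow> complex" where
  "coord x k = (mat_adjoint U *\<^sub>v x) $ k"

lemma H_quad:
  assumes x: "x \<in> carrier_vec n"
  shows "(H f *\<^sub>v x) \<bullet>c x = (\<Sum>k<n. f k * of_real ((cmod (coord x k))\<^sup>2))"
proof -
  have Hx: "H f *\<^sub>v x \<in> carrier_vec n" using x H_carrier[of f] by (rule_tac mult_mat_vec_carrier)
  have co: "coord x k = (\<Sum>j<n. cnj (U $$ (j, k)) * x $ j)" if "k < n" for k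
    unfolding coord_def mat_vec_index[OF Uc(2) x that]
    using that by (intro sum.cong) (auto simp: mat_adjoint_index[OF Uc(1)])
  have "(H f *\<^sub>v x) \<bullet>c x = (\<Sum>i<n. (\<Sum>j<n. H f $$ (i, j) * x $ j) * cnj (x $ i))"
    unfolding cscalar_prod_sum[OF Hx x] by (intro sum.cong) (auto simp: mat_vec_index[OF H_carrier x] simp del: index_mult_mat_vec)
  also have "\<dots> = (\<Sum>i<n. \<Sum>j<n. \<Sum>k<n. f k * (U $$ (i, k) * cnj (x $ i)) * (cnj (U $$ (j, k)) * x $ j))"
    by (intro sum.cong refl) (auto simp: H_index sum_distrib_right sum_distrib_left mult_ac)
  also have "\<dots> = (\<Sum>i<n. \<Sum>k<n. \<Sum>j<n. f k * (U $$ (i, k) * cnj (x $ i)) * (cnj (U $$ (j, k)) * x $ j))"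
    by (intro sum.cong refl sum.swap)
  also have "\<dots> = (\<Sum>k<n. \<Sum>i<n. \<Sum>j<n. f k * (U $$ (i, k) * cnj (x $ i)) * (cnj (U $$ (j, k)) * x $ j))"
    by (rule sum.swap)
  also have "\<dots> = (\<Sum>k<n. f k * (cnj (coord x k) * coord x k))"
    by (intro sum.cong refl) (simp add: co sum_distrib_left sum_distrib_right mult_ac)
  also have "\<dots> = (\<Sum>k<n. f k * of_real ((cmod (coord x k))\<^sup>2))"
    by (intro sum.cong refl) (simp only: complex_norm_square mult.commute[of "cnj _"])
  finally show ?thesis .
qed

lemma coord_col:
  assumes "k < n" "l < n" shows "coord (col U k) l = (if l = k then 1 else 0)"
  unfolding coord_def using assms Uc U_columns[OF assms(2,1)]
  by (subst mat_vec_index[OF Uc(2)]) (auto simp: mat_adjoint_index[OF Uc(1)])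

lemma col_carrier: "k < n \<Longrightarrow> col U k \<in> carrier_vec n" using Uc(1) by auto

lemma H_quad_col:
  assumes "k < n" shows "(H f *\<^sub>v col U k) \<bullet>c col U k = f k"
proof -
  have "(H f *\<^sub>v col U k) \<bullet>c col U k = (\<Sum>l<n. if l = k then f l else 0)"
    unfolding H_quad[OF col_carrier[OF assms]] by (intro sum.cong) (auto simp: coord_col assms)
  then show ?thesis using assms by simp
qed

lemma psd_H_D: "psd_mat n (H f) \<Longrightarrow> k < n \<Longrightarrow> 0 \<le> Re (f k)"
  using H_quad_col[of k f] col_carrier[of k] unfolding psd_mat_def by metis

lemma pd_H_D:
  assumes "pd_mat n (H f)" "k < n" shows "0 < Re (f k)"
proof -
  have "col U k \<noteq> 0\<^sub>v n"
  proof
    assume "col U k = 0\<^sub>v n"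
    then have "coord (col U k) k = 0" using Uc(2) assms(2) by (simp add: coord_def)
    then show False using coord_col[OF assms(2) assms(2)] by simp
  qed
  then show ?thesis using assms H_quad_col[of k f] col_carrier[of k] unfolding pd_mat_def by metis
qed

lemma psd_H_I: "(\<And>k. k < n \<Longrightarrow> f k \<ge> 0) \<Longrightarrow> psd_mat n (H (\<lambda>k. complex_of_real (f k)))"
  unfolding psd_mat_def by (auto simp: H_adjoint H_quad simp flip: of_real_mult intro!: sum_nonneg)

lemma mat_inv_H:
  assumes "\<And>k. k < n \<Longrightarrow> f k \<noteq> 0"
  shows "mat_inv (H f) = H (\<lambda>k. 1 / f k)" "invertible_mat (H f)"
proof -
  have 1: "H f * H (\<lambda>k. 1 / f k) = 1\<^sub>m n" "H (\<lambda>k. 1 / f k) * H f = 1\<^sub>m n"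
    unfolding H_mult H_one[symmetric] using assms by (auto intro!: H_cong)
  then show "invertible_mat (H f)"
    unfolding invertible_mat_def inverts_mat_def by (auto intro!: exI[of _ "H (\<lambda>k. 1 / f k)"])
  have "H f \<in> Units (ring_mat TYPE(complex) n ())"
    unfolding Units_def using 1 by (auto simp: ring_mat_def intro!: bexI[of _ "H (\<lambda>k. 1 / f k)"])
  then obtain B where B: "mat_inverse (H f) = Some B"
    using mat_inverse(1)[OF H_carrier, of f "()"] by (cases "mat_inverse (H f)") auto
  from mat_inverse(2)[OF H_carrier B] have B': "B * H f = 1\<^sub>m n" "B \<in> carrier_mat n n" by auto
  have "B = B * (H f * H (\<lambda>k. 1 / f k))" using B' by (simp add: 1)
  also have "\<dots> = (B * H f) * H (\<lambda>k. 1 / f k)" using B' by (intro assoc_mult_mat[symmetric]) auto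
  also have "\<dots> = H (\<lambda>k. 1 / f k)" by (simp add: B' left_mult_one_mat[OF H_carrier])
  finally show "mat_inv (H f) = H (\<lambda>k. 1 / f k)" by (simp add: mat_inv_def B)
qed

end

section \<open>Mixtures of probability measures\<close>

text \<open>
  The measure \<open>\<Sum>k<n. w k * m k\<close>, written as the integral of the kernel \<open>m\<close> against the
  measure with weights \<open>w\<close> on the indices, so that its nonnegative integrals are known at once.
\<close>

definition mixture :: "nat \<Rightarrow> (nat \<Rightarrow> real) \<Rightarrow> (nat \<Rightarrow> real measure) \<Rightarrow> real measure" where
  "mixture n w m = point_measure {..<n} (\<lambda>k. ennreal (w k)) \<bind> m"

locale mixture_of_distributions =
  fixes n :: nat and m :: "nat \<Rightarrow> real measure"
  assumes n: "n \<ge> 1" and m: "\<And>k. k < n \<Longrightarrow> real_distribution (m k)"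
begin

lemma m_sets: "k < n \<Longrightarrow> sets (m k) = sets borel"
  using m real_distribution.events_eq_borel by blast

lemma m_kernel: "m \<in> measurable (point_measure {..<n} (\<lambda>k. ennreal (w k))) (subprob_algebra borel)"
proof -
  have "subprob_space (m k)" if "k < n" for k
    using m[OF that] by (simp add: real_distribution_def prob_space_imp_subprob_space)
  then show ?thesis by (auto simp: space_subprob_algebra m_sets)
qed

lemma sets_mixture: "sets (mixture n w m) = sets borel"
proof -
  have "space (point_measure {..<n} (\<lambda>k. ennreal (w k))) \<noteq> {}"
    using n by (auto simp: space_point_measure lessThan_empty_iff)
  then show ?thesis unfolding mixture_def
    by (intro sets_bind) (use m_sets in \<open>auto simp: space_point_measure\<close>)
qed

lemma space_mixture: "space (mixture n w m) = UNIV"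
  using sets_eq_imp_space_eq[OF sets_mixture] by simp

lemma nn_integral_mixture:
  assumes "f \<in> borel_measurable borel"
  shows "(\<integral>\<^sup>+x. f x \<partial>mixture n w m) = (\<Sum>k<n. ennreal (w k) * (\<integral>\<^sup>+x. f x \<partial>m k))"
  unfolding mixture_def nn_integral_bind[OF assms m_kernel] by (rule nn_integral_point_measure_finite) simp

lemma emeasure_mixture:
  assumes w: "\<And>k. k < n \<Longrightarrow> w k \<ge> 0" and B: "B \<in> sets borel"
  shows "emeasure (mixture n w m) B = ennreal (\<Sum>k<n. w k * measure (m k) B)"
proof -
  have "emeasure (mixture n w m) B = (\<integral>\<^sup>+x. indicator B x \<partial>mixture n w m)"
    using B by (simp add: sets_mixture)
  also have "\<dots> = (\<Sum>k<n. ennreal (w k) * (\<integral>\<^sup>+x. indicator B x \<partial>m k))"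
    by (rule nn_integral_mixture) (use B in measurable)
  also have "\<dots> = (\<Sum>k<n. ennreal (w k * measure (m k) B))"
  proof (intro sum.cong refl)
    fix k assume "k \<in> {..<n}"
    then have k: "k < n" by simp
    interpret real_distribution "m k" by (rule m[OF k])
    have "(\<integral>\<^sup>+x. indicator B x \<partial>m k) = emeasure (m k) B" using B by simp
    then show "ennreal (w k) * (\<integral>\<^sup>+x. indicator B x \<partial>m k) = ennreal (w k * measure (m k) B)"
      using w[OF k] by (simp add: emeasure_eq_measure ennreal_mult)
  qed
  also have "\<dots> = ennreal (\<Sum>k<n. w k * measure (m k) B)" using w by (intro sum_ennreal) auto
  finally show ?thesis .
qed

lemma measure_mixture:
  assumes w: "\<And>k. k < n \<Longrightarrow> w k \<ge> 0" and B: "B \<in> sets borel"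
  shows "measure (mixture n w m) B = (\<Sum>k<n. w k * measure (m k) B)"
proof -
  have "0 \<le> (\<Sum>k<n. w k * measure (m k) B)"
    using w by (intro sum_nonneg mult_nonneg_nonneg) auto
  then show ?thesis
    using emeasure_mixture[of w B, OF w B] by (simp add: measure_def[of "mixture n w m"])
qed

lemma finite_measure_mixture:
  assumes w: "\<And>k. k < n \<Longrightarrow> w k \<ge> 0"
  shows "finite_measure (mixture n w m)"
  by (rule finite_measureI) (simp add: space_mixture emeasure_mixture[OF w])

lemma has_bochner_integral_mixture_nonneg:
  fixes f :: "real \<Rightarrow> real"
  assumes w: "\<And>k. k < n \<Longrightarrow> w k \<ge> 0" and f: "f \<in> borel_measurable borel" "\<And>x. f x \<ge> 0"
    and I: "\<And>k. k < n \<Longrightarrow> has_bochner_integral (m k) f (I k)"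
  shows "has_bochner_integral (mixture n w m) f (\<Sum>k<n. w k * I k)"
proof (rule has_bochner_integral_nn_integral)
  show "f \<in> borel_measurable (mixture n w m)" using f(1) sets_mixture by (metis measurable_cong_sets)
  show "AE x in mixture n w m. 0 \<le> f x" using f(2) by simp
  have I0: "I k \<ge> 0" if "k < n" for k
    using has_bochner_integral_integral_eq[OF I[OF that]] Bochner_Integration.integral_nonneg[of "m k" f] f(2) by simp
  show "0 \<le> (\<Sum>k<n. w k * I k)" using w I0 by (intro sum_nonneg mult_nonneg_nonneg) auto
  have "(\<integral>\<^sup>+x. ennreal (f x) \<partial>mixture n w m) = (\<Sum>k<n. ennreal (w k) * (\<integral>\<^sup>+x. ennreal (f x) \<partial>m k))"
    by (rule nn_integral_mixture) (use f(1) in measurable)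
  also have "\<dots> = (\<Sum>k<n. ennreal (w k * I k))"
  proof (intro sum.cong refl)
    fix k assume "k \<in> {..<n}"
    then have k: "k < n" by simp
    have "(\<integral>\<^sup>+x. ennreal (f x) \<partial>m k) = ennreal (I k)"
      using I[OF k] f(2) by (subst nn_integral_eq_integral) (auto simp: has_bochner_integral_iff)
    then show "ennreal (w k) * (\<integral>\<^sup>+x. ennreal (f x) \<partial>m k) = ennreal (w k * I k)"
      using w[OF k] by (simp add: ennreal_mult I0[OF k])
  qed
  also have "\<dots> = ennreal (\<Sum>k<n. w k * I k)" using w I0 by (intro sum_ennreal) auto
  finally show "(\<integral>\<^sup>+x. ennreal (f x) \<partial>mixture n w m) = ennreal (\<Sum>k<n. w k * I k)" .
qed

lemma has_bochner_integral_mixture_real: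
  fixes f :: "real \<Rightarrow> real"
  assumes w: "\<And>k. k < n \<Longrightarrow> w k \<ge> 0" and f: "f \<in> borel_measurable borel"
    and I: "\<And>k. k < n \<Longrightarrow> has_bochner_integral (m k) f (I k)"
  shows "has_bochner_integral (mixture n w m) f (\<Sum>k<n. w k * I k)"
proof -
  define p q where "p x = max (f x) 0" and "q x = max (- f x) 0" for x
  have int: "integrable (m k) p" "integrable (m k) q" if "k < n" for k
    using I[OF that] by (auto simp: has_bochner_integral_iff p_def[abs_def] q_def[abs_def])
  have eq: "f x = p x - q x" for x by (simp add: p_def q_def)
  have Ieq: "I k = (LINT x|m k. p x) - (LINT x|m k. q x)" if "k < n" for k
    using has_bochner_integral_integral_eq[OF I[OF that]] int[OF that] unfolding eq[abs_def] by simp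
  have "has_bochner_integral (mixture n w m) p (\<Sum>k<n. w k * (LINT x|m k. p x))"
    by (rule has_bochner_integral_mixture_nonneg[OF w])
      (use f int in \<open>auto simp: p_def[abs_def] has_bochner_integral_iff\<close>)
  moreover have "has_bochner_integral (mixture n w m) q (\<Sum>k<n. w k * (LINT x|m k. q x))"
    by (rule has_bochner_integral_mixture_nonneg[OF w])
      (use f int in \<open>auto simp: q_def[abs_def] has_bochner_integral_iff\<close>)
  ultimately have "has_bochner_integral (mixture n w m) (\<lambda>x. p x - q x)
      ((\<Sum>k<n. w k * (LINT x|m k. p x)) - (\<Sum>k<n. w k * (LINT x|m k. q x)))"
    by (rule has_bochner_integral_diff)
  then show ?thesis by (simp add: eq[symmetric] Ieq sum_subtractf right_diff_distrib)
qed

lemma has_bochner_integral_mixture_complex: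
  fixes f :: "real \<Rightarrow> complex"
  assumes w: "\<And>k. k < n \<Longrightarrow> w k \<ge> 0" and f: "f \<in> borel_measurable borel"
    and I: "\<And>k. k < n \<Longrightarrow> has_bochner_integral (m k) f (I k)"
  shows "has_bochner_integral (mixture n w m) f (\<Sum>k<n. of_real (w k) * I k)"
proof -
  have "has_bochner_integral (mixture n w m) (\<lambda>x. Re (f x)) (\<Sum>k<n. w k * Re (I k))"
    by (rule has_bochner_integral_mixture_real[OF w]) (use f has_bochner_integral_Re[OF I] in auto)
  moreover have "has_bochner_integral (mixture n w m) (\<lambda>x. Im (f x)) (\<Sum>k<n. w k * Im (I k))"
    by (rule has_bochner_integral_mixture_real[OF w]) (use f has_bochner_integral_Im[OF I] in auto)
  ultimately have "has_bochner_integral (mixture n w m) (\<lambda>x. complex_of_real (Re (f x)) + \<i> * complex_of_real (Im (f x)))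
     (complex_of_real (\<Sum>k<n. w k * Re (I k)) + \<i> * complex_of_real (\<Sum>k<n. w k * Im (I k)))"
    by (intro has_bochner_integral_add has_bochner_integral_mult_right has_bochner_integral_of_real)
  moreover have "complex_of_real (\<Sum>k<n. w k * Re (I k)) + \<i> * complex_of_real (\<Sum>k<n. w k * Im (I k)) = (\<Sum>k<n. of_real (w k) * I k)"
    by (simp add: complex_eq_iff)
  ultimately show ?thesis by (simp add: complex_eq[symmetric])
qed

end

section \<open>The matrix equation\<close>

locale matrix_system = canonical_system n r c + spectral_calculus n U
  for n r c U
begin

abbreviation R where "R \<equiv> H (\<lambda>k. complex_of_real (r k))"

text \<open>
  On the cone neither the scalar denominator nor an eigenvalue of the matrix to be inverted vanishes,
  so the equation is meaningful there.
\<close>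

lemma resolvent_entry:
  assumes z: "Im z > 0" and t: "t \<in> sector z" and k: "k < n"
  defines "w \<equiv> z * of_real c * t / (1 - z * (of_real c)\<^sup>2 * t\<^sup>2)"
  shows "- z - w * of_real (r k) \<noteq> 0" "1 / (- z - w * of_real (r k)) = S z t k"
proof -
  note tt = sectorD[OF t z]
  have w: "- z - w * of_real (r k) = - (z * (1 + of_real (r k) * P z t))"
    by (simp add: w_def P_def algebra_simps)
  show "- z - w * of_real (r k) \<noteq> 0" unfolding w using S_denominator_nz[OF z tt(4,5) k] by simp
  show "1 / (- z - w * of_real (r k)) = S z t k" unfolding w S_def by simp
qed

lemma resolvent_mat:
  "(- z) \<cdot>\<^sub>m 1\<^sub>m n - w \<cdot>\<^sub>m R = H (\<lambda>k. - z - w * of_real (r k))"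
  "z \<cdot>\<^sub>m 1\<^sub>m n + w \<cdot>\<^sub>m R = H (\<lambda>k. z + w * of_real (r k))"
  unfolding H_one[symmetric] H_smult H_diff H_add by simp_all

lemma canonical_solution_iff:
  assumes z: "Im z > 0"
  shows "canonical_solution n R c z t \<longleftrightarrow> t \<in> sector z \<and> \<Phi> z t = t"
proof (cases "t \<in> sector z")
  case True
  define w where "w = z * of_real c * t / (1 - z * (of_real c)\<^sup>2 * t\<^sup>2)"
  have nz: "- z - w * of_real (r k) \<noteq> 0" "1 / (- z - w * of_real (r k)) = S z t k" if "k < n" for k
    using resolvent_entry[OF z True that] by (simp_all add: w_def)
  have d: "1 - z * (of_real c)\<^sup>2 * t\<^sup>2 \<noteq> 0" using P_eq(1)[OF z] sectorD[OF True z] by blast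
  have inv: "mat_inv (H (\<lambda>k. - z - w * of_real (r k))) = H (S z t)" "invertible_mat (H (\<lambda>k. - z - w * of_real (r k)))"
    using mat_inv_H[of "\<lambda>k. - z - w * of_real (r k)"] nz(1) H_cong[of "\<lambda>k. 1 / (- z - w * of_real (r k))" "S z t"] nz(2) by auto
  have "canonical_equation n R c z t \<longleftrightarrow> t = 1 / of_nat n * mat_trace (R * H (S z t))"
    unfolding canonical_equation_def Let_def w_def[symmetric] resolvent_mat(1) inv(1) using d inv(2) by simp
  also have "1 / of_nat n * mat_trace (R * H (S z t)) = \<Phi> z t"
    unfolding H_mult H_trace \<Phi>_def ..
  finally show ?thesis using True by (auto simp: canonical_solution_def sector_def)
qed (auto simp: canonical_solution_def sector_def)

lemma canonical_solution_unique:
  assumes z: "Im z > 0" shows "\<exists>!t. canonical_solution n R c z t"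
  unfolding canonical_solution_iff[OF z] using T[OF z] \<Phi>_fixed_point_unique[OF z] by blast

lemma t_fun_eq: "Im z > 0 \<Longrightarrow> t_fun n R c z = T z"
  by (simp add: t_fun_def canonical_solution_iff T_def)

lemma T_fun_eq:
  assumes z: "Im z > 0" shows "T_fun n R c z = H (S z (T z))"
proof -
  define w where "w = z * of_real c * T z / (1 - z * (of_real c)\<^sup>2 * (T z)\<^sup>2)"
  have nz: "z + w * of_real (r k) \<noteq> 0" "- (1 / (z + w * of_real (r k))) = S z (T z) k" if "k < n" for k
  proof -
    have eq: "- z - w * of_real (r k) = - (z + w * of_real (r k))" by simp
    have "- (z + w * of_real (r k)) \<noteq> 0" "1 / (- (z + w * of_real (r k))) = S z (T z) k"
      using resolvent_entry[OF z T(1)[OF z] that] unfolding eq[symmetric] by (simp_all add: w_def)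
    then show "z + w * of_real (r k) \<noteq> 0" "- (1 / (z + w * of_real (r k))) = S z (T z) k"
      by (metis neg_equal_0_iff_equal) (metis \<open>1 / (- _) = _\<close> divide_minus_right)
  qed
  have "T_fun n R c z = - mat_inv (H (\<lambda>k. z + w * of_real (r k)))"
    unfolding T_fun_def Let_def t_fun_eq[OF z] w_def[symmetric] resolvent_mat(2) ..
  also have "\<dots> = H (\<lambda>k. - (1 / (z + w * of_real (r k))))"
    using mat_inv_H(1)[of "\<lambda>k. z + w * of_real (r k)"] nz(1) by (simp add: H_uminus)
  also have "\<dots> = H (S z (T z))" by (rule H_cong) (rule nz(2))
  finally show ?thesis .
qed

end

text \<open>
  The distributions \<open>M k\<close> are the spectral measures of the functions \<open>S z (T z) k\<close>. Both measures of
  the statement are built from them, as \<open>\<nu> B = H (\<lambda>k. measure (M k) B)\<close> and \<open>\<mu> = (1 / n) (\<Sum>k<n. r k * M k)\<close>.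
\<close>

locale matrix_system_with_measures = matrix_system n r c U + mixture_of_distributions n M
  for n r c U M +
  assumes supp: "\<And>k. k < n \<Longrightarrow> measure (M k) {..<0} = 0"
    and stieltjes: "\<And>k z. k < n \<Longrightarrow> Im z > 0 \<Longrightarrow> S z (T z) k = (LINT x|M k. 1 / (of_real x - z))"
    and moment: "\<And>k. k < n \<Longrightarrow> has_bochner_integral (M k) (\<lambda>x. x) (c * m * r k)"
begin

lemma resolvent_integral:
  assumes "k < n" "Im z > 0"
  shows "has_bochner_integral (M k) (\<lambda>x. 1 / (of_real x - z)) (S z (T z) k)"
  using real_distribution.integrable_resolvent[OF m[OF assms(1)] assms(2)] stieltjes[OF assms]
  by (simp add: has_bochner_integral_iff)

lemma mass_nonneg_half_line: assumes "k < n" shows "measure (M k) {0..} = 1"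
proof -
  interpret real_distribution "M k" by (rule m[OF assms])
  have "measure (M k) (UNIV - {..<0}) = measure (M k) UNIV - measure (M k) {..<0}"
    using finite_measure_compl[of "{..<0}"] by simp
  moreover have "UNIV - {..<0} = {0::real..}" by auto
  ultimately show ?thesis using supp[OF assms] prob_space by simp
qed

definition \<nu> :: "real set \<Rightarrow> complex mat" where
  "\<nu> B = H (\<lambda>k. complex_of_real (measure (M k) B))"

definition \<mu> :: "real measure" where
  "\<mu> = mixture n (\<lambda>k. r k / real n) M"

lemma weights: "k < n \<Longrightarrow> r k / real n \<ge> 0" using r[of k] by simp

lemma pos_mat_measure_\<nu>: "pos_mat_measure n \<nu>"
  unfolding pos_mat_measure_def
proof (intro conjI ballI allI impI)
  show "psd_mat n (\<nu> B)" for B unfolding \<nu>_def by (rule psd_H_I) simp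
next
  fix F :: "nat \<Rightarrow> real set" and i j
  assume F: "range F \<subseteq> sets borel" "disjoint_family F" and ij: "i < n" "j < n"
  have "(\<lambda>l. complex_of_real (measure (M k) (F l))) sums complex_of_real (measure (M k) (\<Union>l. F l))" if "k < n" for k
  proof -
    interpret real_distribution "M k" by (rule m[OF that])
    show ?thesis by (intro sums_of_real finite_measure_UNION) (use F in auto)
  qed
  then show "(\<lambda>l. \<nu> (F l) $$ (i, j)) sums (\<nu> (\<Union>l. F l) $$ (i, j))"
    unfolding \<nu>_def H_index[OF ij] by (intro sums_sum sums_mult2) auto
qed

text \<open>
  In the eigenbasis the measure of the quadratic form at \<open>x\<close> is a mixture, weighted by the squared coordinates of \<open>x\<close>. So
  integrals against \<open>\<nu>\<close> reduce to integrals against the \<open>M k\<close>.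
\<close>

lemma quad_measure_eq:
  assumes x: "x \<in> carrier_vec n"
  shows "quad_measure \<nu> x = mixture n (\<lambda>k. (cmod (coord x k))\<^sup>2) M"
proof -
  let ?N = "mixture n (\<lambda>k. (cmod (coord x k))\<^sup>2) M"
  have "quad_measure \<nu> x = measure_of UNIV (sets borel) (emeasure ?N)"
    unfolding quad_measure_def
  proof (rule measure_of_eq)
    fix B assume "B \<in> sigma_sets UNIV (sets (borel :: real measure))"
    then have B: "B \<in> sets borel" using sets.sigma_sets_eq[of "borel :: real measure"] by simp
    have "(\<nu> B *\<^sub>v x) \<bullet>c x = of_real (\<Sum>k<n. (cmod (coord x k))\<^sup>2 * measure (M k) B)"
      unfolding \<nu>_def H_quad[OF x] by (simp add: mult.commute)
    then show "ennreal (Re ((\<nu> B *\<^sub>v x) \<bullet>c x)) = emeasure ?N B"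
      by (subst emeasure_mixture) (use B in auto)
  qed simp
  also have "\<dots> = ?N" using measure_of_of_measure[of ?N] by (simp add: space_mixture sets_mixture)
  finally show ?thesis .
qed

lemma stieltjes_mat_measure_of_\<nu>: "stieltjes_mat_measure_of n {0..} (T_fun n R c) \<nu>"
  unfolding stieltjes_mat_measure_of_def has_mat_integral_def
proof (intro conjI allI impI ballI)
  show "pos_mat_measure n \<nu>" by (rule pos_mat_measure_\<nu>)
  have "- {0..} = {..<0::real}" by auto
  then show "\<nu> (- {0..}) = 0\<^sub>m n n" unfolding \<nu>_def H_zero[symmetric] by (intro H_cong) (simp add: supp)
  fix z :: complex assume z: "0 < Im z"
  show "T_fun n R c z \<in> carrier_mat n n" by (simp add: T_fun_eq[OF z])
  fix x :: "complex vec" assume x: "x \<in> carrier_vec n"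
  have "has_bochner_integral (mixture n (\<lambda>k. (cmod (coord x k))\<^sup>2) M) (\<lambda>l. 1 / (complex_of_real l - z))
     (\<Sum>k<n. of_real ((cmod (coord x k))\<^sup>2) * S z (T z) k)"
    by (rule has_bochner_integral_mixture_complex) (use resolvent_integral z in auto)
  then show "has_bochner_integral (quad_measure \<nu> x) (\<lambda>l. 1 / (complex_of_real l - z)) ((T_fun n R c z *\<^sub>v x) \<bullet>c x)"
    unfolding quad_measure_eq[OF x] T_fun_eq[OF z] H_quad[OF x] by (simp add: mult.commute)
qed

lemma stieltjes_measure_of_\<mu>: "stieltjes_measure_of {0..} (t_fun n R c) \<mu>"
  unfolding stieltjes_measure_of_def
proof (intro conjI allI impI)
  show "sets \<mu> = sets borel" unfolding \<mu>_def by (rule sets_mixture)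
  show "finite_measure \<mu>" unfolding \<mu>_def by (rule finite_measure_mixture[where w="\<lambda>k. r k / real n", OF weights])
  have "- {0..} = {..<0::real}" by auto
  then show "emeasure \<mu> (- {0..}) = 0"
    unfolding \<mu>_def by (subst emeasure_mixture[where w="\<lambda>k. r k / real n", OF weights]) (auto simp: supp)
  fix z :: complex assume z: "0 < Im z"
  have "has_bochner_integral \<mu> (\<lambda>l. 1 / (complex_of_real l - z)) (\<Sum>k<n. of_real (r k / real n) * S z (T z) k)"
    unfolding \<mu>_def by (rule has_bochner_integral_mixture_complex[where w="\<lambda>k. r k / real n", OF weights]) (use resolvent_integral z in auto)
  moreover have "(\<Sum>k<n. of_real (r k / real n) * S z (T z) k) = t_fun n R c z"
    unfolding t_fun_eq[OF z] using T(2)[OF z] by (simp add: \<Phi>_def sum_distrib_left)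
  ultimately show "has_bochner_integral \<mu> (\<lambda>l. 1 / (complex_of_real l - z)) (t_fun n R c z)" by simp
qed

lemma measure_\<mu>: "B \<in> sets borel \<Longrightarrow> measure \<mu> B = (\<Sum>k<n. r k / real n * measure (M k) B)"
  unfolding \<mu>_def by (rule measure_mixture[where w="\<lambda>k. r k / real n", OF weights])

lemma trace_R: "1 / of_nat n * mat_trace R = complex_of_real m"
  by (simp add: H_trace m_def)

lemma mass_\<mu>: "complex_of_real (measure \<mu> {0..}) = 1 / of_nat n * mat_trace R"
proof -
  have "measure \<mu> {0..} = (\<Sum>k<n. r k / real n)"
    unfolding measure_\<mu>[OF borel_closed[OF closed_atLeast]] by (intro sum.cong) (auto simp: mass_nonneg_half_line)
  also have "\<dots> = m" by (simp add: m_def sum_divide_distrib)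
  finally show ?thesis by (simp only: trace_R)
qed

lemma moment_\<mu>:
  "has_bochner_integral \<mu> (\<lambda>l. indicat_real {0..} l *\<^sub>R l) (c * m * ((1 / real n) * (\<Sum>k<n. (r k)\<^sup>2)))"
proof -
  have "has_bochner_integral \<mu> (\<lambda>l. indicat_real {0..} l *\<^sub>R l) (\<Sum>k<n. r k / real n * (c * m * r k))"
    unfolding \<mu>_def
  proof (rule has_bochner_integral_mixture_real[where w="\<lambda>k. r k / real n", OF weights])
    fix k assume k: "k < n"
    interpret real_distribution "M k" by (rule m[OF k])
    have "AE x in M k. x \<ge> 0"
    proof (rule AE_I)
      show "emeasure (M k) {..<0} = 0" using supp[OF k] by (simp add: emeasure_eq_measure)
    qed auto
    then have "AE x in M k. x = indicat_real {0..} x *\<^sub>R x" by eventually_elim simp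
    then show "has_bochner_integral (M k) (\<lambda>l. indicat_real {0..} l *\<^sub>R l) (c * m * r k)"
      using moment[OF k] by (subst (asm) has_bochner_integral_cong_AE) auto
  qed auto
  moreover have "(\<Sum>k<n. r k / real n * (c * m * r k)) = c * m * ((1 / real n) * (\<Sum>k<n. (r k)\<^sup>2))"
    unfolding sum_distrib_left by (intro sum.cong) (auto simp: power2_eq_square)
  ultimately show ?thesis by simp
qed

lemma trace_formula:
  assumes "B \<in> sets borel"
  shows "complex_of_real (measure \<mu> B) = 1 / of_nat n * mat_trace (R * \<nu> B)"
  unfolding measure_\<mu>[OF assms] \<nu>_def H_mult H_trace by (simp add: sum_distrib_left)

lemma first_moment_\<mu>:
  "set_integrable \<mu> {0..} (\<lambda>l. l)"
  "complex_of_real (LINT l:{0..}|\<mu>. l) =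
     of_real c * (1 / of_nat n * mat_trace R) * (1 / of_nat n * mat_trace (R * R))"
proof -
  show "set_integrable \<mu> {0..} (\<lambda>l. l)"
    using moment_\<mu> by (simp only: set_integrable_def has_bochner_integral_iff)
  have "(LINT l:{0..}|\<mu>. l) = c * m * ((1 / real n) * (\<Sum>k<n. (r k)\<^sup>2))"
    using moment_\<mu> by (simp only: set_lebesgue_integral_def has_bochner_integral_iff)
  moreover have "1 / of_nat n * mat_trace (R * R) = complex_of_real ((1 / real n) * (\<Sum>k<n. (r k)\<^sup>2))"
    unfolding H_mult H_trace by (simp add: power2_eq_square)
  ultimately show "complex_of_real (LINT l:{0..}|\<mu>. l) =
          of_real c * (1 / of_nat n * mat_trace R) * (1 / of_nat n * mat_trace (R * R))"
    by (simp only: trace_R of_real_mult)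
qed

lemma mass_\<nu>: "\<nu> {0..} = 1\<^sub>m n"
  unfolding \<nu>_def H_one[symmetric] by (rule H_cong) (simp add: mass_nonneg_half_line)

end

lemma (in matrix_system) spectral_measures_exist:
  "\<exists>\<mu> \<nu>.
        stieltjes_measure_of {0..} (t_fun n R c) \<mu> \<and>
        complex_of_real (measure \<mu> {0..}) = 1 / of_nat n * mat_trace R \<and>
        set_integrable \<mu> {0..} (\<lambda>l. l) \<and>
        complex_of_real (LINT l:{0..}|\<mu>. l) =
          of_real c * (1 / of_nat n * mat_trace R) * (1 / of_nat n * mat_trace (R * R)) \<and>
        stieltjes_mat_measure_of n {0..} (T_fun n R c) \<nu> \<and>
        \<nu> {0..} = 1\<^sub>m n \<and>
        (\<forall>B\<in>sets borel. complex_of_real (measure \<mu> B) = 1 / of_nat n * mat_trace (R * \<nu> B))"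
proof -
  from S_spectral_measure have "\<forall>k. \<exists>M. k < n \<longrightarrow> real_distribution M \<and> measure M {..<0} = 0 \<and>
    (\<forall>z. Im z > 0 \<longrightarrow> S z (T z) k = (LINT x|M. 1 / (of_real x - z))) \<and>
    has_bochner_integral M (\<lambda>x. x) (c * m * r k)" by blast
  then obtain M where M: "\<And>k. k < n \<Longrightarrow> real_distribution (M k) \<and> measure (M k) {..<0} = 0 \<and>
    (\<forall>z. Im z > 0 \<longrightarrow> S z (T z) k = (LINT x|M k. 1 / (of_real x - z))) \<and>
    has_bochner_integral (M k) (\<lambda>x. x) (c * m * r k)" by metis
  have 1: "real_distribution (M k)" if "k < n" for k
    using M[OF that] by (rule conjunct1)
  have 2: "measure (M k) {..<0} = 0" if "k < n" for k
    using M[OF that] by (elim conjE)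
  have 3: "S z (T z) k = (LINT x|M k. 1 / (of_real x - z))" if "k < n" "Im z > 0" for k z
    using M[OF that(1)] that(2) by (elim conjE allE[of _ z] impE)
  have 4: "has_bochner_integral (M k) (\<lambda>x. x) (c * m * r k)" if "k < n" for k
    using M[OF that] by (elim conjE)
  interpret matrix_system_with_measures n r c U M
    by (intro matrix_system_with_measures.intro matrix_system_axioms mixture_of_distributions.intro
        matrix_system_with_measures_axioms.intro n 1 2 3 4)
  show ?thesis
    by (intro exI[of _ \<mu>] exI[of _ \<nu>] conjI ballI)
      (fact stieltjes_measure_of_\<mu> mass_\<mu> first_moment_\<mu> stieltjes_mat_measure_of_\<nu> mass_\<nu> trace_formula)+
qed

text \<open>
  The bounds on the eigenvalues come from the quadratic forms at the columns of \<open>U\<close>.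
\<close>

lemma matrix_system_of_hermitian:
  assumes n: "n \<ge> 1" and c: "c > 0" and a: "a > 0" and R: "pd_mat n R"
    and ge: "psd_mat n (R - complex_of_real a \<cdot>\<^sub>m 1\<^sub>m n)"
    and less: "pd_mat n (complex_of_real b \<cdot>\<^sub>m 1\<^sub>m n - R)"
  shows "\<exists>U r. matrix_system n r c U \<and> R = spectral_mat n U (\<lambda>k. complex_of_real (r k)) \<and>
    (\<forall>k<n. a \<le> r k \<and> r k \<le> b)"
proof -
  have "R \<in> carrier_mat n n" "mat_adjoint R = R" using R by (auto simp: pd_mat_def)
  from hermitian_diagonalization[OF this] obtain U r
    where U: "unitary_mat n U" and Req: "R = spectral_mat n U (\<lambda>k. complex_of_real (r k))" by blast
  interpret spectral_calculus n U by unfold_locales (rule U)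
  have "R - complex_of_real a \<cdot>\<^sub>m 1\<^sub>m n = H (\<lambda>k. complex_of_real (r k - a))"
    "complex_of_real b \<cdot>\<^sub>m 1\<^sub>m n - R = H (\<lambda>k. complex_of_real (b - r k))"
    unfolding Req H_one[symmetric] H_smult H_diff by simp_all
  then have 1: "a \<le> r k" "r k \<le> b" if "k < n" for k
    using psd_H_D[of "\<lambda>k. complex_of_real (r k - a)" k] pd_H_D[of "\<lambda>k. complex_of_real (b - r k)" k] ge less that by auto
  have "matrix_system n r c U"
    by unfold_locales (use n c a 1(1) in \<open>auto intro: less_le_trans\<close>)
  then show ?thesis using Req 1 by blast
qed

theorem proposition5:
  fixes L :: nat and M :: "nat \<Rightarrow> nat" and c :: "nat \<Rightarrow> real" and c_star a b :: real
    and R :: "nat \<Rightarrow> complex mat"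
  assumes L: "L \<ge> 1"
    and M: "\<And>N. N \<ge> 1 \<Longrightarrow> M N \<ge> 1"
    and c: "\<And>N. N \<ge> 1 \<Longrightarrow> c N = real (M N) * real L / real N"
    and c_lim: "c \<longlonglongrightarrow> c_star" and c_star: "c_star > 0"
    and ab: "a > 0" "b > 0"
    and R_pd: "\<And>N. N \<ge> 1 \<Longrightarrow> pd_mat (M N) (R N)"
    and R_ge: "\<And>N. N \<ge> 1 \<Longrightarrow> psd_mat (M N) (R N - complex_of_real a \<cdot>\<^sub>m 1\<^sub>m (M N))"
    and R_less: "\<And>N. N \<ge> 1 \<Longrightarrow> pd_mat (M N) (complex_of_real b \<cdot>\<^sub>m 1\<^sub>m (M N) - R N)"
  shows
    "(\<forall>N\<ge>1. \<forall>z. Im z > 0 \<longrightarrow> (\<exists>!t. canonical_solution (M N) (R N) (c N) z t)) \<and>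
     (\<forall>N\<ge>1. \<exists>\<mu> \<nu>.
        stieltjes_measure_of {0..} (t_fun (M N) (R N) (c N)) \<mu> \<and>
        complex_of_real (measure \<mu> {0..}) = 1 / of_nat (M N) * mat_trace (R N) \<and>
        set_integrable \<mu> {0..} (\<lambda>l. l) \<and>
        complex_of_real (LINT l:{0..}|\<mu>. l) =
          of_real (c N) * (1 / of_nat (M N) * mat_trace (R N))
            * (1 / of_nat (M N) * mat_trace (R N * R N)) \<and>
        stieltjes_mat_measure_of (M N) {0..} (T_fun (M N) (R N) (c N)) \<nu> \<and>
        \<nu> {0..} = 1\<^sub>m (M N) \<and>
        (\<forall>B\<in>sets borel. complex_of_real (measure \<mu> B) =
           1 / of_nat (M N) * mat_trace (R N * \<nu> B))) \<and>
     (\<exists>\<beta> \<kappa> :: real. \<beta> > 0 \<and> \<kappa> > 0 \<and>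
        (\<forall>N\<ge>1. \<forall>z. Im z > 0 \<longrightarrow>
           1 / cmod (1 - z * (of_real (c N) * t_fun (M N) (R N) (c N) z)\<^sup>2)
             \<le> \<kappa> * (\<beta>\<^sup>2 + (cmod z)\<^sup>2)\<^sup>2 / (Im z) ^ 3))"
proof (intro conjI allI impI)
  have c_pos: "c N > 0" if "N \<ge> 1" for N
    using c[OF that] M[OF that] L that by simp
  show "\<exists>!t. canonical_solution (M N) (R N) (c N) z t" if N: "N \<ge> 1" and z: "Im z > 0" for N z
  proof -
    obtain U r where "matrix_system (M N) r (c N) U" "R N = spectral_mat (M N) U (\<lambda>k. complex_of_real (r k))"
      using matrix_system_of_hermitian[OF M[OF N] c_pos[OF N] ab(1) R_pd[OF N] R_ge[OF N] R_less[OF N]] by blast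
    then show ?thesis using matrix_system.canonical_solution_unique z by metis
  qed
  show "\<exists>\<mu> \<nu>.
        stieltjes_measure_of {0..} (t_fun (M N) (R N) (c N)) \<mu> \<and>
        complex_of_real (measure \<mu> {0..}) = 1 / of_nat (M N) * mat_trace (R N) \<and>
        set_integrable \<mu> {0..} (\<lambda>l. l) \<and>
        complex_of_real (LINT l:{0..}|\<mu>. l) =
          of_real (c N) * (1 / of_nat (M N) * mat_trace (R N))
            * (1 / of_nat (M N) * mat_trace (R N * R N)) \<and>
        stieltjes_mat_measure_of (M N) {0..} (T_fun (M N) (R N) (c N)) \<nu> \<and>
        \<nu> {0..} = 1\<^sub>m (M N) \<and>
        (\<forall>B\<in>sets borel. complex_of_real (measure \<mu> B) =
           1 / of_nat (M N) * mat_trace (R N * \<nu> B))" if N: "N \<ge> 1" for N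
  proof -
    obtain U r where ms: "matrix_system (M N) r (c N) U" and R: "R N = spectral_mat (M N) U (\<lambda>k. complex_of_real (r k))"
      using matrix_system_of_hermitian[OF M[OF N] c_pos[OF N] ab(1) R_pd[OF N] R_ge[OF N] R_less[OF N]] by blast
    show ?thesis unfolding R by (rule matrix_system.spectral_measures_exist[OF ms])
  qed
  have "Bseq c" using c_lim by (intro convergent_imp_Bseq) (auto simp: convergent_def)
  then obtain C where C: "C > 0" "\<And>N. \<bar>c N\<bar> \<le> C" by (auto elim!: BseqE)
  define \<eta> where "\<eta> = 2 * C * b\<^sup>2"
  have \<eta>: "\<eta> > 0" using C ab by (simp add: \<eta>_def)
  show "\<exists>\<beta> \<kappa> :: real. \<beta> > 0 \<and> \<kappa> > 0 \<and>
        (\<forall>N\<ge>1. \<forall>z. Im z > 0 \<longrightarrow>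
           1 / cmod (1 - z * (of_real (c N) * t_fun (M N) (R N) (c N) z)\<^sup>2)
             \<le> \<kappa> * (\<beta>\<^sup>2 + (cmod z)\<^sup>2)\<^sup>2 / (Im z) ^ 3)"
  proof (rule exI[of _ \<eta>], rule exI[of _ "2 * b / (a * \<eta>)"], intro conjI allI impI)
    fix N :: nat and z :: complex assume N: "1 \<le> N" and z: "0 < Im z"
    obtain U r where ms: "matrix_system (M N) r (c N) U" and R: "R N = spectral_mat (M N) U (\<lambda>k. complex_of_real (r k))"
      and bounds: "\<And>k. k < M N \<Longrightarrow> a \<le> r k" "\<And>k. k < M N \<Longrightarrow> r k \<le> b"
      using matrix_system_of_hermitian[OF M[OF N] c_pos[OF N] ab(1) R_pd[OF N] R_ge[OF N] R_less[OF N]] by blast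
    interpret matrix_system "M N" r "c N" U by (rule ms)
    have "c N \<le> C" using C(2)[of N] by simp
    then show "1 / cmod (1 - z * (of_real (c N) * t_fun (M N) (R N) (c N) z)\<^sup>2)
             \<le> 2 * b / (a * \<eta>) * (\<eta>\<^sup>2 + (cmod z)\<^sup>2)\<^sup>2 / (Im z) ^ 3"
      unfolding R t_fun_eq[OF z] \<eta>_def by (intro denominator_bound[OF bounds ab(1) _ z])
  qed (use ab \<eta> in auto)
qed

end
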